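(* Let $\mathcal C$ be a $K$-linear, Krull-Schmidt, Hom-finite $2$-Calabi-Yau triangulated category with two basic cluster tilting objects $T=\bigoplus_{i=1}^nT_i$ and $M=\bigoplus_{i=1}^nM_i$. Let $U$ be the maximal direct summand of $T$ satisfying $U\in\mathrm{add}(T)\cap\mathrm{add}(M)$. If $M$ is $T$-mutation-reachable, then there exists a sequence of mutations $(\mu_{Y_1},\dots,\mu_{Y_m})$ such that $M=\mu_{Y_m}\cdots\mu_{Y_2}\mu_{Y_1}(T)$ (up to isomorphism) and $Y_j\notin\mathrm{add}(U)$ for $j=1,\dots,m$.
   Context: $K$ is a field and $[1]$ denotes the shift functor. $\mathcal C$ is $2$-Calabi-Yau if there are bifunctorial isomorphisms $\mathrm{Hom}_{\mathcal C}(X,Y)\cong D\,\mathrm{Hom}_{\mathcal C}(Y,X[2])$, $D=\mathrm{Hom}_K(-,K)$. For an object $X$, $\mathrm{add}(X)$ is the full subcategory of direct summands of finite direct sums of copies of $X$. An object is basic if its indecomposable direct summands are pairwise non-isomorphic. An object $T$ is cluster tilting if $\mathrm{add}(T)=\{X\in\mathcal C\mid \mathrm{Hom}_{\mathcal C}(T,X[1])=0\}$. Mutation: an object $W$ is almost cluster tilting if $W\oplus X$ is cluster tilting for some indecomposable $X\notin\mathrm{add}(W)$. It is known (Iyama-Yoshino) that a basic almost cluster tilting object $W$ is a direct summand of exactly two (up to isomorphism) basic cluster tilting objects $T=W\oplus X$ and $T'=W\oplus Y$, $X\not\cong Y$; one writes $T'=\mu_X(T)$ and $T=\mu_Y(T')$.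 In a composite $\mu_{Y_m}\cdots\mu_{Y_1}(T)$, each $Y_{j+1}$ is an indecomposable direct summand of $\mu_{Y_j}\cdots\mu_{Y_1}(T)$. A rigid object $V$ (i.e. $\mathrm{Hom}_{\mathcal C}(V,V[1])=0$) is $T$-mutation-reachable if there is a basic cluster tilting object $N$ with $V\in\mathrm{add}(N)$ that can be obtained from $T$ by a finite sequence of mutations. *)

theory Defs
  imports Complex_Main "HOL-Library.FuncSet"
begin

text \<open>
  All Hom spaces are subspaces of one ambient \<open>K\<close>-vector space \<open>'m\<close>, and the composition and the action
  of the shift on morphisms are globally typed functions, constrained only on the Hom spaces.
  This is no loss of generality: for a \<open>K\<close>-linear category take for \<open>'m\<close> the direct sum of
  all its Hom spaces; a nonzero element of a summand then determines its domain and codomain,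
  and every composite with a zero morphism is zero.  The Hom spaces are not required to be
  disjoint, and nothing is said about \<open>Hom C X Y\<close> unless \<open>X\<close> and \<open>Y\<close> are objects of \<open>C\<close>.
  \<open>Tri C\<close> is the class of distinguished triangles, \<open>(X, Y, Z, u, v, w)\<close> standing for
  \<open>X \<rightarrow>u Y \<rightarrow>v Z \<rightarrow>w X[1]\<close>.
\<close>

record ('k, 'o, 'm) tricat =
  Ob :: "'o set"
  Hom :: "'o \<Rightarrow> 'o \<Rightarrow> 'm set"
  Idt :: "'o \<Rightarrow> 'm"
  Cmp :: "'m \<Rightarrow> 'm \<Rightarrow> 'm"  (infixl "\<cdot>\<index>" 70)
  Scl :: "'k \<Rightarrow> 'm \<Rightarrow> 'm"
  Sh :: "'o \<Rightarrow> 'o"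
  ShM :: "'m \<Rightarrow> 'm"
  Tri :: "('o \<times> 'o \<times> 'o \<times> 'm \<times> 'm \<times> 'm) set"


subsection \<open>Linear and additive categories\<close>

locale klinear_category = vector_space "Scl C"
  for C :: "('k::field, 'o, 'm::ab_group_add) tricat" (structure) +
  assumes Hom_subspace: "\<lbrakk>X \<in> Ob C; Y \<in> Ob C\<rbrakk> \<Longrightarrow> subspace (Hom C X Y)"
    and Idt_Hom: "X \<in> Ob C \<Longrightarrow> Idt C X \<in> Hom C X X"
    and Cmp_Hom: "\<lbrakk>X \<in> Ob C; Y \<in> Ob C; Z \<in> Ob C; f \<in> Hom C X Y; g \<in> Hom C Y Z\<rbrakk>
      \<Longrightarrow> g \<cdot> f \<in> Hom C X Z"
    and Idt_right: "\<lbrakk>X \<in> Ob C; Y \<in> Ob C; f \<in> Hom C X Y\<rbrakk> \<Longrightarrow> f \<cdot> Idt C X = f"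
    and Idt_left: "\<lbrakk>X \<in> Ob C; Y \<in> Ob C; f \<in> Hom C X Y\<rbrakk> \<Longrightarrow> Idt C Y \<cdot> f = f"
    and Cmp_assoc: "\<lbrakk>X \<in> Ob C; Y \<in> Ob C; Z \<in> Ob C; W \<in> Ob C;
        f \<in> Hom C X Y; g \<in> Hom C Y Z; h \<in> Hom C Z W\<rbrakk> \<Longrightarrow> (h \<cdot> g) \<cdot> f = h \<cdot> (g \<cdot> f)"
    and Cmp_add_left: "\<lbrakk>X \<in> Ob C; Y \<in> Ob C; Z \<in> Ob C;
        f \<in> Hom C X Y; g \<in> Hom C Y Z; g' \<in> Hom C Y Z\<rbrakk> \<Longrightarrow> (g + g') \<cdot> f = g \<cdot> f + g' \<cdot> f"
    and Cmp_add_right: "\<lbrakk>X \<in> Ob C; Y \<in> Ob C; Z \<in> Ob C;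
        f \<in> Hom C X Y; f' \<in> Hom C X Y; g \<in> Hom C Y Z\<rbrakk> \<Longrightarrow> g \<cdot> (f + f') = g \<cdot> f + g \<cdot> f'"
    and Cmp_Scl_left: "\<lbrakk>X \<in> Ob C; Y \<in> Ob C; Z \<in> Ob C; f \<in> Hom C X Y; g \<in> Hom C Y Z\<rbrakk>
      \<Longrightarrow> Scl C s g \<cdot> f = Scl C s (g \<cdot> f)"
    and Cmp_Scl_right: "\<lbrakk>X \<in> Ob C; Y \<in> Ob C; Z \<in> Ob C; f \<in> Hom C X Y; g \<in> Hom C Y Z\<rbrakk>
      \<Longrightarrow> g \<cdot> Scl C s f = Scl C s (g \<cdot> f)"

definition iso_mor :: "('k, 'o, 'm, 'z) tricat_scheme \<Rightarrow> 'o \<Rightarrow> 'o \<Rightarrow> 'm \<Rightarrow> bool" where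
  "iso_mor C X Y f \<longleftrightarrow> f \<in> Hom C X Y \<and>
    (\<exists>g \<in> Hom C Y X. g \<cdot>\<^bsub>C\<^esub> f = Idt C X \<and> f \<cdot>\<^bsub>C\<^esub> g = Idt C Y)"

definition isomorphic_obs :: "('k, 'o, 'm, 'z) tricat_scheme \<Rightarrow> 'o \<Rightarrow> 'o \<Rightarrow> bool" where
  "isomorphic_obs C X Y \<longleftrightarrow> X \<in> Ob C \<and> Y \<in> Ob C \<and> (\<exists>f. iso_mor C X Y f)"

text \<open>
  \<open>is_direct_sum C [X\<^sub>1, \<dots>, X\<^sub>r] S\<close> means that \<open>S\<close> is a biproduct of \<open>X\<^sub>1, \<dots>, X\<^sub>r\<close>, hence it
  determines \<open>S\<close> up to isomorphism; for the empty list it says that \<open>S\<close> is a zero object.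
\<close>

definition is_direct_sum ::
    "('k, 'o, 'm::ab_group_add, 'z) tricat_scheme \<Rightarrow> 'o list \<Rightarrow> 'o \<Rightarrow> bool" where
  "is_direct_sum C Xs S \<longleftrightarrow> set Xs \<subseteq> Ob C \<and> S \<in> Ob C \<and>
    (\<exists>\<iota> \<pi>. (\<forall>i < length Xs. \<iota> i \<in> Hom C (Xs ! i) S \<and> \<pi> i \<in> Hom C S (Xs ! i)) \<and>
      (\<forall>i < length Xs. \<forall>j < length Xs.
        \<pi> j \<cdot>\<^bsub>C\<^esub> \<iota> i = (if i = j then Idt C (Xs ! i) else 0)) \<and>
      (\<Sum>i < length Xs. \<iota> i \<cdot>\<^bsub>C\<^esub> \<pi> i) = Idt C S)"

abbreviation zero_ob :: "('k, 'o, 'm::ab_group_add, 'z) tricat_scheme \<Rightarrow> 'o \<Rightarrow> bool" where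
  "zero_ob C Z \<equiv> is_direct_sum C [] Z"

locale additive_klinear_category = klinear_category C
  for C :: "('k::field, 'o, 'm::ab_group_add) tricat" (structure) +
  assumes ex_zero_ob: "\<exists>Z. zero_ob C Z"
    and ex_direct_sum: "\<lbrakk>X \<in> Ob C; Y \<in> Ob C\<rbrakk> \<Longrightarrow> \<exists>S. is_direct_sum C [X, Y] S"


subsection \<open>Triangulated categories\<close>

definition candidate_triangle ::
    "('k, 'o, 'm, 'z) tricat_scheme \<Rightarrow> 'o \<times> 'o \<times> 'o \<times> 'm \<times> 'm \<times> 'm \<Rightarrow> bool" where
  "candidate_triangle C = (\<lambda>(X, Y, Z, u, v, w). X \<in> Ob C \<and> Y \<in> Ob C \<and> Z \<in> Ob C \<and>
    u \<in> Hom C X Y \<and> v \<in> Hom C Y Z \<and> w \<in> Hom C Z (Sh C X))"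

text \<open>The shift is only required to be an autoequivalence, not a strict automorphism.\<close>

locale triangulated_klinear_category = additive_klinear_category C
  for C :: "('k::field, 'o, 'm::ab_group_add) tricat" (structure) +
  assumes Sh_Ob: "X \<in> Ob C \<Longrightarrow> Sh C X \<in> Ob C"
    and ShM_Idt: "X \<in> Ob C \<Longrightarrow> ShM C (Idt C X) = Idt C (Sh C X)"
    and ShM_Cmp: "\<lbrakk>X \<in> Ob C; Y \<in> Ob C; Z \<in> Ob C; f \<in> Hom C X Y; g \<in> Hom C Y Z\<rbrakk>
      \<Longrightarrow> ShM C (g \<cdot> f) = ShM C g \<cdot> ShM C f"
    and ShM_add: "\<lbrakk>X \<in> Ob C; Y \<in> Ob C; f \<in> Hom C X Y; g \<in> Hom C X Y\<rbrakk>
      \<Longrightarrow> ShM C (f + g) = ShM C f + ShM C g"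
    and ShM_Scl: "\<lbrakk>X \<in> Ob C; Y \<in> Ob C; f \<in> Hom C X Y\<rbrakk>
      \<Longrightarrow> ShM C (Scl C s f) = Scl C s (ShM C f)"
    and ShM_fully_faithful: "\<lbrakk>X \<in> Ob C; Y \<in> Ob C\<rbrakk>
      \<Longrightarrow> bij_betw (ShM C) (Hom C X Y) (Hom C (Sh C X) (Sh C Y))"
    and Sh_ess_surj: "Y \<in> Ob C \<Longrightarrow> \<exists>X \<in> Ob C. isomorphic_obs C (Sh C X) Y"
    and Tri_candidate: "t \<in> Tri C \<Longrightarrow> candidate_triangle C t"
    and TR1_iso: "\<lbrakk>(X, Y, Z, u, v, w) \<in> Tri C; candidate_triangle C (X', Y', Z', u', v', w');
        iso_mor C X X' a; iso_mor C Y Y' b; iso_mor C Z Z' c;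
        b \<cdot> u = u' \<cdot> a; c \<cdot> v = v' \<cdot> b; ShM C a \<cdot> w = w' \<cdot> c\<rbrakk>
      \<Longrightarrow> (X', Y', Z', u', v', w') \<in> Tri C"
    and TR1_Idt: "\<lbrakk>X \<in> Ob C; zero_ob C Z\<rbrakk> \<Longrightarrow> (X, X, Z, Idt C X, 0, 0) \<in> Tri C"
    and TR1_cone: "\<lbrakk>X \<in> Ob C; Y \<in> Ob C; u \<in> Hom C X Y\<rbrakk> \<Longrightarrow> \<exists>Z v w. (X, Y, Z, u, v, w) \<in> Tri C"
    and TR2: "candidate_triangle C (X, Y, Z, u, v, w)
      \<Longrightarrow> (X, Y, Z, u, v, w) \<in> Tri C \<longleftrightarrow> (Y, Z, Sh C X, v, w, - ShM C u) \<in> Tri C"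
    and TR3: "\<lbrakk>(X, Y, Z, u, v, w) \<in> Tri C; (X', Y', Z', u', v', w') \<in> Tri C;
        a \<in> Hom C X X'; b \<in> Hom C Y Y'; b \<cdot> u = u' \<cdot> a\<rbrakk>
      \<Longrightarrow> \<exists>c \<in> Hom C Z Z'. c \<cdot> v = v' \<cdot> b \<and> ShM C a \<cdot> w = w' \<cdot> c"
    and TR4: "\<lbrakk>(X, Y, Z', u, i, i') \<in> Tri C; (Y, Z, X', v, j, j') \<in> Tri C;
        (X, Z, Y', v \<cdot> u, k, k') \<in> Tri C\<rbrakk>
      \<Longrightarrow> \<exists>f \<in> Hom C Z' Y'. \<exists>g \<in> Hom C Y' X'.
            f \<cdot> i = k \<cdot> v \<and> k' \<cdot> f = i' \<and> g \<cdot> k = j \<and> j' \<cdot> g = ShM C u \<cdot> k' \<and>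
            (Z', Y', X', f, g, ShM C i \<cdot> j') \<in> Tri C"


subsection \<open>Finiteness and duality\<close>

definition hom_finite :: "('k::field, 'o, 'm::ab_group_add, 'z) tricat_scheme \<Rightarrow> bool" where
  "hom_finite C \<longleftrightarrow>
    (\<forall>X \<in> Ob C. \<forall>Y \<in> Ob C. \<exists>B. finite B \<and> module.span (Scl C) B = Hom C X Y)"

text \<open>A ring is local if it is nonzero and the sum of two non-units is a non-unit.\<close>

definition local_End :: "('k, 'o, 'm::ab_group_add, 'z) tricat_scheme \<Rightarrow> 'o \<Rightarrow> bool" where
  "local_End C X \<longleftrightarrow> Idt C X \<noteq> 0 \<and>
    (\<forall>f \<in> Hom C X X. \<forall>g \<in> Hom C X X.
      \<not> iso_mor C X X f \<and> \<not> iso_mor C X X g \<longrightarrow> \<not> iso_mor C X X (f + g))"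

definition krull_schmidt :: "('k, 'o, 'm::ab_group_add, 'z) tricat_scheme \<Rightarrow> bool" where
  "krull_schmidt C \<longleftrightarrow>
    (\<forall>X \<in> Ob C. \<exists>Xs. is_direct_sum C Xs X \<and> (\<forall>Y \<in> set Xs. local_End C Y))"

text \<open>
  The dual \<open>Hom\<^sub>K(V, K)\<close> of a subspace \<open>V\<close>; functionals are normalised to be \<open>undefined\<close> outside
  \<open>V\<close>, so that they are determined by their values on \<open>V\<close>.
\<close>

definition dual_space ::
    "('k::field, 'o, 'm::ab_group_add, 'z) tricat_scheme \<Rightarrow> 'm set \<Rightarrow> ('m \<Rightarrow> 'k) set" where
  "dual_space C V = {\<xi> \<in> extensional V.
    (\<forall>f \<in> V. \<forall>g \<in> V. \<xi> (f + g) = \<xi> f + \<xi> g) \<and> (\<forall>a. \<forall>f \<in> V. \<xi> (Scl C a f) = a * \<xi> f)}"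

text \<open>
  \<open>\<phi> X Y\<close> is the isomorphism \<open>Hom(X, Y) \<cong> D Hom(Y, X[2])\<close>.  The last two conjuncts are naturality
  in \<open>X\<close> (contravariant) and in \<open>Y\<close> (covariant), evaluated at an arbitrary element \<open>h\<close> of the
  target Hom space.
\<close>

definition two_calabi_yau :: "('k::field, 'o, 'm::ab_group_add, 'z) tricat_scheme \<Rightarrow> bool" where
  "two_calabi_yau C \<longleftrightarrow> (\<exists>\<phi> :: 'o \<Rightarrow> 'o \<Rightarrow> 'm \<Rightarrow> 'm \<Rightarrow> 'k.
    (\<forall>X \<in> Ob C. \<forall>Y \<in> Ob C.
      bij_betw (\<phi> X Y) (Hom C X Y) (dual_space C (Hom C Y (Sh C (Sh C X)))) \<and>
      (\<forall>f \<in> Hom C X Y. \<forall>g \<in> Hom C X Y. \<forall>h \<in> Hom C Y (Sh C (Sh C X)).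
        \<phi> X Y (f + g) h = \<phi> X Y f h + \<phi> X Y g h) \<and>
      (\<forall>a. \<forall>f \<in> Hom C X Y. \<forall>h \<in> Hom C Y (Sh C (Sh C X)).
        \<phi> X Y (Scl C a f) h = a * \<phi> X Y f h)) \<and>
    (\<forall>X \<in> Ob C. \<forall>X' \<in> Ob C. \<forall>Y \<in> Ob C. \<forall>f \<in> Hom C X Y. \<forall>g \<in> Hom C X' X.
      \<forall>h \<in> Hom C Y (Sh C (Sh C X')).
        \<phi> X' Y (f \<cdot>\<^bsub>C\<^esub> g) h = \<phi> X Y f (ShM C (ShM C g) \<cdot>\<^bsub>C\<^esub> h)) \<and>
    (\<forall>X \<in> Ob C. \<forall>Y \<in> Ob C. \<forall>Y' \<in> Ob C. \<forall>f \<in> Hom C X Y. \<forall>g \<in> Hom C Y Y'.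
      \<forall>h \<in> Hom C Y' (Sh C (Sh C X)).
        \<phi> X Y' (g \<cdot>\<^bsub>C\<^esub> f) h = \<phi> X Y f (h \<cdot>\<^bsub>C\<^esub> g)))"


subsection \<open>Direct summands\<close>

definition direct_summand ::
    "('k, 'o, 'm::ab_group_add, 'z) tricat_scheme \<Rightarrow> 'o \<Rightarrow> 'o \<Rightarrow> bool" where
  "direct_summand C X S \<longleftrightarrow> (\<exists>Z. is_direct_sum C [X, Z] S)"

definition add_of :: "('k, 'o, 'm::ab_group_add, 'z) tricat_scheme \<Rightarrow> 'o \<Rightarrow> 'o set" where
  "add_of C X = {Y. \<exists>r S. is_direct_sum C (replicate r X) S \<and> direct_summand C Y S}"

definition indecomposable_ob ::
    "('k, 'o, 'm::ab_group_add, 'z) tricat_scheme \<Rightarrow> 'o \<Rightarrow> bool" where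
  "indecomposable_ob C X \<longleftrightarrow> X \<in> Ob C \<and> \<not> zero_ob C X \<and>
    (\<forall>A B. is_direct_sum C [A, B] X \<longrightarrow> zero_ob C A \<or> zero_ob C B)"

definition basic_ob :: "('k, 'o, 'm::ab_group_add, 'z) tricat_scheme \<Rightarrow> 'o \<Rightarrow> bool" where
  "basic_ob C X \<longleftrightarrow> X \<in> Ob C \<and>
    (\<forall>Xs. is_direct_sum C Xs X \<and> (\<forall>Y \<in> set Xs. indecomposable_ob C Y) \<longrightarrow>
      (\<forall>i < length Xs. \<forall>j < length Xs. i \<noteq> j \<longrightarrow> \<not> isomorphic_obs C (Xs ! i) (Xs ! j)))"


subsection \<open>Cluster tilting objects and mutation\<close>

definition rigid_ob :: "('k, 'o, 'm::ab_group_add, 'z) tricat_scheme \<Rightarrow> 'o \<Rightarrow> bool" where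
  "rigid_ob C V \<longleftrightarrow> V \<in> Ob C \<and> Hom C V (Sh C V) = {0}"

definition cluster_tilting :: "('k, 'o, 'm::ab_group_add, 'z) tricat_scheme \<Rightarrow> 'o \<Rightarrow> bool" where
  "cluster_tilting C T \<longleftrightarrow> T \<in> Ob C \<and> add_of C T = {X \<in> Ob C. Hom C T (Sh C X) = {0}}"

definition almost_cluster_tilting ::
    "('k, 'o, 'm::ab_group_add, 'z) tricat_scheme \<Rightarrow> 'o \<Rightarrow> bool" where
  "almost_cluster_tilting C W \<longleftrightarrow> W \<in> Ob C \<and>
    (\<exists>X S. indecomposable_ob C X \<and> X \<notin> add_of C W \<and> is_direct_sum C [W, X] S \<and>
      cluster_tilting C S)"

text \<open>
  \<open>mutation C X T T'\<close> means \<open>T' = \<mu>\<^sub>X(T)\<close>.  It is a relation because \<open>T'\<close> is determined by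
  \<open>T\<close> and \<open>X\<close> only up to isomorphism.
\<close>

definition mutation :: "('k, 'o, 'm::ab_group_add, 'z) tricat_scheme \<Rightarrow> 'o \<Rightarrow> 'o \<Rightarrow> 'o \<Rightarrow> bool" where
  "mutation C X T T' \<longleftrightarrow>
    basic_ob C T \<and> cluster_tilting C T \<and> basic_ob C T' \<and> cluster_tilting C T' \<and>
    (\<exists>W Y. basic_ob C W \<and> almost_cluster_tilting C W \<and>
      indecomposable_ob C X \<and> indecomposable_ob C Y \<and> \<not> isomorphic_obs C X Y \<and>
      is_direct_sum C [W, X] T \<and> is_direct_sum C [W, Y] T')"

text \<open>
  \<open>mutation_seq C [Y\<^sub>1, \<dots>, Y\<^sub>m] T N\<close> means \<open>N \<cong> \<mu>\<^bsub>Y\<^sub>m\<^esub> \<cdots> \<mu>\<^bsub>Y\<^sub>1\<^esub>(T)\<close>: the head of the list is the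
  first mutation applied.
\<close>

primrec mutation_seq ::
    "('k, 'o, 'm::ab_group_add, 'z) tricat_scheme \<Rightarrow> 'o list \<Rightarrow> 'o \<Rightarrow> 'o \<Rightarrow> bool" where
  "mutation_seq C [] T N \<longleftrightarrow> isomorphic_obs C T N"
| "mutation_seq C (Y # Ys) T N \<longleftrightarrow> (\<exists>T'. mutation C Y T T' \<and> mutation_seq C Ys T' N)"

definition mutation_reachable ::
    "('k, 'o, 'm::ab_group_add, 'z) tricat_scheme \<Rightarrow> 'o \<Rightarrow> 'o \<Rightarrow> bool" where
  "mutation_reachable C T V \<longleftrightarrow> rigid_ob C V \<and>
    (\<exists>N. basic_ob C N \<and> cluster_tilting C N \<and> V \<in> add_of C N \<and> (\<exists>Ys. mutation_seq C Ys T N))"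

text \<open>
  \<open>U\<close> is a direct summand of \<open>T\<close> lying in \<open>add(T) \<inter> add(M)\<close> and is, up to isomorphism, maximal
  with respect to the relation of being a direct summand among all such objects.
\<close>

definition maximal_common_summand ::
    "('k, 'o, 'm::ab_group_add, 'z) tricat_scheme \<Rightarrow> 'o \<Rightarrow> 'o \<Rightarrow> 'o \<Rightarrow> bool" where
  "maximal_common_summand C T M U \<longleftrightarrow>
    direct_summand C U T \<and> U \<in> add_of C T \<inter> add_of C M \<and>
    (\<forall>V. direct_summand C V T \<and> V \<in> add_of C T \<inter> add_of C M \<and> direct_summand C U V \<longrightarrow>
      isomorphic_obs C V U)"

end

theory Submission
  imports Defs
begin

text \<open>
  Let \<open>U\<close> be a rigid object.  For every cluster tilting object \<open>T\<close> there is a cluster tilting object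
  having \<open>U\<close> as a direct summand, the Bongartz completion of \<open>U\<close> with respect to \<open>T\<close>.  The theorem
  follows from the fact that this construction turns a mutation \<open>T \<leadsto> T'\<close> into an isomorphism or into
  a single mutation of the completions, and in the latter case at an indecomposable outside
  \<open>add(U)\<close>.  If \<open>U\<close> already lies in \<open>add(T)\<close>, then the completion of \<open>U\<close> with respect to \<open>T\<close> is \<open>T\<close>
  itself.  So for a common summand \<open>U\<close> of \<open>T\<close> and \<open>M\<close>, completing every term of an arbitrary mutation
  sequence from \<open>T\<close> to \<open>M\<close> gives a sequence from \<open>T\<close> to \<open>M\<close> that never exchanges a summand of \<open>U\<close>.

  The completion is made of pieces that depend on one object at a time.  A left
  \<open>add(U[1])\<close>-approximation \<open>A \<rightarrow> U'[1]\<close> has a cocone \<open>B\<close>, and \<open>Hom(B, U[1]) = 0\<close>; conversely every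
  triangle \<open>U' \<rightarrow> B \<rightarrow> A \<rightarrow> U'[1]\<close> with \<open>U' \<in> add(U)\<close> and \<open>Hom(B, U[1]) = 0\<close> arises in this way.  This
  relation between \<open>A\<close> and \<open>B\<close> is called \<open>bongartz U A B\<close>.  It determines \<open>B\<close> up to summands in
  \<open>add(U)\<close> (lemma \<open>bongartz_unique\<close>) and is compatible with direct sums (\<open>bongartz_sum\<close>).  The completion
  is the basic object with the same indecomposable summands as \<open>B\<^sub>T \<oplus> U\<close>.  It is rigid by
  \<open>bongartz_ext0_pair\<close>.  That it is cluster tilting rests on \<open>bongartz_coresolution\<close>: every \<open>Z\<close> with
  \<open>Hom(Z, U[1]) = 0\<close> sits in a triangle \<open>Z \<rightarrow> V \<rightarrow> B \<rightarrow> Z[1]\<close> with \<open>bongartz U A V\<close> and \<open>bongartz U T\<^sub>0 B\<close> for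
  some \<open>A, T\<^sub>0 \<in> add(T)\<close>, and if \<open>Z\<close> has no extensions with the completion this triangle splits.

  Now let \<open>T = W \<oplus> X\<close> and \<open>T' = W \<oplus> Y\<close> be related by a mutation.  The two completions share the piece
  coming from \<open>W\<close>, so it is enough to see that the completion of \<open>T\<close> has, up to isomorphism, at most one
  indecomposable summand \<open>P\<close> outside that piece.  This is a rank count
  (\<open>bongartz_new_summand_unique\<close>): for such a \<open>P\<close> the split triangle above gives \<open>V \<cong> P \<oplus> B\<close>, and the
  multiplicities in \<open>V\<close> and \<open>B\<close> of any summand outside the common piece are \<open>a\<close> and \<open>b\<close> times the one in
  \<open>B\<^sub>X\<close>, where \<open>a\<close> and \<open>b\<close> are the multiplicities of \<open>X\<close> in \<open>A\<close> and \<open>T\<^sub>0\<close>.  A second such summand \<open>Q\<close> would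
  force \<open>a = b\<close>, which contradicts the equation for \<open>P\<close>.

  All bookkeeping with direct sums is done with the multiplicities of the Krull-Schmidt theorem, which
  is proved first.  They determine an object up to isomorphism, so \<open>add\<close>, basic objects and the
  splitting off of summands turn into statements about natural numbers.
\<close>

section \<open>Morphisms and biproducts in linear categories\<close>

context klinear_category
begin

definition arr :: "'m \<Rightarrow> 'o \<Rightarrow> 'o \<Rightarrow> bool" where
  "arr f X Y \<longleftrightarrow> X \<in> Ob C \<and> Y \<in> Ob C \<and> f \<in> Hom C X Y"

text \<open>
  Rewriting with associativity needs the types of the factors.  For the innermost factor, which may be
  a long composite, the codomain is all that matters; a predicate on the codomain alone can be
  discharged by the simplifier, since it leaves no domain to be guessed.
\<close>

definition into :: "'m \<Rightarrow> 'o \<Rightarrow> bool" where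
  "into f Y \<longleftrightarrow> (\<exists>X. arr f X Y)"

lemma arr_Hom: "arr f X Y \<Longrightarrow> f \<in> Hom C X Y"
  and arr_dom: "arr f X Y \<Longrightarrow> X \<in> Ob C"
  and arr_cod: "arr f X Y \<Longrightarrow> Y \<in> Ob C"
  by (auto simp: arr_def)

lemma arr_comp: "\<lbrakk>arr f X Y; arr g Y Z\<rbrakk> \<Longrightarrow> arr (g \<cdot> f) X Z"
  by (auto simp: arr_def intro: Cmp_Hom)

lemma arr_Idt: "X \<in> Ob C \<Longrightarrow> arr (Idt C X) X X"
  by (auto simp: arr_def Idt_Hom)

lemma arr_zero: "\<lbrakk>X \<in> Ob C; Y \<in> Ob C\<rbrakk> \<Longrightarrow> arr 0 X Y"
  by (auto simp: arr_def subspace_0 Hom_subspace)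

lemma arr_add: "\<lbrakk>arr f X Y; arr g X Y\<rbrakk> \<Longrightarrow> arr (f + g) X Y"
  and arr_diff: "\<lbrakk>arr f X Y; arr g X Y\<rbrakk> \<Longrightarrow> arr (f - g) X Y"
  and arr_uminus: "arr f X Y \<Longrightarrow> arr (- f) X Y"
  by (auto simp: arr_def subspace_add subspace_diff subspace_neg Hom_subspace)

lemma arr_sum: "\<lbrakk>X \<in> Ob C; Y \<in> Ob C; \<And>i. i \<in> I \<Longrightarrow> arr (f i) X Y\<rbrakk> \<Longrightarrow> arr (\<Sum>i\<in>I. f i) X Y"
  by (auto simp: arr_def subspace_sum Hom_subspace)

lemma arr_into: "arr f X Y \<Longrightarrow> into f Y"
  and into_comp: "\<lbrakk>arr g Y Z; into f Y\<rbrakk> \<Longrightarrow> into (g \<cdot> f) Z"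
  and into_Idt: "X \<in> Ob C \<Longrightarrow> into (Idt C X) X"
  by (auto simp: into_def intro: arr_comp arr_Idt)

lemma comp_assoc: "\<lbrakk>arr h Z W; arr g Y Z; into f Y\<rbrakk> \<Longrightarrow> (h \<cdot> g) \<cdot> f = h \<cdot> (g \<cdot> f)"
  by (auto simp: arr_def into_def intro: Cmp_assoc)

lemma comp_Idt_left: "into f Y \<Longrightarrow> Idt C Y \<cdot> f = f"
  and comp_Idt_right: "arr f X Y \<Longrightarrow> f \<cdot> Idt C X = f"
  by (auto simp: arr_def into_def intro: Idt_left Idt_right)

lemma comp_add_left: "\<lbrakk>arr g Y Z; arr g' Y Z; into f Y\<rbrakk> \<Longrightarrow> (g + g') \<cdot> f = g \<cdot> f + g' \<cdot> f"
  by (auto simp: arr_def into_def intro: Cmp_add_left)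

lemma comp_add_right: "\<lbrakk>arr g Y Z; arr f X Y; arr f' X Y\<rbrakk> \<Longrightarrow> g \<cdot> (f + f') = g \<cdot> f + g \<cdot> f'"
  by (auto simp: arr_def intro: Cmp_add_right)

lemma comp_zero_left: "into f Y \<Longrightarrow> 0 \<cdot> f = 0"
proof -
  assume f: "into f Y"
  then have "arr 0 Y Y" by (auto simp: into_def arr_def subspace_0 Hom_subspace)
  from comp_add_left[OF this this f] show ?thesis by simp
qed

lemma comp_zero_right: "arr g Y Z \<Longrightarrow> g \<cdot> 0 = 0"
proof -
  assume g: "arr g Y Z"
  then have "arr 0 Y Y" by (auto simp: arr_def subspace_0 Hom_subspace)
  from comp_add_right[OF g this this] show ?thesis by simp
qed

lemma comp_zero_left': "arr f X Y \<Longrightarrow> 0 \<cdot> f = 0"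
  and comp_zero_left'': "\<lbrakk>arr g Y Z; into f Y\<rbrakk> \<Longrightarrow> 0 \<cdot> (g \<cdot> f) = 0"
  by (auto intro: comp_zero_left arr_into into_comp)

lemma comp_uminus_left: "\<lbrakk>arr g Y Z; into f Y\<rbrakk> \<Longrightarrow> (- g) \<cdot> f = - (g \<cdot> f)"
  using comp_add_left[of g Y Z "- g" f] by (simp add: arr_uminus comp_zero_left eq_neg_iff_add_eq_0 add.commute)

lemma comp_uminus_right: "\<lbrakk>arr g Y Z; arr f X Y\<rbrakk> \<Longrightarrow> g \<cdot> (- f) = - (g \<cdot> f)"
  using comp_add_right[of g Y Z f X "- f"] by (simp add: arr_uminus comp_zero_right eq_neg_iff_add_eq_0 add.commute)

lemma comp_diff_left: "\<lbrakk>arr g Y Z; arr g' Y Z; into f Y\<rbrakk> \<Longrightarrow> (g - g') \<cdot> f = g \<cdot> f - g' \<cdot> f"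
  using comp_add_left[of g Y Z "- g'" f] by (simp add: arr_uminus comp_uminus_left)

lemma comp_diff_right: "\<lbrakk>arr g Y Z; arr f X Y; arr f' X Y\<rbrakk> \<Longrightarrow> g \<cdot> (f - f') = g \<cdot> f - g \<cdot> f'"
  using comp_add_right[of g Y Z f X "- f'"] by (simp add: arr_uminus comp_uminus_right)

lemma comp_sum_left:
  assumes "\<And>i. i \<in> I \<Longrightarrow> arr (g i) Y Z" "arr f X Y" "Z \<in> Ob C"
  shows "(\<Sum>i\<in>I. g i) \<cdot> f = (\<Sum>i\<in>I. g i \<cdot> f)"
  using assms(1)
proof (induction I rule: infinite_finite_induct)
  case (insert x F)
  have "arr (\<Sum>i\<in>F. g i) Y Z"
    using insert assms by (intro arr_sum) (auto dest: arr_cod)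
  then show ?case
    using insert assms by (simp add: comp_add_left[of "g x" Y Z _ f] arr_into[of f X Y])
qed (use assms arr_into[of f X Y] in \<open>auto intro: comp_zero_left\<close>)

lemma comp_sum_right:
  assumes "\<And>i. i \<in> I \<Longrightarrow> arr (f i) X Y" "arr g Y Z" "X \<in> Ob C"
  shows "g \<cdot> (\<Sum>i\<in>I. f i) = (\<Sum>i\<in>I. g \<cdot> f i)"
  using assms(1)
proof (induction I rule: infinite_finite_induct)
  case (insert x F)
  have "arr (\<Sum>i\<in>F. f i) X Y"
    using insert assms by (intro arr_sum) (auto dest: arr_dom)
  then show ?case
    using insert assms by (simp add: comp_add_right[of g Y Z "f x" X])
qed (use assms in \<open>auto intro: comp_zero_right\<close>)

lemma comp_lift: "\<lbrakk>g \<cdot> f = k; arr g Y Z; arr f X Y; into h X\<rbrakk> \<Longrightarrow> g \<cdot> (f \<cdot> h) = k \<cdot> h"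
  using comp_assoc[of g Y Z f X h] by simp

lemmas comp_simps = comp_assoc comp_Idt_left comp_Idt_right comp_zero_left' comp_zero_left''
  comp_zero_right   arr_into into_comp into_Idt


abbreviation isomorphic (infix "\<cong>" 50) where "X \<cong> Y \<equiv> isomorphic_obs C X Y"

lemma iso_mor_arr:
  assumes "X \<in> Ob C" "Y \<in> Ob C"
  shows "iso_mor C X Y f \<longleftrightarrow> arr f X Y \<and> (\<exists>g. arr g Y X \<and> g \<cdot> f = Idt C X \<and> f \<cdot> g = Idt C Y)"
  using assms by (auto simp: iso_mor_def arr_def)

lemma isoI: "\<lbrakk>arr f X Y; arr g Y X; g \<cdot> f = Idt C X; f \<cdot> g = Idt C Y\<rbrakk> \<Longrightarrow> X \<cong> Y"
  unfolding isomorphic_obs_def iso_mor_def by (auto simp: arr_def)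

lemma isoE:
  assumes "X \<cong> Y"
  obtains f g where "arr f X Y" "arr g Y X" "g \<cdot> f = Idt C X" "f \<cdot> g = Idt C Y"
  using assms unfolding isomorphic_obs_def iso_mor_def by (auto simp: arr_def)

lemma iso_refl: "X \<in> Ob C \<Longrightarrow> X \<cong> X"
  by (rule isoI[of "Idt C X" X X "Idt C X"]) (auto intro: arr_Idt comp_Idt_left into_Idt)

lemma iso_sym: "X \<cong> Y \<Longrightarrow> Y \<cong> X"
  by (meson isoE isoI)

lemma iso_trans:
  assumes "X \<cong> Y" "Y \<cong> Z" shows "X \<cong> Z"
proof -
  obtain f g where fg: "arr f X Y" "arr g Y X" "g \<cdot> f = Idt C X" "f \<cdot> g = Idt C Y"
    using assms(1) by (rule isoE)
  obtain h k where hk: "arr h Y Z" "arr k Z Y" "k \<cdot> h = Idt C Y" "h \<cdot> k = Idt C Z"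
    using assms(2) by (rule isoE)
  show ?thesis
    by (rule isoI[of "h \<cdot> f" X Z "g \<cdot> k"])
      (use fg hk in \<open>simp_all add: comp_simps arr_comp[of f X Y h Z] arr_comp[of k Z Y g X]
        comp_lift[OF hk(3)] comp_lift[OF fg(4)]\<close>)
qed

lemma iso_Ob: "X \<cong> Y \<Longrightarrow> X \<in> Ob C" "X \<cong> Y \<Longrightarrow> Y \<in> Ob C"
  by (auto simp: isomorphic_obs_def)

lemma ds_Ob: "is_direct_sum C Xs S \<Longrightarrow> S \<in> Ob C"
  "is_direct_sum C Xs S \<Longrightarrow> X \<in> set Xs \<Longrightarrow> X \<in> Ob C"
  by (auto simp: is_direct_sum_def)

definition biproduct :: "'o \<Rightarrow> 'o \<Rightarrow> 'o \<Rightarrow> 'm \<Rightarrow> 'm \<Rightarrow> 'm \<Rightarrow> 'm \<Rightarrow> bool" where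
  "biproduct A B S i\<^sub>1 i\<^sub>2 p\<^sub>1 p\<^sub>2 \<longleftrightarrow>
    arr i\<^sub>1 A S \<and> arr i\<^sub>2 B S \<and> arr p\<^sub>1 S A \<and> arr p\<^sub>2 S B \<and>
    p\<^sub>1 \<cdot> i\<^sub>1 = Idt C A \<and> p\<^sub>2 \<cdot> i\<^sub>2 = Idt C B \<and> p\<^sub>2 \<cdot> i\<^sub>1 = 0 \<and> p\<^sub>1 \<cdot> i\<^sub>2 = 0 \<and>
    i\<^sub>1 \<cdot> p\<^sub>1 + i\<^sub>2 \<cdot> p\<^sub>2 = Idt C S"

lemma dsE:
  assumes "is_direct_sum C Xs S"
  obtains i p where "set Xs \<subseteq> Ob C" "S \<in> Ob C"
    "\<And>k. k < length Xs \<Longrightarrow> arr (i k) (Xs ! k) S" "\<And>k. k < length Xs \<Longrightarrow> arr (p k) S (Xs ! k)"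
    "\<And>k l. \<lbrakk>k < length Xs; l < length Xs\<rbrakk> \<Longrightarrow> p l \<cdot> i k = (if k = l then Idt C (Xs ! k) else 0)"
    "(\<Sum>k < length Xs. i k \<cdot> p k) = Idt C S"
proof -
  from assms obtain i p where ip: "set Xs \<subseteq> Ob C" "S \<in> Ob C"
    "\<forall>k < length Xs. i k \<in> Hom C (Xs ! k) S \<and> p k \<in> Hom C S (Xs ! k)"
    "\<forall>k < length Xs. \<forall>l < length Xs. p l \<cdot> i k = (if k = l then Idt C (Xs ! k) else 0)"
    "(\<Sum>k < length Xs. i k \<cdot> p k) = Idt C S"
    unfolding is_direct_sum_def by (elim conjE exE) (rule that)
  then have ob: "Xs ! k \<in> Ob C" if "k < length Xs" for k using that by (simp add: subset_iff)
  show thesis by (rule that[of i p]) (use ip ob in \<open>simp_all add: arr_def\<close>)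
qed

lemma all_less_2: "(\<forall>i < Suc (Suc 0). P i) \<longleftrightarrow> P 0 \<and> P (Suc 0)"
  by (auto simp: less_Suc_eq)

lemma biproduct_ds: "biproduct A B S i1 i2 p1 p2 \<Longrightarrow> is_direct_sum C [A, B] S"
  unfolding is_direct_sum_def biproduct_def arr_def
  by (intro conjI exI[of _ "\<lambda>k. if k = 0 then i1 else i2"]
      exI[of _ "\<lambda>k. if k = 0 then p1 else p2"]) (auto simp: all_less_2)

lemma ds_biproductE:
  assumes "is_direct_sum C [A, B] S"
  obtains i1 i2 p1 p2 where "biproduct A B S i1 i2 p1 p2"
proof -
  from assms obtain i p where ip:
    "A \<in> Ob C" "B \<in> Ob C" "S \<in> Ob C"
    "\<forall>k < length [A,B]. i k \<in> Hom C ([A,B] ! k) S \<and> p k \<in> Hom C S ([A,B] ! k)"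
    "\<forall>k < length [A,B]. \<forall>l < length [A,B].
      p l \<cdot> i k = (if k = l then Idt C ([A,B] ! k) else 0)"
    "(\<Sum>k < length [A,B]. i k \<cdot> p k) = Idt C S"
    unfolding is_direct_sum_def by auto
  have "biproduct A B S (i 0) (i 1) (p 0) (p 1)"
    using ip by (auto simp: biproduct_def arr_def all_less_2)
  then show thesis by (rule that)
qed

lemma zero_ob_iff: "zero_ob C Z \<longleftrightarrow> Z \<in> Ob C \<and> Idt C Z = 0"
  by (auto simp: is_direct_sum_def)

lemma zero_ob_arr:
  assumes "zero_ob C Z"
  shows "arr f X Z \<Longrightarrow> f = 0" "arr f Z X \<Longrightarrow> f = 0"
  using assms comp_Idt_left[of f Z] comp_Idt_right[of f Z X] comp_zero_left[of f Z] comp_zero_right[of f Z X]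
  by (auto simp: zero_ob_iff dest: arr_into)

lemma ds_iso:
  assumes "is_direct_sum C Xs S" "S \<cong> S'"
  shows "is_direct_sum C Xs S'"
proof -
  obtain f g where fg: "arr f S S'" "arr g S' S" "g \<cdot> f = Idt C S" "f \<cdot> g = Idt C S'"
    using assms(2) by (rule isoE)
  obtain i p where ip: "set Xs \<subseteq> Ob C" "S \<in> Ob C"
    "\<And>k. k < length Xs \<Longrightarrow> arr (i k) (Xs ! k) S" "\<And>k. k < length Xs \<Longrightarrow> arr (p k) S (Xs ! k)"
    "\<And>k l. \<lbrakk>k < length Xs; l < length Xs\<rbrakk> \<Longrightarrow> p l \<cdot> i k = (if k = l then Idt C (Xs ! k) else 0)"
    "(\<Sum>k < length Xs. i k \<cdot> p k) = Idt C S"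
    using assms(1) by (rule dsE) (rule that)
  let ?i = "\<lambda>k. f \<cdot> i k" and ?p = "\<lambda>k. p k \<cdot> g"
  have a: "arr (?i k) (Xs ! k) S'" "arr (?p k) S' (Xs ! k)" if "k < length Xs" for k
    using ip(3,4)[OF that] fg by (auto intro: arr_comp)
  have b: "?p l \<cdot> ?i k = (if k = l then Idt C (Xs ! k) else 0)"
    if "k < length Xs" "l < length Xs" for k l
    using ip(3)[OF that(1)] ip(4)[OF that(2)] ip(5)[OF that] fg(1,2)
    by (simp add: comp_simps comp_lift[OF fg(3)])
  have "(\<Sum>k < length Xs. ?i k \<cdot> ?p k) = (\<Sum>k < length Xs. f \<cdot> ((i k \<cdot> p k) \<cdot> g))"
  proof (rule sum.cong[OF refl])
    fix k assume "k \<in> {..<length Xs}"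
    then have "arr (i k) (Xs ! k) S" "arr (p k) S (Xs ! k)" using ip by auto
    then show "?i k \<cdot> ?p k = f \<cdot> ((i k \<cdot> p k) \<cdot> g)" using fg(1,2) by (simp add: comp_simps)
  qed
  also have "\<dots> = f \<cdot> (\<Sum>k < length Xs. (i k \<cdot> p k) \<cdot> g)"
    by (rule comp_sum_right[symmetric, OF _ fg(1)])
      (use ip(3,4) fg in \<open>auto intro!: arr_comp dest: arr_dom\<close>)
  also have "(\<Sum>k < length Xs. (i k \<cdot> p k) \<cdot> g) = (\<Sum>k < length Xs. i k \<cdot> p k) \<cdot> g"
    by (rule comp_sum_left[symmetric, OF _ fg(2)])
      (use ip(2,3,4) fg in \<open>auto intro!: arr_comp\<close>)
  also have "f \<cdot> ((\<Sum>k < length Xs. i k \<cdot> p k) \<cdot> g) = Idt C S'"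
    unfolding ip(6) using fg by (simp add: comp_simps)
  finally show ?thesis
    unfolding is_direct_sum_def using a b ip(1) iso_Ob[OF assms(2)]
    by (intro conjI exI[of _ ?i] exI[of _ ?p]) (auto simp: arr_def)
qed

text \<open>
  The canonical comparison morphisms \<open>\<Sum> j\<^sub>k p\<^sub>k\<close> and \<open>\<Sum> i\<^sub>k q\<^sub>k\<close> are inverse to each other.  Both
  composites have the same form, so one computation with the roles of the data exchanged gives both.
\<close>

lemma ds_unique:
  assumes "is_direct_sum C Xs S" "is_direct_sum C Xs S'"
  shows "S \<cong> S'"
proof -
  let ?n = "length Xs"
  obtain i p where ip: "set Xs \<subseteq> Ob C" "S \<in> Ob C"
    "\<And>k. k < length Xs \<Longrightarrow> arr (i k) (Xs ! k) S" "\<And>k. k < length Xs \<Longrightarrow> arr (p k) S (Xs ! k)"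
    "\<And>k l. \<lbrakk>k < length Xs; l < length Xs\<rbrakk> \<Longrightarrow> p l \<cdot> i k = (if k = l then Idt C (Xs ! k) else 0)"
    "(\<Sum>k < length Xs. i k \<cdot> p k) = Idt C S"
    using assms(1) by (rule dsE) (rule that)
  obtain j q where jq: "set Xs \<subseteq> Ob C" "S' \<in> Ob C"
    "\<And>k. k < length Xs \<Longrightarrow> arr (j k) (Xs ! k) S'" "\<And>k. k < length Xs \<Longrightarrow> arr (q k) S' (Xs ! k)"
    "\<And>k l. \<lbrakk>k < length Xs; l < length Xs\<rbrakk> \<Longrightarrow> q l \<cdot> j k = (if k = l then Idt C (Xs ! k) else 0)"
    "(\<Sum>k < length Xs. j k \<cdot> q k) = Idt C S'"
    using assms(2) by (rule dsE) (rule that)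
  have *: "(\<Sum>k<?n. i k \<cdot> q k) \<cdot> (\<Sum>l<?n. j l \<cdot> p l) = (\<Sum>k<?n. i k \<cdot> p k)"
    if "S \<in> Ob C" "S' \<in> Ob C"
      "\<And>k. k < length Xs \<Longrightarrow> arr (i k) (Xs ! k) S" "\<And>k. k < length Xs \<Longrightarrow> arr (p k) S (Xs ! k)"
      "\<And>k. k < length Xs \<Longrightarrow> arr (j k) (Xs ! k) S'" "\<And>k. k < length Xs \<Longrightarrow> arr (q k) S' (Xs ! k)"
      "\<And>k l. \<lbrakk>k < length Xs; l < length Xs\<rbrakk> \<Longrightarrow> q l \<cdot> j k = (if k = l then Idt C (Xs ! k) else 0)"
    for S S' i p j q
  proof -
    have iq: "arr (i k \<cdot> q k) S' S" if "k < ?n" for k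
      by (rule arr_comp[OF \<open>\<And>k. k < ?n \<Longrightarrow> arr (q k) S' (Xs ! k)\<close>[OF that]
            \<open>\<And>k. k < ?n \<Longrightarrow> arr (i k) (Xs ! k) S\<close>[OF that]])
    have jp: "arr (j k \<cdot> p k) S S'" if "k < ?n" for k
      by (rule arr_comp[OF \<open>\<And>k. k < ?n \<Longrightarrow> arr (p k) S (Xs ! k)\<close>[OF that]
            \<open>\<And>k. k < ?n \<Longrightarrow> arr (j k) (Xs ! k) S'\<close>[OF that]])
    have "(\<Sum>k<?n. i k \<cdot> q k) \<cdot> (\<Sum>l<?n. j l \<cdot> p l) = (\<Sum>k<?n. (i k \<cdot> q k) \<cdot> (\<Sum>l<?n. j l \<cdot> p l))"
      by (rule comp_sum_left[where Y = S' and Z = S and X = S])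
        (use that(1,2) iq jp in \<open>auto intro!: arr_sum\<close>)
    also have "\<dots> = (\<Sum>k<?n. \<Sum>l<?n. (i k \<cdot> q k) \<cdot> (j l \<cdot> p l))"
      by (rule sum.cong[OF refl], rule comp_sum_right[where X = S and Y = S' and Z = S])
        (use that(1,2) iq jp in auto)
    also have "\<dots> = (\<Sum>k<?n. \<Sum>l<?n. if k = l then i k \<cdot> p k else 0)"
    proof (intro sum.cong[OF refl])
      fix k l assume "k \<in> {..<?n}" "l \<in> {..<?n}"
      then have kl: "k < ?n" "l < ?n" by auto
      note t = that(3)[OF kl(1)] that(4)[OF kl(2)] that(5)[OF kl(2)] that(6)[OF kl(1)]
      have "(i k \<cdot> q k) \<cdot> (j l \<cdot> p l) = i k \<cdot> ((q k \<cdot> j l) \<cdot> p l)"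
        using t by (simp add: comp_simps)
      also have "\<dots> = (if k = l then i k \<cdot> p k else 0)"
        using t by (auto simp add: that(7)[OF kl(2,1)] comp_simps)
      finally show "(i k \<cdot> q k) \<cdot> (j l \<cdot> p l) = (if k = l then i k \<cdot> p k else 0)" .
    qed
    also have "\<dots> = (\<Sum>k<?n. i k \<cdot> p k)"
      by (simp add: sum.delta)
    finally show ?thesis .
  qed
  show ?thesis
  proof (rule isoI[of "\<Sum>l<?n. j l \<cdot> p l" S S' "\<Sum>k<?n. i k \<cdot> q k"])
    show "(\<Sum>k<?n. i k \<cdot> q k) \<cdot> (\<Sum>l<?n. j l \<cdot> p l) = Idt C S"
      using *[of S S' i p j q] ip jq by simp
    show "(\<Sum>l<?n. j l \<cdot> p l) \<cdot> (\<Sum>k<?n. i k \<cdot> q k) = Idt C S'"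
      using *[of S' S j q i p] ip jq by simp
  qed (use ip jq in \<open>auto intro!: arr_sum arr_comp\<close>)
qed

text \<open>
  Together with its converse, which needs the existence of direct sums, this reduces sums of lists to
  binary biproducts.
\<close>

lemma ds_ConsI:
  assumes "is_direct_sum C Xs S'" "is_direct_sum C [X, S'] S"
  shows "is_direct_sum C (X # Xs) S"
proof -
  let ?n = "length Xs"
  obtain i p where ip: "set Xs \<subseteq> Ob C" "S' \<in> Ob C"
    "\<And>k. k < length Xs \<Longrightarrow> arr (i k) (Xs ! k) S'" "\<And>k. k < length Xs \<Longrightarrow> arr (p k) S' (Xs ! k)"
    "\<And>k l. \<lbrakk>k < length Xs; l < length Xs\<rbrakk> \<Longrightarrow> p l \<cdot> i k = (if k = l then Idt C (Xs ! k) else 0)"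
    "(\<Sum>k < length Xs. i k \<cdot> p k) = Idt C S'"
    using assms(1) by (rule dsE) (rule that)
  obtain i1 i2 p1 p2 where "biproduct X S' S i1 i2 p1 p2"
    using assms(2) by (rule ds_biproductE)
  then have b: "arr i1 X S" "arr i2 S' S" "arr p1 S X" "arr p2 S S'"
    and e: "p1 \<cdot> i1 = Idt C X" "p2 \<cdot> i2 = Idt C S'" "p2 \<cdot> i1 = 0" "p1 \<cdot> i2 = 0"
    "i1 \<cdot> p1 + i2 \<cdot> p2 = Idt C S"
    by (auto simp: biproduct_def)
  define j where "j = (\<lambda>k. case k of 0 \<Rightarrow> i1 | Suc k \<Rightarrow> i2 \<cdot> i k)"
  define q where "q = (\<lambda>k. case k of 0 \<Rightarrow> p1 | Suc k \<Rightarrow> p k \<cdot> p2)"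
  have t: "arr (j k) ((X # Xs) ! k) S \<and> arr (q k) S ((X # Xs) ! k)" if "k < length (X # Xs)" for k
    using that b ip by (cases k) (auto simp: j_def q_def intro: arr_comp)
  have o: "q l \<cdot> j k = (if k = l then Idt C ((X # Xs) ! k) else 0)"
    if "k < length (X # Xs)" "l < length (X # Xs)" for k l
  proof (cases k)
    case 0
    show ?thesis
    proof (cases l)
      case (Suc l')
      then have "arr (p l') S' (Xs ! l')" using that ip by auto
      then show ?thesis using Suc 0 e b by (simp add: j_def q_def comp_simps)
    qed (use 0 e in \<open>simp add: j_def q_def\<close>)
  next
    case (Suc k')
    then have i: "arr (i k') (Xs ! k') S'" using that ip by auto
    show ?thesis
    proof (cases l)
      case (Suc l')
      then have p: "arr (p l') S' (Xs ! l')" using that ip by auto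
      have "p l' \<cdot> i k' = (if k' = l' then Idt C (Xs ! k') else 0)"
        using that Suc \<open>k = Suc k'\<close> by (intro ip) auto
      then show ?thesis using \<open>k = Suc k'\<close> Suc e b p i
        by (simp add: j_def q_def comp_simps comp_lift[OF e(2)])
    next
      case 0
      then show ?thesis using Suc e b i by (simp add: j_def q_def comp_simps comp_lift[OF e(4)])
    qed
  qed
  have "(\<Sum>k<?n. (i2 \<cdot> i k) \<cdot> (p k \<cdot> p2)) = (\<Sum>k<?n. i2 \<cdot> ((i k \<cdot> p k) \<cdot> p2))"
  proof (rule sum.cong[OF refl])
    fix k assume "k \<in> {..<?n}"
    then have "arr (i k) (Xs ! k) S'" "arr (p k) S' (Xs ! k)" using ip by auto
    then show "(i2 \<cdot> i k) \<cdot> (p k \<cdot> p2) = i2 \<cdot> ((i k \<cdot> p k) \<cdot> p2)" using b by (simp add: comp_simps)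
  qed
  also have "\<dots> = i2 \<cdot> (\<Sum>k<?n. (i k \<cdot> p k) \<cdot> p2)"
    by (rule comp_sum_right[symmetric, OF _ b(2)])
      (use ip(3,4) b in \<open>auto intro!: arr_comp dest: arr_dom\<close>)
  also have "(\<Sum>k<?n. (i k \<cdot> p k) \<cdot> p2) = (\<Sum>k<?n. i k \<cdot> p k) \<cdot> p2"
    by (rule comp_sum_left[symmetric, OF _ b(4)])
      (use ip(2,3,4) b in \<open>auto intro!: arr_comp\<close>)
  finally have "(\<Sum>k<?n. (i2 \<cdot> i k) \<cdot> (p k \<cdot> p2)) = i2 \<cdot> p2"
    unfolding ip(6) using b by (simp add: comp_simps)
  then have "(\<Sum>k<length (X # Xs). j k \<cdot> q k) = Idt C S"
    using e(5) by (simp add: j_def q_def sum.lessThan_Suc_shift del: sum.lessThan_Suc)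
  then show ?thesis
    unfolding is_direct_sum_def using t o ip(1) b(1)
    by (intro conjI exI[of _ j] exI[of _ q]) (auto simp: arr_def)
qed

end


section \<open>Binary biproducts and local endomorphism rings\<close>

context klinear_category
begin

lemma biproductD:
  assumes "biproduct A B S i1 i2 p1 p2"
  shows "arr i1 A S" "arr i2 B S" "arr p1 S A" "arr p2 S B"
    "p1 \<cdot> i1 = Idt C A" "p2 \<cdot> i2 = Idt C B" "p2 \<cdot> i1 = 0" "p1 \<cdot> i2 = 0"
    "i1 \<cdot> p1 + i2 \<cdot> p2 = Idt C S" "A \<in> Ob C" "B \<in> Ob C" "S \<in> Ob C"
  using assms by (auto simp: biproduct_def arr_def)

lemma biproduct_lift:
  assumes "biproduct A B S i1 i2 p1 p2"
  shows "into x A \<Longrightarrow> p1 \<cdot> (i1 \<cdot> x) = x" "into y B \<Longrightarrow> p2 \<cdot> (i2 \<cdot> y) = y"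
    "into x A \<Longrightarrow> p2 \<cdot> (i1 \<cdot> x) = 0" "into y B \<Longrightarrow> p1 \<cdot> (i2 \<cdot> y) = 0"
  using biproductD[OF assms(1)]
    comp_lift[of p1 i1 "Idt C A" S A A x] comp_lift[of p2 i2 "Idt C B" S B B y]
    comp_lift[of p2 i1 0 S B A x] comp_lift[of p1 i2 0 S A B y]
  by (simp_all add: comp_Idt_left comp_zero_left)

lemma biproduct_decomp:
  assumes "biproduct A B S i1 i2 p1 p2"
  shows "into x S \<Longrightarrow> x = i1 \<cdot> (p1 \<cdot> x) + i2 \<cdot> (p2 \<cdot> x)"
    and "arr y S Y \<Longrightarrow> y = (y \<cdot> i1) \<cdot> p1 + (y \<cdot> i2) \<cdot> p2"
proof -
  note b = biproductD[OF assms]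
  have t: "arr (i1 \<cdot> p1) S S" "arr (i2 \<cdot> p2) S S"
    using b by (auto intro: arr_comp)
  show "x = i1 \<cdot> (p1 \<cdot> x) + i2 \<cdot> (p2 \<cdot> x)" if "into x S"
  proof -
    have "x = Idt C S \<cdot> x" using that by (simp add: comp_Idt_left)
    also have "\<dots> = (i1 \<cdot> p1) \<cdot> x + (i2 \<cdot> p2) \<cdot> x"
      unfolding b(9)[symmetric] by (rule comp_add_left[OF t that])
    finally show ?thesis using b that by (simp add: comp_simps)
  qed
  show "y = (y \<cdot> i1) \<cdot> p1 + (y \<cdot> i2) \<cdot> p2" if y: "arr y S Y"
  proof -
    have "y = y \<cdot> Idt C S" using y by (simp add: comp_Idt_right)
    also have "\<dots> = y \<cdot> (i1 \<cdot> p1) + y \<cdot> (i2 \<cdot> p2)"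
      unfolding b(9)[symmetric] by (rule comp_add_right[OF y t])
    finally show ?thesis using b y by (simp add: comp_simps)
  qed
qed

lemma biproduct_swap:
  "biproduct A B S i1 i2 p1 p2 \<Longrightarrow> biproduct B A S i2 i1 p2 p1"
  by (auto simp: biproduct_def add.commute)

lemma ds_comm: "is_direct_sum C [A, B] S \<Longrightarrow> is_direct_sum C [B, A] S"
  by (meson ds_biproductE biproduct_swap biproduct_ds)

lemma ds_iso_left:
  assumes "is_direct_sum C [A, B] S" "A \<cong> A'"
  shows "is_direct_sum C [A', B] S"
proof -
  obtain i1 i2 p1 p2 where bp: "biproduct A B S i1 i2 p1 p2"
    using assms(1) by (rule ds_biproductE)
  obtain f g where fg: "arr f A A'" "arr g A' A" "g \<cdot> f = Idt C A" "f \<cdot> g = Idt C A'"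
    using assms(2) by (rule isoE)
  note b = biproductD[OF bp]
  have "biproduct A' B S (i1 \<cdot> g) i2 (f \<cdot> p1) p2"
    unfolding biproduct_def using b(1-9) fg
    by (auto simp: comp_simps biproduct_lift[OF bp] comp_lift[OF fg(3)] comp_lift[OF b(7)]
        intro: arr_comp arr_into)
  then show ?thesis by (rule biproduct_ds)
qed

lemma ds_iso_right:
  assumes "is_direct_sum C [A, B] S" "B \<cong> B'"
  shows "is_direct_sum C [A, B'] S"
  using assms ds_comm ds_iso_left by blast

lemma zero_ds: "\<lbrakk>zero_ob C Z; X \<in> Ob C\<rbrakk> \<Longrightarrow> is_direct_sum C [X, Z] X"
  by (rule biproduct_ds[of X Z X "Idt C X" 0 "Idt C X" 0])
    (auto simp: biproduct_def zero_ob_iff comp_Idt_right[OF arr_Idt] comp_zero_left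
      comp_zero_right[OF arr_zero] comp_Idt_right[OF arr_zero] comp_Idt_left into_Idt arr_into[OF arr_zero]
      intro: arr_Idt arr_zero)

lemma ds_zero_iso: "\<lbrakk>zero_ob C Z; is_direct_sum C [Z, Y] S\<rbrakk> \<Longrightarrow> Y \<cong> S"
  using zero_ds ds_comm ds_unique ds_Ob(2) by (metis list.set_intros)

lemma ds_assoc3:
  assumes "is_direct_sum C [X, Y] S" "is_direct_sum C [S, Z] R"
  shows "is_direct_sum C [X, Y, Z] R"
proof -
  obtain i1 i2 p1 p2 where bp: "biproduct X Y S i1 i2 p1 p2"
    using assms(1) by (rule ds_biproductE)
  obtain j1 j2 q1 q2 where bq: "biproduct S Z R j1 j2 q1 q2"
    using assms(2) by (rule ds_biproductE)
  note b = biproductD[OF bp] and c = biproductD[OF bq]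
  define i where "i = (\<lambda>k::nat. if k = 0 then j1 \<cdot> i1 else if k = 1 then j1 \<cdot> i2 else j2)"
  define p where "p = (\<lambda>k::nat. if k = 0 then p1 \<cdot> q1 else if k = 1 then p2 \<cdot> q1 else q2)"
  have t: "arr (j1 \<cdot> i1) X R" "arr (j1 \<cdot> i2) Y R" "arr (p1 \<cdot> q1) R X" "arr (p2 \<cdot> q1) R Y"
    using b c by (auto intro: arr_comp)
  have "(j1 \<cdot> i1) \<cdot> (p1 \<cdot> q1) + (j1 \<cdot> i2) \<cdot> (p2 \<cdot> q1) = j1 \<cdot> (i1 \<cdot> (p1 \<cdot> q1) + i2 \<cdot> (p2 \<cdot> q1))"
  proof -
    have "arr (i1 \<cdot> (p1 \<cdot> q1)) R S" "arr (i2 \<cdot> (p2 \<cdot> q1)) R S" using b t by (auto intro: arr_comp)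
    then show ?thesis using b(1-4) c(1-4) by (simp add: comp_simps comp_add_right)
  qed
  also have "\<dots> = j1 \<cdot> q1"
    using biproduct_decomp(1)[OF bp, of q1] c by (simp add: arr_into[OF c(3)])
  finally have s: "(j1 \<cdot> i1) \<cdot> (p1 \<cdot> q1) + (j1 \<cdot> i2) \<cdot> (p2 \<cdot> q1) + j2 \<cdot> q2 = Idt C R"
    using c by simp
  have "\<forall>k<3. \<forall>l<3. p l \<cdot> i k = (if k = l then Idt C ([X,Y,Z] ! k) else 0)"
    using b(1-8) c(1-8)
    by (auto simp: numeral_3_eq_3 less_Suc_eq i_def p_def comp_simps biproduct_lift[OF bq] 
        comp_lift[OF c(7)] comp_lift[OF c(8)])
  moreover have "\<forall>k<3. arr (i k) ([X,Y,Z] ! k) R \<and> arr (p k) R ([X,Y,Z] ! k)"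
    using t c by (auto simp: numeral_3_eq_3 less_Suc_eq i_def p_def)
  moreover have "(\<Sum>k<3. i k \<cdot> p k) = Idt C R"
    using s by (simp add: numeral_3_eq_3 i_def p_def)
  ultimately show ?thesis
    unfolding is_direct_sum_def using b c
    by (intro conjI exI[of _ i] exI[of _ p]) (auto simp: arr_def numeral_3_eq_3)
qed

lemma ds_singleton_iff: "is_direct_sum C [X] S \<longleftrightarrow> X \<cong> S"
proof
  assume "is_direct_sum C [X] S"
  then show "X \<cong> S"
    unfolding is_direct_sum_def by (auto intro!: isoI simp: arr_def)
next
  assume "X \<cong> S"
  then obtain f g where "arr f X S" "arr g S X" "g \<cdot> f = Idt C X" "f \<cdot> g = Idt C S"
    by (rule isoE)
  then show "is_direct_sum C [X] S"
    unfolding is_direct_sum_def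
    by (intro conjI exI[of _ "\<lambda>_. f"] exI[of _ "\<lambda>_. g"]) (auto simp: arr_def)
qed

definition retract :: "'o \<Rightarrow> 'o \<Rightarrow> bool" where
  "retract P S \<longleftrightarrow> (\<exists>i r. arr i P S \<and> arr r S P \<and> r \<cdot> i = Idt C P)"

lemma ds_retract: "is_direct_sum C [A, B] S \<Longrightarrow> retract A S"
  by (meson ds_biproductE biproductD retract_def)

definition invertible_end :: "'o \<Rightarrow> 'm \<Rightarrow> bool" where
  "invertible_end P f \<longleftrightarrow> arr f P P \<and> (\<exists>g. arr g P P \<and> g \<cdot> f = Idt C P \<and> f \<cdot> g = Idt C P)"

lemma invertible_end_iff: "P \<in> Ob C \<Longrightarrow> invertible_end P f \<longleftrightarrow> iso_mor C P P f"
  by (auto simp: invertible_end_def iso_mor_arr)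

lemma local_split:
  assumes "local_End C P" "arr f P P" "arr g P P" "invertible_end P (f + g)"
  shows "invertible_end P f \<or> invertible_end P g"
  using assms invertible_end_iff[OF arr_dom[OF assms(2)]] arr_Hom[OF assms(2)] arr_Hom[OF assms(3)]
  unfolding local_End_def by blast

lemma local_nonzero: "local_End C P \<Longrightarrow> Idt C P \<noteq> 0"
  by (simp add: local_End_def)

lemma invertible_Idt: "P \<in> Ob C \<Longrightarrow> invertible_end P (Idt C P)"
  unfolding invertible_end_def
  by (intro conjI exI[of _ "Idt C P"]) (auto intro: arr_Idt comp_Idt_left into_Idt)

lemma invertible_idem:
  assumes "invertible_end P e" "e \<cdot> e = e"
  shows "e = Idt C P"
proof -
  obtain g where g: "arr e P P" "arr g P P" "g \<cdot> e = Idt C P" using assms(1) by (auto simp: invertible_end_def)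
  have "e = g \<cdot> (e \<cdot> e)" using g by (simp add: comp_lift[OF g(3)] comp_simps)
  then show ?thesis using g assms(2) by simp
qed

text \<open>
  One of \<open>e\<close> and \<open>1 - e\<close> is invertible because their sum is, and an invertible idempotent is \<open>1\<close>.
\<close>

lemma local_idem:
  assumes "local_End C P" "arr e P P" "e \<cdot> e = e"
  shows "e = 0 \<or> e = Idt C P"
proof -
  have P: "P \<in> Ob C" using assms(2) by (rule arr_dom)
  let ?d = "Idt C P - e"
  have d: "arr ?d P P" using assms P by (intro arr_diff arr_Idt)
  have "?d \<cdot> ?d = ?d \<cdot> Idt C P - ?d \<cdot> e"
    by (rule comp_diff_right[OF d arr_Idt[OF P] assms(2)])
  also have "?d \<cdot> e = Idt C P \<cdot> e - e \<cdot> e"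
    by (rule comp_diff_left[OF arr_Idt[OF P] assms(2)]) (rule arr_into[OF assms(2)])
  finally have dd: "?d \<cdot> ?d = ?d"
    using assms d by (simp add: comp_simps comp_Idt_right[OF d])
  have "invertible_end P (e + ?d)" using invertible_Idt[OF P] by simp
  then have "invertible_end P e \<or> invertible_end P ?d"
    by (rule local_split[OF assms(1,2) d])
  then show ?thesis
  proof
    assume "invertible_end P e"
    then have "e = Idt C P" using assms(3) by (rule invertible_idem)
    then show ?thesis ..
  next
    assume "invertible_end P ?d"
    then have "?d = Idt C P" using dd by (rule invertible_idem)
    then show ?thesis by simp
  qed
qed

text \<open>
  The composite \<open>f g\<close> is an idempotent of a local ring, and it is nonzero because
  \<open>g (f g) f = 1 \<noteq> 0\<close>.
\<close>

lemma local_left_inverse: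
  assumes "local_End C Q" "Idt C P \<noteq> 0" "arr f P Q" "arr g Q P" "g \<cdot> f = Idt C P"
  shows "f \<cdot> g = Idt C Q"
proof -
  have "(f \<cdot> g) \<cdot> (f \<cdot> g) = f \<cdot> g"
    using assms(3,4) by (simp add: comp_simps comp_lift[OF assms(5)])
  then have "f \<cdot> g = 0 \<or> f \<cdot> g = Idt C Q"
    using assms by (intro local_idem arr_comp)
  moreover have "f \<cdot> g \<noteq> 0"
  proof
    assume z: "f \<cdot> g = 0"
    have "Idt C P = Idt C P \<cdot> Idt C P" using assms by (simp add: comp_simps arr_dom into_Idt)
    also have "\<dots> = g \<cdot> ((f \<cdot> g) \<cdot> f)"
      using assms(3,4) arr_dom[OF assms(3)] by (simp add: comp_simps assms(5) comp_lift[OF assms(5)])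
    also have "\<dots> = 0" unfolding z using assms by (simp add: comp_simps)
    finally show False using assms by simp
  qed
  ultimately show ?thesis by simp
qed

lemma retract_local:
  assumes "local_End C P" "local_End C Q" "retract P Q"
  shows "P \<cong> Q"
proof -
  obtain i r where "arr i P Q" "arr r Q P" "r \<cdot> i = Idt C P"
    using assms(3) by (auto simp: retract_def)
  then show ?thesis
    using local_left_inverse[OF assms(2) local_nonzero[OF assms(1)]] by (blast intro: isoI)
qed

text \<open>
  The identity of \<open>P\<close> is the sum of its parts through \<open>A\<close> and through \<open>B\<close>; in a local ring one of
  them is invertible.
\<close>

lemma retract_sum:
  assumes "local_End C P" "retract P S" "is_direct_sum C [A, B] S"
  shows "retract P A \<or> retract P B"
proof -
  obtain i r where ir: "arr i P S" "arr r S P" "r \<cdot> i = Idt C P"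
    using assms(2) by (auto simp: retract_def)
  obtain i1 i2 p1 p2 where bp: "biproduct A B S i1 i2 p1 p2"
    using assms(3) by (rule ds_biproductE)
  note b = biproductD[OF bp]
  have *: "retract P D" if D: "arr j D S" "arr p S D" "invertible_end P (r \<cdot> (j \<cdot> (p \<cdot> i)))" for j p D
  proof -
    obtain g where g: "arr g P P" "g \<cdot> (r \<cdot> (j \<cdot> (p \<cdot> i))) = Idt C P"
      using D by (auto simp: invertible_end_def)
    then have "(g \<cdot> (r \<cdot> j)) \<cdot> (p \<cdot> i) = Idt C P"
      using that(1,2) ir(1,2) arr_comp[of j D S r P] by (simp add: comp_simps)
    then show ?thesis unfolding retract_def using that(1,2) ir(1,2) g(1) by (blast intro: arr_comp)
  qed
  have t: "arr (i1 \<cdot> (p1 \<cdot> i)) P S" "arr (i2 \<cdot> (p2 \<cdot> i)) P S" using b ir by (auto intro: arr_comp)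
  have "r \<cdot> (i1 \<cdot> (p1 \<cdot> i)) + r \<cdot> (i2 \<cdot> (p2 \<cdot> i)) = r \<cdot> i"
    using biproduct_decomp(1)[OF bp, of i] comp_add_right[OF ir(2) t] ir by (simp add: arr_into)
  then have "invertible_end P (r \<cdot> (i1 \<cdot> (p1 \<cdot> i)) + r \<cdot> (i2 \<cdot> (p2 \<cdot> i)))"
    using ir invertible_Idt[of P] arr_dom by simp
  then have "invertible_end P (r \<cdot> (i1 \<cdot> (p1 \<cdot> i))) \<or> invertible_end P (r \<cdot> (i2 \<cdot> (p2 \<cdot> i)))"
    by (rule local_split[OF assms(1) arr_comp[OF t(1) ir(2)] arr_comp[OF t(2) ir(2)]])
  then show ?thesis using * b by blast
qed

text \<open>
  If \<open>q i\<close> is invertible, then \<open>B\<close>, the kernel of \<open>q\<close>, is also a complement of the image of \<open>i\<close>, hence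
  isomorphic to \<open>A\<close>.  The isomorphism \<open>A \<rightarrow> B\<close> comes from \<open>a\<close> by subtracting the multiple of \<open>i\<close> that
  moves it into the kernel of \<open>q\<close>.
\<close>

lemma complement_iso:
  assumes bp: "biproduct P A S i a p pa" and bq: "biproduct P B S j b q qb"
    and inv: "invertible_end P (q \<cdot> i)"
  shows "A \<cong> B"
proof -
  note A = biproductD[OF bp] and B = biproductD[OF bq]
  obtain u where u: "arr u P P" "u \<cdot> (q \<cdot> i) = Idt C P" "(q \<cdot> i) \<cdot> u = Idt C P"
    using inv by (auto simp: invertible_end_def)
  have u2: "q \<cdot> (i \<cdot> u) = Idt C P" using u A B by (simp add: comp_simps)
  have u3: "q \<cdot> (i \<cdot> (u \<cdot> h)) = h" if "into h P" for h
    using comp_lift[OF u2, of S P P h] that u(1) A(1) B(3) by (simp add: comp_simps arr_comp)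
  have u4: "u \<cdot> (q \<cdot> (i \<cdot> h)) = h" if "into h P" for h
    using comp_lift[OF u(2), of P P P h] that u(1) A(1) B(3) by (simp add: comp_simps arr_comp)
  define x where "x = a - i \<cdot> (u \<cdot> (q \<cdot> a))"
  have t: "arr (i \<cdot> (u \<cdot> (q \<cdot> a))) A S" using A B u by (auto intro: arr_comp)
  have x: "arr x A S" unfolding x_def using A t by (intro arr_diff) auto
  have "q \<cdot> x = q \<cdot> a - q \<cdot> (i \<cdot> (u \<cdot> (q \<cdot> a)))"
    unfolding x_def by (rule comp_diff_right[OF B(3) A(2) t])
  then have qx: "q \<cdot> x = 0" using A B by (simp add: u3 comp_simps)
  have bx: "b \<cdot> (qb \<cdot> x) = x"
    using biproduct_decomp(1)[OF bq, of x] x B(1) by (simp add: qx comp_simps)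
  have f: "arr (qb \<cdot> x) A B" and g: "arr (pa \<cdot> b) B A" using A B x by (auto intro: arr_comp)
  have "(pa \<cdot> b) \<cdot> (qb \<cdot> x) = pa \<cdot> x"
    using A(4) B(2,4) x by (simp add: comp_simps bx)
  also have "\<dots> = pa \<cdot> a - pa \<cdot> (i \<cdot> (u \<cdot> (q \<cdot> a)))"
    unfolding x_def by (rule comp_diff_right[OF A(4) A(2) t])
  also have "\<dots> = Idt C A"
    using A u B by (simp add: comp_simps comp_lift[OF A(7)])
  finally have gf: "(pa \<cdot> b) \<cdot> (qb \<cdot> x) = Idt C A" .
  have ib: "arr (i \<cdot> (p \<cdot> b)) B S" using A B by (auto intro: arr_comp)
  have y: "a \<cdot> (pa \<cdot> b) = b - i \<cdot> (p \<cdot> b)"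
    using biproduct_decomp(1)[OF bp, of b] B by (simp add: arr_into algebra_simps)
  have "q \<cdot> (a \<cdot> (pa \<cdot> b)) = q \<cdot> b - q \<cdot> (i \<cdot> (p \<cdot> b))"
    unfolding y by (rule comp_diff_right[OF B(3) B(2) ib])
  then have qy: "q \<cdot> (a \<cdot> (pa \<cdot> b)) = - (q \<cdot> (i \<cdot> (p \<cdot> b)))" using B by simp
  have qib: "arr (q \<cdot> (i \<cdot> (p \<cdot> b))) B P" using ib B by (auto intro: arr_comp)
  have pb: "arr (p \<cdot> b) B P" using A B by (auto intro: arr_comp)
  have uq: "u \<cdot> (q \<cdot> (a \<cdot> (pa \<cdot> b))) = - (p \<cdot> b)"
    unfolding qy using comp_uminus_right[OF u(1) qib] u4[of "p \<cdot> b"] pb by (simp add: arr_into)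
  have "x \<cdot> (pa \<cdot> b) = a \<cdot> (pa \<cdot> b) - (i \<cdot> (u \<cdot> (q \<cdot> a))) \<cdot> (pa \<cdot> b)"
    unfolding x_def by (rule comp_diff_left[OF A(2) t]) (rule arr_into[OF g])
  also have "(i \<cdot> (u \<cdot> (q \<cdot> a))) \<cdot> (pa \<cdot> b) = i \<cdot> (u \<cdot> (q \<cdot> (a \<cdot> (pa \<cdot> b))))"
    using A(1,2) B(3) u(1) arr_comp[OF A(2) B(3)] arr_comp[OF arr_comp[OF A(2) B(3)] u(1)] arr_into[OF g]
    by (simp add: comp_assoc)
  also have "\<dots> = - (i \<cdot> (p \<cdot> b))" unfolding uq by (rule comp_uminus_right[OF A(1) pb])
  finally have xb: "x \<cdot> (pa \<cdot> b) = b" by (simp add: y)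
  have "(qb \<cdot> x) \<cdot> (pa \<cdot> b) = qb \<cdot> (x \<cdot> (pa \<cdot> b))"
    using B(4) x g by (simp add: comp_assoc arr_into)
  then have fg: "(qb \<cdot> x) \<cdot> (pa \<cdot> b) = Idt C B"
    using xb B by simp
  show ?thesis by (rule isoI[OF f g gf fg])
qed

text \<open>
  The claim comes down to \<open>complement_iso\<close> once
  \<open>q i\<close> is invertible.  In general \<open>1 = p i = (p j)(q i) + (p b)(qb i)\<close>; if \<open>q i\<close> is not invertible then
  \<open>w = (p b)(qb i)\<close> is, and so is \<open>q i + w\<close>.  An elementary automorphism of \<open>P \<oplus> B\<close> replaces \<open>q i\<close> by
  \<open>q i + w\<close>.
\<close>

lemma ds_cancel:
  assumes loc: "local_End C P" and "is_direct_sum C [P, A] S" "is_direct_sum C [P, B] S"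
  shows "A \<cong> B"
proof -
  obtain i a p pa where bp: "biproduct P A S i a p pa"
    using assms(2) by (rule ds_biproductE)
  obtain j b q qb where bq: "biproduct P B S j b q qb"
    using assms(3) by (rule ds_biproductE)
  note A = biproductD[OF bp] and B = biproductD[OF bq]
  have qi: "arr (q \<cdot> i) P P" and pj: "arr (p \<cdot> j) P P" and pb: "arr (p \<cdot> b) B P" and qbi: "arr (qb \<cdot> i) P B"
    using A B by (auto intro: arr_comp)
  show ?thesis
  proof (cases "invertible_end P (q \<cdot> i)")
    case True
    then show ?thesis by (rule complement_iso[OF bp bq])
  next
    case False
    let ?w = "(p \<cdot> b) \<cdot> (qb \<cdot> i)"
    have w: "arr ?w P P" using pb qbi by (auto intro: arr_comp)
    have t: "arr (j \<cdot> (q \<cdot> i)) P S" "arr (b \<cdot> (qb \<cdot> i)) P S" using A B by (auto intro: arr_comp)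
    have "p \<cdot> i = p \<cdot> (j \<cdot> (q \<cdot> i)) + p \<cdot> (b \<cdot> (qb \<cdot> i))"
      using biproduct_decomp(1)[OF bq, of i] A comp_add_right[OF A(3) t] by (simp add: arr_into)
    then have "(p \<cdot> j) \<cdot> (q \<cdot> i) + ?w = Idt C P"
      using A B by (simp add: comp_simps)
    then have "invertible_end P ((p \<cdot> j) \<cdot> (q \<cdot> i)) \<or> invertible_end P ?w"
      using local_split[OF loc arr_comp[OF qi pj] w] invertible_Idt[OF A(10)] by simp
    moreover have "\<not> invertible_end P ((p \<cdot> j) \<cdot> (q \<cdot> i))"
    proof
      \<comment> \<open>A left inverse in a local ring is two-sided, so \<open>q i\<close> would be invertible.\<close>
      assume "invertible_end P ((p \<cdot> j) \<cdot> (q \<cdot> i))"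
      then obtain g where g: "arr g P P" "g \<cdot> ((p \<cdot> j) \<cdot> (q \<cdot> i)) = Idt C P"
        by (auto simp: invertible_end_def)
      have gp: "arr (g \<cdot> (p \<cdot> j)) P P" using g pj by (auto intro: arr_comp)
      have l: "(g \<cdot> (p \<cdot> j)) \<cdot> (q \<cdot> i) = Idt C P"
        using g pj qi by (simp add: comp_assoc[OF g(1) pj arr_into[OF qi]])
      have "(q \<cdot> i) \<cdot> (g \<cdot> (p \<cdot> j)) = Idt C P"
        by (rule local_left_inverse[OF loc local_nonzero[OF loc] qi gp l])
      then show False using False qi gp l by (auto simp: invertible_end_def)
    qed
    ultimately have winv: "invertible_end P ?w" by simp
    have inv: "invertible_end P (q \<cdot> i + ?w)"
    proof (rule ccontr)
      assume n: "\<not> invertible_end P (q \<cdot> i + ?w)"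
      have "\<not> invertible_end P (- (q \<cdot> i))"
      proof
        assume "invertible_end P (- (q \<cdot> i))"
        then obtain g where g: "arr g P P" "g \<cdot> (- (q \<cdot> i)) = Idt C P" "(- (q \<cdot> i)) \<cdot> g = Idt C P"
          by (auto simp: invertible_end_def)
        have "(- g) \<cdot> (q \<cdot> i) = Idt C P" "(q \<cdot> i) \<cdot> (- g) = Idt C P"
          using g comp_uminus_right[OF g(1) qi] comp_uminus_left[OF g(1) arr_into[OF qi]]
            comp_uminus_right[OF qi g(1)] comp_uminus_left[OF qi arr_into[OF g(1)]] by auto
        then show False using False qi g(1) by (auto simp: invertible_end_def intro: arr_uminus)
      qed
      then show False
        using local_split[OF loc arr_add[OF qi w] arr_uminus[OF qi]] n winv by auto
    qed
    \<comment> \<open>The biproduct structure of \<open>P \<oplus> B\<close> transported along the elementary automorphism.\<close>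
    define q' where "q' = q + (p \<cdot> b) \<cdot> qb"
    define b' where "b' = b - j \<cdot> (p \<cdot> b)"
    have pbq: "arr ((p \<cdot> b) \<cdot> qb) S P" and jpb: "arr (j \<cdot> (p \<cdot> b)) B S" using pb B by (auto intro: arr_comp)
    have q': "arr q' S P" and b': "arr b' B S"
      unfolding q'_def b'_def using B pbq jpb by (auto intro: arr_add arr_diff)
    have q'c: "q' \<cdot> h = q \<cdot> h + (p \<cdot> b) \<cdot> (qb \<cdot> h)" if "into h S" for h
      using comp_add_left[OF B(3) pbq that] comp_assoc[OF pb B(4) that] by (simp add: q'_def)
    have b'c: "h \<cdot> b' = h \<cdot> b - h \<cdot> (j \<cdot> (p \<cdot> b))" if "arr h S Z" for h Z
      using comp_diff_right[OF that B(2) jpb] by (simp add: b'_def)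
    have "biproduct P B S j b' q' qb"
      unfolding biproduct_def
    proof (intro conjI)
      show "q' \<cdot> j = Idt C P" using q'c[of j] B pb by (simp add: comp_simps arr_into comp_zero_right[OF pb])
      show "qb \<cdot> b' = Idt C B" using b'c[OF B(4)] B pb by (simp add: comp_lift[OF B(7) B(4) B(1) arr_into[OF pb]] comp_zero_left')
      show "qb \<cdot> j = 0" by (rule B)
      have "q' \<cdot> b' = q \<cdot> b' + (p \<cdot> b) \<cdot> (qb \<cdot> b')" by (rule q'c) (rule arr_into[OF b'])
      also have "qb \<cdot> b' = Idt C B" by fact
      also have "q \<cdot> b' = - (p \<cdot> b)"
        using b'c[OF B(3)] biproduct_lift(1)[OF bq arr_into[OF pb]] B by simp
      finally show "q' \<cdot> b' = 0" using comp_Idt_right[OF pb] by simp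
      have "j \<cdot> q' = j \<cdot> q + j \<cdot> ((p \<cdot> b) \<cdot> qb)" unfolding q'_def by (rule comp_add_right[OF B(1) B(3) pbq])
      moreover have "b' \<cdot> qb = b \<cdot> qb - (j \<cdot> (p \<cdot> b)) \<cdot> qb"
        unfolding b'_def by (rule comp_diff_left[OF B(2) jpb arr_into[OF B(4)]])
      moreover have "(j \<cdot> (p \<cdot> b)) \<cdot> qb = j \<cdot> ((p \<cdot> b) \<cdot> qb)"
        by (rule comp_assoc[OF B(1) pb arr_into[OF B(4)]])
      ultimately show "j \<cdot> q' + b' \<cdot> qb = Idt C S" using B(9) by simp
    qed (use B q' b' in auto)
    moreover have "q' \<cdot> i = q \<cdot> i + ?w" by (rule q'c) (rule arr_into[OF A(1)])
    ultimately show ?thesis using complement_iso[OF bp] inv by simp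
  qed
qed

end


section \<open>Krull-Schmidt multiplicities\<close>

context additive_klinear_category
begin

lemma ex_ds: "set Xs \<subseteq> Ob C \<Longrightarrow> \<exists>S. is_direct_sum C Xs S"
proof (induction Xs)
  case Nil
  then show ?case using ex_zero_ob by simp
next
  case (Cons X Xs)
  then obtain S' where "is_direct_sum C Xs S'" by auto
  moreover obtain S where "is_direct_sum C [X, S'] S"
    using ex_direct_sum[of X S'] Cons.prems ds_Ob(1)[OF calculation] by auto
  ultimately show ?case using ds_ConsI by blast
qed

lemma ds_ConsE:
  assumes "is_direct_sum C (X # Xs) S"
  obtains S' where "is_direct_sum C Xs S'" "is_direct_sum C [X, S'] S"
proof -
  have ob: "X \<in> Ob C" "set Xs \<subseteq> Ob C" using ds_Ob(2)[OF assms] by auto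
  then obtain S' where S': "is_direct_sum C Xs S'" using ex_ds by blast
  then obtain S'' where S'': "is_direct_sum C [X, S'] S''"
    using ex_direct_sum[of X S'] ob ds_Ob(1) by blast
  have "is_direct_sum C [X, S'] S"
    by (rule ds_iso[OF S'' ds_unique[OF ds_ConsI[OF S' S''] assms]])
  then show thesis using S' that by blast
qed

lemma ds_assoc:
  assumes "is_direct_sum C [X, Y] S" "is_direct_sum C [S, Z] R" "is_direct_sum C [Y, Z] Q"
  shows "is_direct_sum C [X, Q] R"
proof -
  obtain Q' where Q': "is_direct_sum C [Y, Z] Q'" "is_direct_sum C [X, Q'] R"
    using ds_assoc3[OF assms(1,2)] by (rule ds_ConsE)
  then show ?thesis using ds_iso_right ds_unique assms(3) by blast
qed

lemma ds_append:
  assumes "is_direct_sum C Xs X" "is_direct_sum C Ys Y" "is_direct_sum C [X, Y] S"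
  shows "is_direct_sum C (Xs @ Ys) S"
  using assms(1,3)
proof (induction Xs arbitrary: X S)
  case Nil
  then show ?case using ds_iso[OF assms(2)] ds_zero_iso by simp
next
  case (Cons P Xs)
  obtain X' where X': "is_direct_sum C Xs X'" "is_direct_sum C [P, X'] X"
    using Cons.prems(1) by (rule ds_ConsE)
  obtain Q where Q: "is_direct_sum C [X', Y] Q"
    using ex_direct_sum X' assms(2) ds_Ob(1) by blast
  have "is_direct_sum C [P, Q] S" by (rule ds_assoc[OF X'(2) Cons.prems(2) Q])
  then show ?case using Cons.IH[OF X'(1) Q] ds_ConsI by simp
qed

lemma ds_appendE:
  assumes "is_direct_sum C (Xs @ Ys) S"
  obtains X Y where "is_direct_sum C Xs X" "is_direct_sum C Ys Y" "is_direct_sum C [X, Y] S"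
proof -
  have "set Xs \<subseteq> Ob C" "set Ys \<subseteq> Ob C" using ds_Ob(2)[OF assms] by auto
  then obtain X Y where XY: "is_direct_sum C Xs X" "is_direct_sum C Ys Y" using ex_ds by blast
  then obtain S' where S': "is_direct_sum C [X, Y] S'" using ex_direct_sum ds_Ob(1) by blast
  have "S' \<cong> S" by (rule ds_unique[OF ds_append[OF XY S'] assms])
  then show thesis using that XY ds_iso[OF S'] by blast
qed

lemma ds_move:
  assumes "is_direct_sum C (Xs @ P # Ys) S"
  shows "is_direct_sum C (P # Xs @ Ys) S"
proof -
  obtain X Y' where X: "is_direct_sum C Xs X" "is_direct_sum C (P # Ys) Y'" "is_direct_sum C [X, Y'] S"
    using assms by (rule ds_appendE)
  obtain Y where Y: "is_direct_sum C Ys Y" "is_direct_sum C [P, Y] Y'"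
    using X(2) by (rule ds_ConsE)
  obtain Q where Q: "is_direct_sum C [X, Y] Q"
    using ex_direct_sum X(1) Y(1) ds_Ob(1) by blast
  have "is_direct_sum C [P, Q] S"
    by (rule ds_assoc[OF Y(2) ds_comm[OF X(3)] ds_comm[OF Q]])
  then show ?thesis by (rule ds_ConsI[OF ds_append[OF X(1) Y(1) Q]])
qed

lemma retract_list:
  assumes "local_End C P" "retract P S" "is_direct_sum C Xs S" "\<forall>X \<in> set Xs. local_End C X"
  shows "\<exists>X \<in> set Xs. P \<cong> X"
  using assms(2-4)
proof (induction Xs arbitrary: S)
  case Nil
  then obtain i r where "arr i P S" "arr r S P" "r \<cdot> i = Idt C P" by (auto simp: retract_def)
  then have "Idt C P = 0" using zero_ob_arr(1)[OF Nil(2)] comp_zero_right by metis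
  then show ?case using local_nonzero assms(1) by blast
next
  case (Cons X Xs)
  obtain S' where S': "is_direct_sum C Xs S'" "is_direct_sum C [X, S'] S"
    using Cons.prems(2) by (rule ds_ConsE)
  from retract_sum[OF assms(1) Cons.prems(1) S'(2)]
  show ?case
    using retract_local[OF assms(1)] Cons.IH[OF _ S'(1)] Cons.prems(3) by auto
qed

definition multiplicity_in :: "'o \<Rightarrow> 'o list \<Rightarrow> nat" where
  "multiplicity_in P Xs = length (filter (\<lambda>X. P \<cong> X) Xs)"

lemma multiplicity_in_simps [simp]:
  "multiplicity_in P [] = 0"
  "multiplicity_in P (X # Xs) = (if P \<cong> X then Suc (multiplicity_in P Xs) else multiplicity_in P Xs)"
  "multiplicity_in P (Xs @ Ys) = multiplicity_in P Xs + multiplicity_in P Ys"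
  by (auto simp: multiplicity_in_def)

text \<open>
  Each indecomposable on the left is isomorphic to one on the right by \<open>retract_list\<close>, and \<open>ds_cancel\<close>
  removes both.
\<close>

lemma krull_schmidt_unique:
  assumes "is_direct_sum C Xs S" "is_direct_sum C Ys S"
    "\<forall>X \<in> set Xs. local_End C X" "\<forall>Y \<in> set Ys. local_End C Y"
  shows "multiplicity_in P Xs = multiplicity_in P Ys"
  using assms
proof (induction Xs arbitrary: S Ys)
  case Nil
  show ?case
  proof (cases Ys)
    case (Cons Y Ys')
    then obtain Y' where "is_direct_sum C [Y, Y'] S" using Nil.prems(2) ds_ConsE by blast
    then have "\<exists>X \<in> set []. Y \<cong> X"
      using Nil.prems Cons by (intro retract_list[of Y S]) (auto intro: ds_retract)
    then show ?thesis by simp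
  qed simp
next
  case (Cons X Xs)
  obtain S' where S': "is_direct_sum C Xs S'" "is_direct_sum C [X, S'] S"
    using Cons.prems(1) by (rule ds_ConsE)
  have loc: "local_End C X" using Cons.prems by simp
  then have "\<exists>Y \<in> set Ys. X \<cong> Y"
    using Cons.prems S' by (intro retract_list[of X S]) (auto intro: ds_retract)
  then obtain Y Y1 Y2 where Y: "X \<cong> Y" "Ys = Y1 @ Y # Y2" by (auto dest: split_list)
  then have "is_direct_sum C (Y # Y1 @ Y2) S" using Cons.prems(2) ds_move by blast
  then obtain T where T: "is_direct_sum C (Y1 @ Y2) T" "is_direct_sum C [Y, T] S" by (rule ds_ConsE)
  have "is_direct_sum C [X, T] S" by (rule ds_iso_left[OF T(2) iso_sym[OF Y(1)]])
  then have "S' \<cong> T" by (rule ds_cancel[OF loc S'(2)])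
  then have "is_direct_sum C Xs T" using S'(1) ds_iso by blast
  then have "multiplicity_in P Xs = multiplicity_in P (Y1 @ Y2)"
    using Cons.prems Y by (intro Cons.IH[OF _ T(1)]) auto
  moreover have "P \<cong> X \<longleftrightarrow> P \<cong> Y" using Y(1) iso_trans iso_sym by blast
  ultimately show ?case using Y by simp
qed

end

locale krull_schmidt_category = additive_klinear_category C
  for C :: "('k::field, 'o, 'm::ab_group_add) tricat" (structure) +
  assumes ks: "krull_schmidt C"
begin

lemma ex_local_decomposition:
  assumes "X \<in> Ob C"
  obtains Xs where "is_direct_sum C Xs X" "\<forall>Y \<in> set Xs. local_End C Y"
  using ks assms unfolding krull_schmidt_def by blast

text \<open>
  The choice of the decomposition does not matter by \<open>krull_schmidt_unique\<close>.
\<close>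

definition mult :: "'o \<Rightarrow> 'o \<Rightarrow> nat" where
  "mult P X = multiplicity_in P (SOME Xs. is_direct_sum C Xs X \<and> (\<forall>Y \<in> set Xs. local_End C Y))"

lemma mult_eq:
  assumes "is_direct_sum C Xs X" "\<forall>Y \<in> set Xs. local_End C Y"
  shows "mult P X = multiplicity_in P Xs"
proof -
  let ?Q = "\<lambda>Xs. is_direct_sum C Xs X \<and> (\<forall>Y \<in> set Xs. local_End C Y)"
  have "?Q (SOME Xs. ?Q Xs)" by (rule someI[of ?Q]) (use assms in blast)
  then show ?thesis unfolding mult_def using krull_schmidt_unique assms by blast
qed

lemma mult_sum: "is_direct_sum C [X, Y] S \<Longrightarrow> mult P S = mult P X + mult P Y"
proof -
  assume S: "is_direct_sum C [X, Y] S"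
  then have "X \<in> Ob C" "Y \<in> Ob C" using ds_Ob by auto
  then obtain Xs Ys where "is_direct_sum C Xs X" "\<forall>Y \<in> set Xs. local_End C Y"
      "is_direct_sum C Ys Y" "\<forall>Y \<in> set Ys. local_End C Y"
    by (meson ex_local_decomposition)
  then show ?thesis using mult_eq[OF ds_append[OF _ _ S], of Xs Ys P] mult_eq[of Xs X P] mult_eq[of Ys Y P] by auto
qed

lemma mult_iso: "X \<cong> Y \<Longrightarrow> mult P X = mult P Y"
  by (metis ds_iso ex_local_decomposition iso_Ob(1) mult_eq)

lemma mult_iso_left: "P \<cong> Q \<Longrightarrow> mult P X = mult Q X"
proof -
  assume "P \<cong> Q"
  then have "P \<cong> Y \<longleftrightarrow> Q \<cong> Y" for Y using iso_trans iso_sym by blast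
  then show ?thesis by (simp add: mult_def multiplicity_in_def)
qed

lemma mult_zero: "zero_ob C Z \<Longrightarrow> mult P Z = 0"
  using mult_eq[of "[]" Z P] by simp

lemma mult_local: "\<lbrakk>local_End C Q; Q \<in> Ob C\<rbrakk> \<Longrightarrow> mult P Q = (if P \<cong> Q then 1 else 0)"
  using mult_eq[of "[Q]" Q P] by (simp add: ds_singleton_iff iso_refl)

lemma mult_self: "\<lbrakk>local_End C P; P \<in> Ob C\<rbrakk> \<Longrightarrow> mult P P = 1"
  by (simp add: mult_local iso_refl)

lemma mult_pos_split:
  assumes "X \<in> Ob C" "mult P X > 0"
  obtains X' where "is_direct_sum C [P, X'] X"
proof -
  obtain Xs where Xs: "is_direct_sum C Xs X" "\<forall>Y \<in> set Xs. local_End C Y"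
    using assms(1) by (rule ex_local_decomposition)
  then have "filter (\<lambda>X. P \<cong> X) Xs \<noteq> []" using assms(2) mult_eq by (auto simp: multiplicity_in_def)
  then obtain Y where "Y \<in> set Xs" "P \<cong> Y" by (auto simp: filter_empty_conv)
  then obtain Y1 Y2 where "Xs = Y1 @ Y # Y2" by (auto dest: split_list)
  then have "is_direct_sum C (Y # Y1 @ Y2) X" using Xs(1) ds_move by blast
  then obtain X' where "is_direct_sum C [Y, X'] X" by (rule ds_ConsE)
  then have "is_direct_sum C [P, X'] X" by (rule ds_iso_left[OF _ iso_sym[OF \<open>P \<cong> Y\<close>]])
  then show thesis by (rule that)
qed

lemma iso_if_mult_eq:
  assumes "X \<in> Ob C" "Y \<in> Ob C" "\<And>P. \<lbrakk>local_End C P; P \<in> Ob C\<rbrakk> \<Longrightarrow> mult P X = mult P Y"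
  shows "X \<cong> Y"
proof -
  obtain Xs where "is_direct_sum C Xs X" "\<forall>Y \<in> set Xs. local_End C Y"
    using assms(1) by (rule ex_local_decomposition)
  then show ?thesis using assms
  proof (induction Xs arbitrary: X Y)
    case Nil
    obtain Ys where Ys: "is_direct_sum C Ys Y" "\<forall>Y \<in> set Ys. local_End C Y"
      using Nil.prems(4) by (rule ex_local_decomposition)
    have "Ys = []"
    proof (cases Ys)
      case (Cons P Ps)
      then have P: "local_End C P" "P \<in> Ob C" using Ys ds_Ob by auto
      have "mult P Y > 0" using mult_eq[OF Ys, of P] Cons P by (simp add: iso_refl)
      then show ?thesis using Nil.prems(5)[OF P] mult_zero[OF Nil.prems(1)] by simp
    qed
    then show ?case using Ys(1) Nil.prems(1) ds_unique by blast
  next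
    case (Cons P Ps)
    then have P: "local_End C P" "P \<in> Ob C" using ds_Ob by auto
    obtain X' where X': "is_direct_sum C Ps X'" "is_direct_sum C [P, X'] X"
      using Cons.prems(1) by (rule ds_ConsE)
    have "mult P Y > 0"
      using Cons.prems(5)[OF P] mult_sum[OF X'(2), of P] mult_self[OF P] by simp
    with Cons.prems(4) obtain Y' where Y': "is_direct_sum C [P, Y'] Y" by (rule mult_pos_split)
    have "X' \<cong> Y'"
    proof (rule Cons.IH[OF X'(1)])
      show "mult Q X' = mult Q Y'" if "local_End C Q" "Q \<in> Ob C" for Q
        using Cons.prems(5)[OF that] mult_sum[OF X'(2)] mult_sum[OF Y'] by simp
    qed (use Cons.prems X' Y' ds_Ob in auto)
    then show ?case using X'(2) Y' ds_iso_right ds_unique by blast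
  qed
qed

text \<open>
  The way direct sum decompositions are produced from here on: it suffices that the numbers add up.
\<close>

lemma ds_if_mult:
  assumes "X \<in> Ob C" "Y \<in> Ob C" "S \<in> Ob C"
    "\<And>P. \<lbrakk>local_End C P; P \<in> Ob C\<rbrakk> \<Longrightarrow> mult P S = mult P X + mult P Y"
  shows "is_direct_sum C [X, Y] S"
proof -
  obtain S' where S': "is_direct_sum C [X, Y] S'" using ex_direct_sum assms by blast
  have "S' \<cong> S"
    using assms mult_sum[OF S'] ds_Ob(1)[OF S'] by (intro iso_if_mult_eq) auto
  then show ?thesis by (rule ds_iso[OF S'])
qed

lemma zero_if_mult:
  assumes "X \<in> Ob C" "\<And>P. \<lbrakk>local_End C P; P \<in> Ob C\<rbrakk> \<Longrightarrow> mult P X = 0"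
  shows "zero_ob C X"
proof -
  obtain Z where Z: "zero_ob C Z" using ex_zero_ob by blast
  have "Z \<cong> X" using assms Z mult_zero[OF Z] ds_Ob(1)[OF Z] by (intro iso_if_mult_eq) auto
  then show ?thesis by (rule ds_iso[OF Z])
qed

lemma mult_replicate: "is_direct_sum C (replicate r X) S \<Longrightarrow> mult P S = r * mult P X"
proof (induction r arbitrary: S)
  case 0
  then show ?case by (simp add: mult_zero)
next
  case (Suc r)
  then obtain S' where "is_direct_sum C (replicate r X) S'" "is_direct_sum C [X, S'] S"
    using ds_ConsE[of X "replicate r X" S] by auto
  then show ?case using Suc.IH mult_sum by simp
qed

lemma ex_replicate: "X \<in> Ob C \<Longrightarrow> \<exists>S. is_direct_sum C (replicate r X) S"
  by (rule ex_ds) auto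

text \<open>
  \<open>Y \<preceq> X\<close> expresses \<open>Y \<in> add(X)\<close> through multiplicities (see \<open>add_of_iff\<close>), which makes it visibly
  transitive and compatible with direct sums.
\<close>

definition support_le :: "'o \<Rightarrow> 'o \<Rightarrow> bool" (infix "\<preceq>" 50) where
  "Y \<preceq> X \<longleftrightarrow> Y \<in> Ob C \<and> X \<in> Ob C \<and>
    (\<forall>P \<in> Ob C. local_End C P \<longrightarrow> mult P Y > 0 \<longrightarrow> mult P X > 0)"

lemma support_leD: "\<lbrakk>Y \<preceq> X; local_End C P; P \<in> Ob C; mult P Y > 0\<rbrakk> \<Longrightarrow> mult P X > 0"
  and support_le_Ob: "Y \<preceq> X \<Longrightarrow> Y \<in> Ob C" "Y \<preceq> X \<Longrightarrow> X \<in> Ob C"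
  by (auto simp: support_le_def)

lemma support_le_refl: "X \<in> Ob C \<Longrightarrow> X \<preceq> X"
  and support_le_trans: "\<lbrakk>X \<preceq> Y; Y \<preceq> Z\<rbrakk> \<Longrightarrow> X \<preceq> Z"
  by (auto simp: support_le_def)

lemma support_le_sum: "\<lbrakk>is_direct_sum C [X, Y] S; X \<preceq> Z; Y \<preceq> Z\<rbrakk> \<Longrightarrow> S \<preceq> Z"
  and support_le_summand: "is_direct_sum C [X, Y] S \<Longrightarrow> X \<preceq> S" "is_direct_sum C [X, Y] S \<Longrightarrow> Y \<preceq> S"
  using mult_sum[of X Y S] ds_Ob[of "[X, Y]" S] by (auto simp: support_le_def)

text \<open>
  Induction over the indecomposables of \<open>Y\<close>: each one uses up one further copy of \<open>X\<close>.
\<close>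

lemma support_le_complement:
  assumes "Y \<preceq> X"
  shows "\<exists>r S Z. is_direct_sum C (replicate r X) S \<and> is_direct_sum C [Y, Z] S"
proof -
  obtain Ys where "is_direct_sum C Ys Y" "\<forall>P \<in> set Ys. local_End C P"
    using support_le_Ob(1)[OF assms] by (rule ex_local_decomposition)
  then show ?thesis using assms
  proof (induction Ys arbitrary: Y)
    case Nil
    then have "is_direct_sum C [Y, Y] Y" using zero_ds support_le_Ob by blast
    then show ?case using Nil.prems(1)
      by (intro exI[of _ 0] exI[of _ Y] exI[of _ Y]) simp
  next
    case (Cons P Ps)
    then have P: "local_End C P" "P \<in> Ob C" using ds_Ob by auto
    obtain Y' where Y': "is_direct_sum C Ps Y'" "is_direct_sum C [P, Y'] Y"
      using Cons.prems(1) by (rule ds_ConsE)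
    have "Y' \<preceq> X" using support_le_summand(2)[OF Y'(2)] Cons.prems(3) by (rule support_le_trans)
    then obtain r S Z where rSZ: "is_direct_sum C (replicate r X) S" "is_direct_sum C [Y', Z] S"
      using Cons.IH[OF Y'(1)] Cons.prems(2) by auto
    have X: "X \<in> Ob C" using support_le_Ob Cons.prems by blast
    have "mult P Y > 0" using mult_sum[OF Y'(2), of P] mult_self[OF P] by simp
    then obtain X' where X': "is_direct_sum C [P, X'] X"
      using mult_pos_split[OF X] support_leD[OF Cons.prems(3) P] by blast
    obtain Z' where Z': "is_direct_sum C [X', Z] Z'"
      using ex_direct_sum[of X' Z] ds_Ob(2)[OF X'] ds_Ob(2)[OF rSZ(2)] by auto
    obtain S' where S': "is_direct_sum C [X, S] S'"
      using ex_direct_sum X ds_Ob(1)[OF rSZ(1)] by blast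
    have "is_direct_sum C [Y, Z'] S'"
      using mult_sum[OF Y'(2)] mult_sum[OF Z'] mult_sum[OF S'] mult_sum[OF X'] mult_sum[OF rSZ(2)]
        support_le_Ob(1)[OF Cons.prems(3)] ds_Ob(1)[OF Z'] ds_Ob(1)[OF S']
      by (intro ds_if_mult) auto
    moreover have "is_direct_sum C (replicate (Suc r) X) S'"
      using ds_ConsI[OF rSZ(1) S'] by simp
    ultimately show ?case by blast
  qed
qed

lemma add_of_iff: "X \<in> Ob C \<Longrightarrow> Y \<in> add_of C X \<longleftrightarrow> Y \<preceq> X"
proof
  assume "Y \<preceq> X"
  then show "Y \<in> add_of C X"
    using support_le_complement unfolding add_of_def direct_summand_def by blast
next
  assume X: "X \<in> Ob C" and "Y \<in> add_of C X"
  then obtain r S Z where "is_direct_sum C (replicate r X) S" "is_direct_sum C [Y, Z] S"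
    unfolding add_of_def direct_summand_def by blast
  then have e: "r * mult P X = mult P Y + mult P Z" for P
    using mult_replicate mult_sum by metis
  have "Y \<in> Ob C" using ds_Ob(2)[OF \<open>is_direct_sum C [Y, Z] S\<close>] by simp
  moreover have "mult P X > 0" if "mult P Y > 0" for P
    using e[of P] that by (cases "mult P X") auto
  ultimately show "Y \<preceq> X"
    using X by (simp add: support_le_def)
qed

text \<open>
  Objects with local endomorphism ring are nonzero, so a decomposition of an indecomposable object into
  such objects has a single term, and invertibility of endomorphisms is transported along the resulting
  isomorphism.
\<close>

lemma local_if_indecomposable:
  assumes "indecomposable_ob C X"
  shows "local_End C X"
proof -
  have X: "X \<in> Ob C" using assms by (simp add: indecomposable_ob_def)
  obtain Xs where Xs: "is_direct_sum C Xs X" "\<forall>Y \<in> set Xs. local_End C Y"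
    using X by (rule ex_local_decomposition)
  obtain P Ps where Ps: "Xs = P # Ps"
    using Xs assms by (cases Xs) (auto simp: indecomposable_ob_def)
  then obtain Y where Y: "is_direct_sum C [P, Y] X" using Xs ds_ConsE by blast
  have P: "P \<in> Ob C" "local_End C P" using Y Ps Xs ds_Ob by auto
  then have "\<not> zero_ob C P" using local_nonzero zero_ob_iff by blast
  then have "zero_ob C Y" using assms Y by (auto simp: indecomposable_ob_def)
  then have "is_direct_sum C [P, Y] P" using P zero_ds by blast
  then have "P \<cong> X" using Y ds_unique by blast
  then obtain f g where fg: "arr f P X" "arr g X P" "g \<cdot> f = Idt C P" "f \<cdot> g = Idt C X" by (rule isoE)
  have conj: "iso_mor C P P (g \<cdot> (h \<cdot> f))" if h: "iso_mor C X X h" for h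
  proof -
    obtain k where k: "arr h X X" "arr k X X" "k \<cdot> h = Idt C X" "h \<cdot> k = Idt C X"
      using h X by (auto simp: iso_mor_arr)
    have "arr (g \<cdot> (h \<cdot> f)) P P" "arr (g \<cdot> (k \<cdot> f)) P P" using fg k by (auto intro: arr_comp)
    moreover have "(g \<cdot> (k \<cdot> f)) \<cdot> (g \<cdot> (h \<cdot> f)) = Idt C P" "(g \<cdot> (h \<cdot> f)) \<cdot> (g \<cdot> (k \<cdot> f)) = Idt C P"
      using fg(1,2,3) k(1,2) arr_comp[OF fg(1) k(1)] arr_comp[OF fg(1) k(2)]
      by (simp_all add: comp_simps comp_lift[OF fg(4)] comp_lift[OF k(3)] comp_lift[OF k(4)])
    ultimately show ?thesis using P by (auto simp: iso_mor_arr)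
  qed
  have conj': "iso_mor C X X h" if h: "arr h X X" "iso_mor C P P (g \<cdot> (h \<cdot> f))" for h
  proof -
    obtain k where k: "arr k P P" "k \<cdot> (g \<cdot> (h \<cdot> f)) = Idt C P" "(g \<cdot> (h \<cdot> f)) \<cdot> k = Idt C P"
      using h P by (auto simp: iso_mor_arr)
    have hf: "arr (h \<cdot> f) P X" "arr (k \<cdot> g) X P" using fg h k by (auto intro: arr_comp)
    have "f \<cdot> ((g \<cdot> (h \<cdot> f)) \<cdot> k) = f" unfolding k(3) using fg by (simp add: comp_simps)
    then have 1: "h \<cdot> (f \<cdot> k) = f"
      using fg(1,2) h(1) k(1) hf by (simp add: comp_simps comp_lift[OF fg(4)])
    have "(k \<cdot> (g \<cdot> (h \<cdot> f))) \<cdot> g = g" unfolding k(2) using fg by (simp add: comp_simps)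
    then have 2: "k \<cdot> (g \<cdot> h) = g"
      using fg(1,2,4) h(1) k(1) hf arr_comp[OF hf(1) fg(2)] by (simp add: comp_simps)
    have "(f \<cdot> (k \<cdot> g)) \<cdot> h = Idt C X" "h \<cdot> (f \<cdot> (k \<cdot> g)) = Idt C X"
      using fg(1,2,4) h(1) k(1) hf 2 comp_lift[OF 1, of ] comp_assoc[OF h(1) arr_comp[OF k(1) fg(1)] arr_into[OF fg(2)]] 1
      by (simp_all add: comp_simps)
    then show ?thesis using h(1) X arr_comp[OF hf(2) fg(1)] by (auto simp: iso_mor_arr)
  qed
  show ?thesis
    unfolding local_End_def
  proof (intro conjI ballI impI)
    show "Idt C X \<noteq> 0" using assms X by (auto simp: indecomposable_ob_def zero_ob_iff)
    fix h k assume "h \<in> Hom C X X" "k \<in> Hom C X X" and n: "\<not> iso_mor C X X h \<and> \<not> iso_mor C X X k"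
    then have hk: "arr h X X" "arr k X X" using X by (auto simp: arr_def)
    have a: "arr (g \<cdot> (h \<cdot> f)) P P" "arr (g \<cdot> (k \<cdot> f)) P P" "arr (h \<cdot> f) P X" "arr (k \<cdot> f) P X"
      using hk fg by (auto intro: arr_comp)
    have "g \<cdot> ((h + k) \<cdot> f) = g \<cdot> (h \<cdot> f) + g \<cdot> (k \<cdot> f)"
      using comp_add_left[OF hk arr_into[OF fg(1)]] comp_add_right[OF fg(2) a(3,4)] by simp
    moreover have "\<not> iso_mor C P P (g \<cdot> (h \<cdot> f) + g \<cdot> (k \<cdot> f))"
      using P(2) n conj' hk a unfolding local_End_def by (meson arr_Hom)
    ultimately show "\<not> iso_mor C X X (h + k)" using conj by metis
  qed
qed

lemma indecomposable_if_local:
  assumes "local_End C X" "X \<in> Ob C"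
  shows "indecomposable_ob C X"
proof -
  have "zero_ob C A \<or> zero_ob C B" if AB: "is_direct_sum C [A, B] X" for A B
  proof (rule ccontr)
    assume "\<not> ?thesis"
    then have n: "\<not> zero_ob C A" "\<not> zero_ob C B" by auto
    have *: "mult X D > 0" if D: "D \<in> Ob C" "\<not> zero_ob C D" "\<And>P. mult P D \<le> mult P X" for D
    proof -
      obtain P where P: "local_End C P" "P \<in> Ob C" "mult P D \<noteq> 0"
        using zero_if_mult[OF D(1)] D(2) by blast
      then have "mult P X \<noteq> 0" using D(3)[of P] by simp
      then have "P \<cong> X" using mult_local[OF assms, of P] by (simp split: if_splits)
      then show ?thesis using P(3) mult_iso_left[of P X D] by simp
    qed
    have "mult X A > 0" by (rule *) (use AB n ds_Ob(2)[OF AB] mult_sum[OF AB] in auto)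
    moreover have "mult X B > 0" by (rule *) (use AB n ds_Ob(2)[OF AB] mult_sum[OF AB] in auto)
    ultimately show False using mult_sum[OF AB, of X] mult_self[OF assms] by simp
  qed
  moreover have "\<not> zero_ob C X" using assms local_nonzero zero_ob_iff by blast
  ultimately show ?thesis using assms by (auto simp: indecomposable_ob_def)
qed

lemma indecomposable_iff: "indecomposable_ob C X \<longleftrightarrow> local_End C X \<and> X \<in> Ob C"
proof
  assume X: "indecomposable_ob C X"
  then have "X \<in> Ob C" unfolding indecomposable_ob_def by (elim conjE)
  then show "local_End C X \<and> X \<in> Ob C" using local_if_indecomposable[OF X] by simp
qed (elim conjE, rule indecomposable_if_local)

text \<open>
  A multiplicity of at least \<open>2\<close> lets one split off \<open>P\<close> twice, and two isomorphic terms in a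
  decomposition count twice in the multiplicity.
\<close>

lemma basic_iff: "basic_ob C X \<longleftrightarrow> X \<in> Ob C \<and> (\<forall>P \<in> Ob C. local_End C P \<longrightarrow> mult P X \<le> 1)"
proof
  assume b: "basic_ob C X"
  then have X: "X \<in> Ob C" by (simp add: basic_ob_def)
  have "mult P X \<le> 1" if P: "P \<in> Ob C" "local_End C P" for P
  proof (rule ccontr)
    assume n: "\<not> mult P X \<le> 1"
    then obtain X' where X': "is_direct_sum C [P, X'] X" using X mult_pos_split by (metis not_gr_zero zero_le_one)
    then have "mult P X' > 0" using n mult_sum[OF X', of P] mult_self P by simp
    then obtain X'' where X'': "is_direct_sum C [P, X''] X'" using mult_pos_split[of X' P] ds_Ob(2)[OF X'] by auto
    obtain Xs where Xs: "is_direct_sum C Xs X''" "\<forall>Y \<in> set Xs. local_End C Y"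
      using ex_local_decomposition[of X''] ds_Ob(2)[OF X''] by auto
    have "is_direct_sum C (P # P # Xs) X" using X' X'' Xs ds_ConsI by blast
    moreover have "\<forall>Y \<in> set (P # P # Xs). indecomposable_ob C Y"
      using P Xs ds_Ob(2)[OF Xs(1)] by (auto simp: indecomposable_iff)
    ultimately have "\<not> (P # P # Xs) ! 0 \<cong> (P # P # Xs) ! 1"
      using b unfolding basic_ob_def by (metis One_nat_def Suc_less_eq length_Cons n_not_Suc_n zero_less_Suc)
    then show False using iso_refl P by simp
  qed
  then show "X \<in> Ob C \<and> (\<forall>P \<in> Ob C. local_End C P \<longrightarrow> mult P X \<le> 1)" using X by blast
next
  assume m: "X \<in> Ob C \<and> (\<forall>P \<in> Ob C. local_End C P \<longrightarrow> mult P X \<le> 1)"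
  have "\<not> Xs ! i \<cong> Xs ! j" if Xs: "is_direct_sum C Xs X" "\<forall>Y \<in> set Xs. indecomposable_ob C Y"
    and ij: "i < length Xs" "j < length Xs" "i \<noteq> j" for Xs i j
  proof
    assume iso: "Xs ! i \<cong> Xs ! j"
    let ?P = "Xs ! i"
    have P: "local_End C ?P" "?P \<in> Ob C" using Xs ij by (auto simp: indecomposable_iff)
    have "{i, j} \<subseteq> {k. k < length Xs \<and> ?P \<cong> Xs ! k}" using ij iso iso_refl P by auto
    then have "card {i, j} \<le> card {k. k < length Xs \<and> ?P \<cong> Xs ! k}" by (intro card_mono) auto
    also have "\<dots> = mult ?P X"
      using mult_eq[OF Xs(1), of ?P] Xs(2) by (simp add: indecomposable_iff multiplicity_in_def length_filter_conv_card)
    finally show False using m P ij by fastforce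
  qed
  then show "basic_ob C X" using m by (auto simp: basic_ob_def)
qed

lemma ex_basic:
  assumes "X \<in> Ob C"
  shows "\<exists>N. basic_ob C N \<and> N \<preceq> X \<and> X \<preceq> N"
proof -
  obtain Xs where "is_direct_sum C Xs X" "\<forall>Y \<in> set Xs. local_End C Y"
    using assms by (rule ex_local_decomposition)
  then show ?thesis
  proof (induction Xs arbitrary: X)
    case Nil
    then have "basic_ob C X" using mult_zero[OF Nil(1)] ds_Ob(1)[OF Nil(1)] by (simp add: basic_iff)
    then show ?case using support_le_refl by (auto simp: basic_ob_def)
  next
    case (Cons P Ps)
    then have P: "local_End C P" "P \<in> Ob C" using ds_Ob by auto
    obtain Y where Y: "is_direct_sum C Ps Y" "is_direct_sum C [P, Y] X"
      using Cons.prems(1) by (rule ds_ConsE)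
    then obtain N where N: "basic_ob C N" "N \<preceq> Y" "Y \<preceq> N" using Cons by auto
    note le = support_le_summand[OF Y(2)]
    show ?case
    proof (cases "mult P N > 0")
      case True
      have "P \<preceq> N"
        unfolding support_le_def
      proof (intro conjI ballI impI)
        fix Q assume Q: "Q \<in> Ob C" "local_End C Q" "mult Q P > 0"
        then have "Q \<cong> P" using mult_local[OF P, of Q] by (simp split: if_splits)
        then show "mult Q N > 0" using True mult_iso_left by metis
      qed (use P N in \<open>auto simp: basic_ob_def\<close>)
      then show ?thesis using support_le_trans[OF N(2) le(2)] support_le_sum[OF Y(2)] N by blast
    next
      case False
      obtain N' where N': "is_direct_sum C [P, N] N'" using ex_direct_sum[of P N] P(2) N(1) unfolding basic_ob_def by blast
      have "basic_ob C N'"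
        unfolding basic_iff
      proof (intro conjI ballI impI)
        fix Q assume Q: "Q \<in> Ob C" "local_End C Q"
        have "mult Q N \<le> 1" using N Q by (simp add: basic_iff)
        moreover have "mult Q N = 0" if "Q \<cong> P" using False mult_iso_left[OF that] by simp
        ultimately show "mult Q N' \<le> 1" using mult_sum[OF N'] mult_local[OF P] by auto
      qed (use N' ds_Ob in auto)
      moreover have "N' \<preceq> X"
        by (rule support_le_sum[OF N' le(1) support_le_trans[OF N(2) le(2)]])
      moreover have "X \<preceq> N'"
        using support_le_summand[OF N'] support_le_trans[OF N(3)] by (intro support_le_sum[OF Y(2)]) auto
      ultimately show ?thesis by blast
    qed
  qed
qed

lemma basic_iso:
  assumes "basic_ob C X" "basic_ob C Y" "X \<preceq> Y" "Y \<preceq> X"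
  shows "X \<cong> Y"
proof (rule iso_if_mult_eq)
  fix P assume P: "local_End C P" "P \<in> Ob C"
  have "mult P X \<le> 1" "mult P Y \<le> 1" "mult P X > 0 \<longleftrightarrow> mult P Y > 0"
    using assms P support_leD by (auto simp: basic_iff)
  then show "mult P X = mult P Y" by linarith
qed (use assms in \<open>auto simp: basic_ob_def\<close>)

end


section \<open>Exact sequences and sums of triangles\<close>

context triangulated_klinear_category
begin

lemma arr_ShM: "arr f X Y \<Longrightarrow> arr (ShM C f) (Sh C X) (Sh C Y)"
  using ShM_fully_faithful[of X Y] by (auto simp: arr_def Sh_Ob bij_betw_def)

lemma ShM_comp: "\<lbrakk>arr f X Y; arr g Y Z\<rbrakk> \<Longrightarrow> ShM C (g \<cdot> f) = ShM C g \<cdot> ShM C f"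
  by (auto simp: arr_def ShM_Cmp)

lemma ShM_plus: "\<lbrakk>arr f X Y; arr g X Y\<rbrakk> \<Longrightarrow> ShM C (f + g) = ShM C f + ShM C g"
  by (auto simp: arr_def ShM_add)

lemma ShM_zero: "\<lbrakk>X \<in> Ob C; Y \<in> Ob C\<rbrakk> \<Longrightarrow> ShM C 0 = 0"
  using ShM_plus[of 0 X Y 0] by (simp add: arr_zero)

lemma ShM_faithful: "\<lbrakk>ShM C f = ShM C g; arr f X Y; arr g X Y\<rbrakk> \<Longrightarrow> f = g"
  using ShM_fully_faithful[of X Y] by (auto simp: arr_def bij_betw_def inj_on_def)

lemma ShM_eq_zero: "\<lbrakk>ShM C f = 0; arr f X Y\<rbrakk> \<Longrightarrow> f = 0"
  using ShM_faithful[of f 0 X Y] ShM_zero[of X Y] by (auto simp: arr_zero arr_dom arr_cod)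

lemma ShM_full:
  assumes "arr h (Sh C X) (Sh C Y)" "X \<in> Ob C" "Y \<in> Ob C"
  obtains f where "arr f X Y" "h = ShM C f"
  using ShM_fully_faithful[of X Y] assms by (auto simp: arr_def bij_betw_def image_iff)

lemma Sh_iso_cancel:
  assumes "Sh C X \<cong> Sh C Y" "X \<in> Ob C" "Y \<in> Ob C"
  shows "X \<cong> Y"
proof -
  obtain f g where fg: "arr f (Sh C X) (Sh C Y)" "arr g (Sh C Y) (Sh C X)"
    "g \<cdot> f = Idt C (Sh C X)" "f \<cdot> g = Idt C (Sh C Y)"
    using assms(1) by (rule isoE)
  obtain f' where f': "arr f' X Y" "f = ShM C f'" using fg(1) assms(2,3) by (rule ShM_full)
  obtain g' where g': "arr g' Y X" "g = ShM C g'" using fg(2) assms(3,2) by (rule ShM_full)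
  have "ShM C (g' \<cdot> f') = ShM C (Idt C X)" using fg f' g' assms by (simp add: ShM_comp[OF f'(1) g'(1)] ShM_Idt)
  then have 1: "g' \<cdot> f' = Idt C X"
    by (rule ShM_faithful) (use f' g' assms in \<open>auto intro: arr_comp arr_Idt\<close>)
  have "ShM C (f' \<cdot> g') = ShM C (Idt C Y)" using fg f' g' assms by (simp add: ShM_comp[OF g'(1) f'(1)] ShM_Idt)
  then have 2: "f' \<cdot> g' = Idt C Y"
    by (rule ShM_faithful) (use f' g' assms in \<open>auto intro: arr_comp arr_Idt\<close>)
  show ?thesis by (rule isoI[OF f'(1) g'(1) 1 2])
qed

lemma biproduct_Sh:
  assumes "biproduct A B S i1 i2 p1 p2"
  shows "biproduct (Sh C A) (Sh C B) (Sh C S) (ShM C i1) (ShM C i2) (ShM C p1) (ShM C p2)"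
proof -
  note b = biproductD[OF assms]
  have "ShM C (i1 \<cdot> p1 + i2 \<cdot> p2) = ShM C (i1 \<cdot> p1) + ShM C (i2 \<cdot> p2)"
    using b by (intro ShM_plus) (auto intro: arr_comp)
  then have "ShM C i1 \<cdot> ShM C p1 + ShM C i2 \<cdot> ShM C p2 = Idt C (Sh C S)"
    using b by (simp add: ShM_comp[OF b(3) b(1)] ShM_comp[OF b(4) b(2)] ShM_Idt)
  then show ?thesis
    unfolding biproduct_def
    using b ShM_comp[OF b(1) b(3)] ShM_comp[OF b(1) b(4)] ShM_comp[OF b(2) b(3)] ShM_comp[OF b(2) b(4)]
      ShM_zero[OF b(10,11)]
    by (auto simp: ShM_Idt intro: arr_ShM)
qed

lemma ds_Sh: "is_direct_sum C [A, B] S \<Longrightarrow> is_direct_sum C [Sh C A, Sh C B] (Sh C S)"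
  by (meson ds_biproductE biproduct_Sh biproduct_ds)

lemma zero_ob_Sh: "zero_ob C Z \<Longrightarrow> zero_ob C (Sh C Z)"
  using ShM_zero[of Z Z] ShM_Idt[of Z] by (auto simp: zero_ob_iff Sh_Ob)

abbreviation tri :: "'o \<Rightarrow> 'o \<Rightarrow> 'o \<Rightarrow> 'm \<Rightarrow> 'm \<Rightarrow> 'm \<Rightarrow> bool" where
  "tri X Y Z u v w \<equiv> (X, Y, Z, u, v, w) \<in> Tri C"

lemma candidate_arr:
  "candidate_triangle C (X, Y, Z, u, v, w) \<longleftrightarrow> arr u X Y \<and> arr v Y Z \<and> arr w Z (Sh C X)"
  by (auto simp: candidate_triangle_def arr_def Sh_Ob)

lemma triD:
  assumes "tri X Y Z u v w"
  shows "arr u X Y" "arr v Y Z" "arr w Z (Sh C X)" "X \<in> Ob C" "Y \<in> Ob C" "Z \<in> Ob C"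
  using Tri_candidate[OF assms] by (auto simp: candidate_arr dest: arr_dom arr_cod)

lemma tri_rotate: "tri X Y Z u v w \<Longrightarrow> tri Y Z (Sh C X) v w (- ShM C u)"
  using TR2[of X Y Z u v w] Tri_candidate[of "(X, Y, Z, u, v, w)"] by blast

lemma tri_rotate_back:
  "\<lbrakk>tri Y Z (Sh C X) v w (- ShM C u); arr u X Y\<rbrakk> \<Longrightarrow> tri X Y Z u v w"
  using TR2[of X Y Z u v w] triD[of Y Z "Sh C X" v w] by (auto simp: candidate_arr)

lemma tri_zero_Idt:
  assumes O: "zero_ob C O\<^sub>0" and A: "A \<in> Ob C"
  shows "tri O\<^sub>0 A A 0 (Idt C A) 0"
proof (rule tri_rotate_back)
  show "tri A A (Sh C O\<^sub>0) (Idt C A) 0 (- ShM C 0)"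
    using TR1_Idt[OF A zero_ob_Sh[OF O]] ShM_zero[OF ds_Ob(1)[OF O] A] by simp
  show "arr 0 O\<^sub>0 A" by (rule arr_zero[OF ds_Ob(1)[OF O] A])
qed

text \<open>
  A morphism from the trivial triangle \<open>X \<rightarrow> X \<rightarrow> 0 \<rightarrow> X[1]\<close> to the given one makes \<open>v u\<close> factor through
  a zero object.
\<close>

lemma tri_comp_zero: "tri X Y Z u v w \<Longrightarrow> v \<cdot> u = 0"
proof -
  assume t: "tri X Y Z u v w"
  note a = triD[OF t]
  obtain O0 where O0: "zero_ob C O0" using ex_zero_ob by blast
  have "tri X X O0 (Idt C X) 0 0" using a O0 by (intro TR1_Idt)
  then have "\<exists>c \<in> Hom C O0 Z. c \<cdot> 0 = v \<cdot> u \<and> ShM C (Idt C X) \<cdot> 0 = w \<cdot> c"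
    by (rule TR3[OF _ t]) (use a in \<open>auto dest: arr_Hom intro: Idt_Hom\<close>)
  then obtain c where "arr c O0 Z" "c \<cdot> 0 = v \<cdot> u" using a O0 ds_Ob(1)[OF O0] by (auto simp: arr_def)
  then show ?thesis by (simp add: comp_zero_right)
qed

lemma tri_comp_zero2: "tri X Y Z u v w \<Longrightarrow> w \<cdot> v = 0"
  by (rule tri_comp_zero[OF tri_rotate])

lemma tri_comp_zero3: "tri X Y Z u v w \<Longrightarrow> ShM C u \<cdot> w = 0"
proof -
  assume t: "tri X Y Z u v w"
  show ?thesis
    using tri_comp_zero2[OF tri_rotate[OF t]]
      comp_uminus_left[OF arr_ShM[OF triD(1)[OF t]] arr_into[OF triD(3)[OF t]]] by simp
qed

text \<open>
  Compare with the triangle \<open>0 \<rightarrow> A \<rightarrow> A \<rightarrow> 0[1]\<close>: a morphism of triangles extending \<open>f\<close> is a factorisation.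
\<close>

lemma exact_contra_mid:
  assumes t: "tri X Y Z u v w" and f: "arr f Y A" "f \<cdot> u = 0"
  obtains g where "arr g Z A" "f = g \<cdot> v"
proof -
  note a = triD[OF t]
  obtain O0 where O0: "zero_ob C O0" using ex_zero_ob by blast
  have A: "A \<in> Ob C" using f by (simp add: arr_cod)
  have z: "arr 0 X O0" using a O0 ds_Ob(1)[OF O0] by (simp add: arr_zero)
  have "f \<cdot> u = 0 \<cdot> (0::'m)" using f(2) comp_zero_left'[OF z] by simp
  then have "\<exists>c \<in> Hom C Z A. c \<cdot> v = Idt C A \<cdot> f \<and> ShM C 0 \<cdot> w = 0 \<cdot> c"
    using TR3[OF t tri_zero_Idt[OF O0 A], of 0 f] z f by (auto dest: arr_Hom)
  then obtain c where "arr c Z A" "c \<cdot> v = Idt C A \<cdot> f" using a A by (auto simp: arr_def)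
  then show thesis using that f by (simp add: comp_Idt_left arr_into)
qed

text \<open>
  A morphism from the rotated trivial triangle \<open>A \<rightarrow> 0 \<rightarrow> A[1]\<close> to the rotation of the given one is, up to
  the full faithfulness of the shift, a factorisation of \<open>f\<close>.
\<close>

lemma exact_cov_mid:
  assumes t: "tri X Y Z u v w" and f: "arr f A Y" "v \<cdot> f = 0"
  obtains g where "arr g A X" "f = u \<cdot> g"
proof -
  note a = triD[OF t]
  obtain O0 where O0: "zero_ob C O0" using ex_zero_ob by blast
  have A: "A \<in> Ob C" using f by (simp add: arr_dom)
  have z: "arr 0 O0 Z" using a O0 ds_Ob(1)[OF O0] by (simp add: arr_zero)
  have "0 \<cdot> (0::'m) = v \<cdot> f" using f(2) comp_zero_right[OF z] by simp
  then have "\<exists>c \<in> Hom C (Sh C A) (Sh C X). c \<cdot> 0 = w \<cdot> 0 \<and> ShM C f \<cdot> (- ShM C (Idt C A)) = (- ShM C u) \<cdot> c"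
    using TR3[OF tri_rotate[OF TR1_Idt[OF A O0]] tri_rotate[OF t], of f 0] z f by (auto dest: arr_Hom)
  then obtain c where c: "arr c (Sh C A) (Sh C X)" "ShM C f \<cdot> (- ShM C (Idt C A)) = (- ShM C u) \<cdot> c"
    using a A by (auto simp: arr_def Sh_Ob)
  obtain g where g: "arr g A X" "c = ShM C g" using c(1) A a(4) by (rule ShM_full)
  have "ShM C f \<cdot> (- ShM C (Idt C A)) = - ShM C f"
    using comp_uminus_right[OF arr_ShM[OF f(1)] arr_ShM[OF arr_Idt[OF A]]] comp_Idt_right[OF arr_ShM[OF f(1)]] A
    by (simp add: ShM_Idt)
  moreover have "(- ShM C u) \<cdot> c = - (ShM C u \<cdot> c)"
    by (rule comp_uminus_left[OF arr_ShM[OF a(1)] arr_into[OF c(1)]])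
  ultimately have "ShM C f = ShM C (u \<cdot> g)"
    using c(2) g ShM_comp[OF g(1) a(1)] by simp
  then have "f = u \<cdot> g" by (rule ShM_faithful[OF _ f(1) arr_comp[OF g(1) a(1)]])
  then show thesis using that g by blast
qed

lemma exact_contra_third:
  assumes "tri X Y Z u v w" "arr f Z A" "f \<cdot> v = 0"
  obtains g where "arr g (Sh C X) A" "f = g \<cdot> w"
  using exact_contra_mid[OF tri_rotate[OF assms(1)] assms(2,3)] .

lemma exact_cov_third:
  assumes "tri X Y Z u v w" "arr f A Z" "w \<cdot> f = 0"
  obtains g where "arr g A Y" "f = v \<cdot> g"
  using exact_cov_mid[OF tri_rotate[OF assms(1)] assms(2,3)] .

lemma exact_cov_Sh_first:
  assumes t: "tri X Y Z u v w" and f: "arr f A (Sh C X)" "ShM C u \<cdot> f = 0"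
  obtains g where "arr g A Z" "f = w \<cdot> g"
proof (rule exact_cov_third[OF tri_rotate[OF t] f(1)])
  show "(- ShM C u) \<cdot> f = 0"
    using comp_uminus_left[OF arr_ShM[OF triD(1)[OF t]] arr_into[OF f(1)]] f(2) by simp
qed (rule that)

lemma exact_cov_Sh_mid:
  assumes t: "tri X Y Z u v w" and f: "arr f A (Sh C Y)" "ShM C v \<cdot> f = 0"
  obtains g where "arr g A (Sh C X)" "f = ShM C u \<cdot> g"
proof -
  obtain g where g: "arr g A (Sh C X)" "f = (- ShM C u) \<cdot> g"
    using exact_cov_Sh_first[OF tri_rotate[OF t] f] .
  have "f = ShM C u \<cdot> (- g)"
    using g comp_uminus_left[OF arr_ShM[OF triD(1)[OF t]] arr_into[OF g(1)]]
      comp_uminus_right[OF arr_ShM[OF triD(1)[OF t]] g(1)] by simp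
  then show thesis using that arr_uminus[OF g(1)] by blast
qed

text \<open>
  The identity of \<open>Z\<close> lifts to a section \<open>s\<close> of \<open>v\<close>, and \<open>1 - s v\<close> factors through \<open>u\<close>, which gives the
  retraction of \<open>u\<close>.  The monomorphism property of \<open>u\<close> is exactness at \<open>X[1]\<close>.
\<close>

lemma tri_split:
  assumes t: "tri X Y Z u v 0"
  shows "is_direct_sum C [X, Z] Y"
proof -
  note a = triD[OF t]
  have "0 \<cdot> Idt C Z = 0" using comp_zero_left'[OF arr_Idt[OF a(6)]] .
  then obtain s where s: "arr s Z Y" "v \<cdot> s = Idt C Z"
    using exact_cov_third[OF t arr_Idt[OF a(6)]] by metis
  let ?d = "Idt C Y - s \<cdot> v"
  have sv: "arr (s \<cdot> v) Y Y" using s a by (auto intro: arr_comp)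
  have d: "arr ?d Y Y" using a by (intro arr_diff arr_Idt sv)
  have "v \<cdot> ?d = v \<cdot> Idt C Y - v \<cdot> (s \<cdot> v)" by (rule comp_diff_right[OF a(2) arr_Idt[OF a(5)] sv])
  also have "\<dots> = 0" using s(1) a by (simp add: comp_simps comp_lift[OF s(2)])
  finally obtain r where r: "arr r Y X" "?d = u \<cdot> r" using exact_cov_mid[OF t d] by blast
  have mono: "g = 0" if g: "arr g A X" "u \<cdot> g = 0" for g A
  proof -
    have "ShM C u \<cdot> ShM C g = 0"
      using ShM_comp[OF g(1) a(1)] g(2) ShM_zero[OF arr_dom[OF g(1)] a(5)] by simp
    then obtain k where "arr k (Sh C A) Z" "ShM C g = 0 \<cdot> k"
      using exact_cov_Sh_first[OF t arr_ShM[OF g(1)]] by blast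
    then have "ShM C g = 0" using comp_zero_left' by metis
    then show ?thesis using g(1) by (rule ShM_eq_zero)
  qed
  have du: "?d \<cdot> h = h - s \<cdot> (v \<cdot> h)" if "arr h A Y" for h A
    using comp_diff_left[OF arr_Idt[OF a(5)] sv arr_into[OF that]] s a that by (simp add: comp_simps)
  have "u \<cdot> (r \<cdot> u) = ?d \<cdot> u" unfolding r(2) using a r(1) by (simp add: comp_simps)
  also have "\<dots> = u" using du[OF a(1)] tri_comp_zero[OF t] s by (simp add: comp_zero_right)
  finally have "u \<cdot> (r \<cdot> u - Idt C X) = 0"
    using comp_diff_right[OF a(1) arr_comp[OF a(1) r(1)] arr_Idt[OF a(4)]] a by (simp add: comp_simps)
  then have "r \<cdot> u - Idt C X = 0"
    by (rule mono[OF arr_diff[OF arr_comp[OF a(1) r(1)] arr_Idt[OF a(4)]]])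
  then have ru: "r \<cdot> u = Idt C X" by simp
  have "u \<cdot> (r \<cdot> s) = ?d \<cdot> s" unfolding r(2) using a r(1) s(1) by (simp add: comp_simps)
  also have "\<dots> = 0" using du[OF s(1)] s(2) comp_Idt_right[OF s(1)] by simp
  finally have rs: "r \<cdot> s = 0" by (rule mono[OF arr_comp[OF s(1) r(1)]])
  have "u \<cdot> r + s \<cdot> v = Idt C Y" using r(2) by (simp add: algebra_simps)
  then have "biproduct X Z Y u s r v"
    unfolding biproduct_def using a(1,2) r(1) s ru rs tri_comp_zero[OF t] by simp
  then show ?thesis by (rule biproduct_ds)
qed

text \<open>
  The cone of \<open>w\<close> is the shift of the object \<open>Y\<close> that is sought; since the shift is only essentially
  surjective and full, this holds up to an isomorphism, and the triangle is then rotated back twice.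
\<close>

lemma tri_complete:
  assumes w: "arr w Z (Sh C X)" and X: "X \<in> Ob C"
  obtains Y u v where "tri X Y Z u v w"
proof -
  note Z = arr_dom[OF w] and SX = arr_cod[OF w]
  obtain Q a b where t: "tri Z (Sh C X) Q w a b"
    using TR1_cone[OF Z SX arr_Hom[OF w]] by blast
  note ta = triD[OF t]
  obtain Y where Y: "Y \<in> Ob C" "Sh C Y \<cong> Q" using Sh_ess_surj[OF ta(6)] by blast
  obtain f g where fg: "arr f (Sh C Y) Q" "arr g Q (Sh C Y)" "g \<cdot> f = Idt C (Sh C Y)" "f \<cdot> g = Idt C Q"
    using Y(2) by (rule isoE)
  have a': "arr (- (g \<cdot> a)) (Sh C X) (Sh C Y)" and b': "arr (- (b \<cdot> f)) (Sh C Y) (Sh C Z)"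
    using ta fg by (auto intro!: arr_uminus intro: arr_comp)
  obtain u where u: "arr u X Y" "- (g \<cdot> a) = ShM C u" using a' X Y(1) by (rule ShM_full)
  obtain v where v: "arr v Y Z" "- (b \<cdot> f) = ShM C v" using b' Y(1) Z by (rule ShM_full)
  have "tri Z (Sh C X) (Sh C Y) w (- ShM C u) (- ShM C v)"
  proof (rule TR1_iso[OF t])
    show "candidate_triangle C (Z, Sh C X, Sh C Y, w, - ShM C u, - ShM C v)"
      using w u v by (auto simp: candidate_arr intro!: arr_uminus arr_ShM)
    show "iso_mor C Z Z (Idt C Z)" using Z iso_mor_arr[OF Z Z, of "Idt C Z"] arr_Idt[OF Z] comp_Idt_right[OF arr_Idt[OF Z]] by blast
    show "iso_mor C (Sh C X) (Sh C X) (Idt C (Sh C X))"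
      using iso_mor_arr[OF SX SX, of "Idt C (Sh C X)"] arr_Idt[OF SX] comp_Idt_right[OF arr_Idt[OF SX]] by blast
    show "iso_mor C Q (Sh C Y) g" using iso_mor_arr[of Q "Sh C Y" g] fg ta Y Sh_Ob by blast
    show "Idt C (Sh C X) \<cdot> w = w \<cdot> Idt C Z" using w by (simp add: comp_Idt_left comp_Idt_right arr_into)
    show "g \<cdot> a = - ShM C u \<cdot> Idt C (Sh C X)"
      using u(2) comp_Idt_right[OF arr_comp[OF ta(2) fg(2)]] by (simp flip: u(2))
    have "- ShM C v \<cdot> g = (b \<cdot> f) \<cdot> g" by (simp flip: v(2))
    also have "\<dots> = b" using ta fg by (simp add: comp_simps)
    finally show "ShM C (Idt C Z) \<cdot> b = - ShM C v \<cdot> g"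
      using ta Z by (simp add: ShM_Idt comp_Idt_left arr_into)
  qed
  then have "tri Y Z (Sh C X) v w (- ShM C u)" by (rule tri_rotate_back[OF _ v(1)])
  then have "tri X Y Z u v w" by (rule tri_rotate_back[OF _ u(1)])
  then show thesis by (rule that)
qed

lemma iso_left_right_inverse:
  assumes "arr h A B" "arr g B A" "arr k B A" "g \<cdot> h = Idt C A" "h \<cdot> k = Idt C B"
  shows "h \<cdot> g = Idt C B"
proof -
  have "g = g \<cdot> (h \<cdot> k)" using assms(2,5) by (simp add: comp_simps)
  also have "\<dots> = k" using assms(1-3) by (simp add: comp_simps comp_lift[OF assms(4)])
  finally show ?thesis using assms by simp
qed

lemma unipotent_inverse:
  assumes m: "arr m A A" "m \<cdot> m = 0"
  shows "(Idt C A - m) \<cdot> (Idt C A + m) = Idt C A" "(Idt C A + m) \<cdot> (Idt C A - m) = Idt C A"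
proof -
  note I = arr_Idt[OF arr_dom[OF m(1)]]
  have *: "(Idt C A + a) \<cdot> (Idt C A + b) = Idt C A + b + a + a \<cdot> b" if "arr a A A" "arr b A A" for a b
    using comp_add_left[OF I that(1) arr_into[OF arr_add[OF I that(2)]]]
      comp_add_right[OF that(1) I that(2)] comp_Idt_left[OF arr_into[OF arr_add[OF I that(2)]]]
      comp_Idt_right[OF that(1)] by (simp add: add.assoc)
  show "(Idt C A - m) \<cdot> (Idt C A + m) = Idt C A"
    using *[OF arr_uminus[OF m(1)] m(1)] comp_uminus_left[OF m(1) arr_into[OF m(1)]] m(2) by simp
  show "(Idt C A + m) \<cdot> (Idt C A - m) = Idt C A"
    using *[OF m(1) arr_uminus[OF m(1)]] comp_uminus_right[OF m(1) m(1)] m(2) by simp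
qed

text \<open>
  By \<open>unipotent_inverse\<close> both \<open>g h\<close> and \<open>h g\<close> are invertible, so \<open>h\<close> has a left and a right inverse.
\<close>

lemma nearly_inverse_iso:
  assumes h: "arr h A B" and g: "arr g B A"
    and m: "(g \<cdot> h - Idt C A) \<cdot> (g \<cdot> h - Idt C A) = 0"
    and n: "(h \<cdot> g - Idt C B) \<cdot> (h \<cdot> g - Idt C B) = 0"
  obtains k where "arr k B A" "k \<cdot> h = Idt C A" "h \<cdot> k = Idt C B"
proof -
  let ?m = "g \<cdot> h - Idt C A" and ?n = "h \<cdot> g - Idt C B"
  note A = arr_dom[OF h] and B = arr_cod[OF h]
  have am: "arr ?m A A" and an: "arr ?n B B"
    using h g A B by (auto intro!: arr_diff arr_Idt intro: arr_comp)
  have dm: "arr (Idt C A - ?m) A A" and dn: "arr (Idt C B - ?n) B B"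
    by (intro arr_diff arr_Idt am an A B)+
  have l: "arr ((Idt C A - ?m) \<cdot> g) B A" and r: "arr (g \<cdot> (Idt C B - ?n)) B A"
    by (intro arr_comp[OF g dm] arr_comp[OF dn g])+
  have 1: "((Idt C A - ?m) \<cdot> g) \<cdot> h = Idt C A"
    using unipotent_inverse(1)[OF am m] comp_assoc[OF dm g arr_into[OF h]] by simp
  have 2: "h \<cdot> (g \<cdot> (Idt C B - ?n)) = Idt C B"
    using unipotent_inverse(2)[OF an n] comp_assoc[OF h g arr_into[OF dn]] by simp
  show thesis by (rule that[OF l 1 iso_left_right_inverse[OF h l r 1 2]])
qed

text \<open>
  There are morphisms \<open>h\<close> and \<open>g\<close> in both directions
  between the sum of the third objects and a cone \<open>Q\<close> of \<open>u \<oplus> u'\<close>, assembled from the injections and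
  projections by the third axiom.  The errors \<open>g h - 1\<close> and \<open>h g - 1\<close> are killed by composition with
  the second morphism on one side and with the third on the other side, so by exactness they have square
  zero, and \<open>h\<close> is an isomorphism.
\<close>

lemma tri_sum:
  assumes t: "tri X Y Z u v w" and t': "tri X' Y' Z' u' v' w'"
    and bX: "biproduct X X' X'' a1 a2 r1 r2"
    and bY: "biproduct Y Y' Y'' b1 b2 s1 s2"
    and bZ: "biproduct Z Z' Z'' c1 c2 t1 t2"
  shows "tri X'' Y'' Z'' (b1 \<cdot> (u \<cdot> r1) + b2 \<cdot> (u' \<cdot> r2)) (c1 \<cdot> (v \<cdot> s1) + c2 \<cdot> (v' \<cdot> s2))
    (ShM C a1 \<cdot> (w \<cdot> t1) + ShM C a2 \<cdot> (w' \<cdot> t2))"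
proof -
  note T = triD[OF t] and T' = triD[OF t']
  note A = biproductD[OF bX] and B = biproductD[OF bY] and D = biproductD[OF bZ]
  note bS = biproduct_Sh[OF bX]
  note S = biproductD[OF bS]
  define u'' where "u'' = b1 \<cdot> (u \<cdot> r1) + b2 \<cdot> (u' \<cdot> r2)"
  define v'' where "v'' = c1 \<cdot> (v \<cdot> s1) + c2 \<cdot> (v' \<cdot> s2)"
  define w'' where "w'' = ShM C a1 \<cdot> (w \<cdot> t1) + ShM C a2 \<cdot> (w' \<cdot> t2)"
  \<comment> \<open>The rules for computing with a diagonal morphism, used for all three morphisms of the sum.\<close>
  have diag: "arr (j1 \<cdot> (x \<cdot> p1) + j2 \<cdot> (x' \<cdot> p2)) P Q"
      "(j1 \<cdot> (x \<cdot> p1) + j2 \<cdot> (x' \<cdot> p2)) \<cdot> i1 = j1 \<cdot> x"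
      "(j1 \<cdot> (x \<cdot> p1) + j2 \<cdot> (x' \<cdot> p2)) \<cdot> i2 = j2 \<cdot> x'"
      "q1 \<cdot> (j1 \<cdot> (x \<cdot> p1) + j2 \<cdot> (x' \<cdot> p2)) = x \<cdot> p1"
      "q2 \<cdot> (j1 \<cdot> (x \<cdot> p1) + j2 \<cdot> (x' \<cdot> p2)) = x' \<cdot> p2"
    if bP: "biproduct P1 P2 P i1 i2 p1 p2" and bQ: "biproduct Q1 Q2 Q j1 j2 q1 q2"
      and x: "arr x P1 Q1" "arr x' P2 Q2" for P1 P2 P i1 i2 p1 p2 Q1 Q2 Q j1 j2 q1 q2 x x'
  proof -
    note P = biproductD[OF bP] and Q = biproductD[OF bQ]
    have e: "arr (j1 \<cdot> (x \<cdot> p1)) P Q" "arr (j2 \<cdot> (x' \<cdot> p2)) P Q" and f: "arr (x \<cdot> p1) P Q1" "arr (x' \<cdot> p2) P Q2"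
      using P Q x by (auto intro: arr_comp)
    show "arr (j1 \<cdot> (x \<cdot> p1) + j2 \<cdot> (x' \<cdot> p2)) P Q" by (rule arr_add[OF e])
    show "(j1 \<cdot> (x \<cdot> p1) + j2 \<cdot> (x' \<cdot> p2)) \<cdot> i1 = j1 \<cdot> x"
      using comp_add_left[OF e arr_into[OF P(1)]] comp_assoc[OF Q(1) f(1) arr_into[OF P(1)]]
        comp_assoc[OF Q(2) f(2) arr_into[OF P(1)]] P Q x
      by (simp add: comp_assoc[OF x(1) P(3)] comp_assoc[OF x(2) P(4)] arr_into comp_Idt_right comp_zero_right)
    show "(j1 \<cdot> (x \<cdot> p1) + j2 \<cdot> (x' \<cdot> p2)) \<cdot> i2 = j2 \<cdot> x'"
      using comp_add_left[OF e arr_into[OF P(2)]] comp_assoc[OF Q(1) f(1) arr_into[OF P(2)]]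
        comp_assoc[OF Q(2) f(2) arr_into[OF P(2)]] P Q x
      by (simp add: comp_assoc[OF x(1) P(3)] comp_assoc[OF x(2) P(4)] arr_into comp_Idt_right comp_zero_right)
    show "q1 \<cdot> (j1 \<cdot> (x \<cdot> p1) + j2 \<cdot> (x' \<cdot> p2)) = x \<cdot> p1"
      using comp_add_right[OF Q(3) e] biproduct_lift[OF bQ] f by (simp add: arr_into)
    show "q2 \<cdot> (j1 \<cdot> (x \<cdot> p1) + j2 \<cdot> (x' \<cdot> p2)) = x' \<cdot> p2"
      using comp_add_right[OF Q(4) e] biproduct_lift[OF bQ] f by (simp add: arr_into)
  qed
  note U = diag[OF bX bY T(1) T'(1), folded u''_def]
  note V = diag[OF bY bZ T(2) T'(2), folded v''_def]
  note W = diag[OF bZ bS T(3) T'(3), folded w''_def]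
  obtain Q q k where tQ: "tri X'' Y'' Q u'' q k"
    using TR1_cone[OF A(12) B(12) arr_Hom[OF U(1)]] by blast
  note Q = triD[OF tQ]
  obtain h1 where h1: "arr h1 Z Q" "h1 \<cdot> v = q \<cdot> b1" "ShM C a1 \<cdot> w = k \<cdot> h1"
    using TR3[OF t tQ arr_Hom[OF A(1)] arr_Hom[OF B(1)] U(2)[symmetric]] T(6) Q(6) by (auto simp: arr_def)
  obtain h2 where h2: "arr h2 Z' Q" "h2 \<cdot> v' = q \<cdot> b2" "ShM C a2 \<cdot> w' = k \<cdot> h2"
    using TR3[OF t' tQ arr_Hom[OF A(2)] arr_Hom[OF B(2)] U(3)[symmetric]] T'(6) Q(6) by (auto simp: arr_def)
  obtain g1 where g1: "arr g1 Q Z" "g1 \<cdot> q = v \<cdot> s1" "ShM C r1 \<cdot> k = w \<cdot> g1"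
    using TR3[OF tQ t arr_Hom[OF A(3)] arr_Hom[OF B(3)] U(4)] T(6) Q(6) by (auto simp: arr_def)
  obtain g2 where g2: "arr g2 Q Z'" "g2 \<cdot> q = v' \<cdot> s2" "ShM C r2 \<cdot> k = w' \<cdot> g2"
    using TR3[OF tQ t' arr_Hom[OF A(4)] arr_Hom[OF B(4)] U(5)] T'(6) Q(6) by (auto simp: arr_def)
  define h where "h = h1 \<cdot> t1 + h2 \<cdot> t2"
  define g where "g = c1 \<cdot> g1 + c2 \<cdot> g2"
  have ht: "arr (h1 \<cdot> t1) Z'' Q" "arr (h2 \<cdot> t2) Z'' Q" and gt: "arr (c1 \<cdot> g1) Q Z''" "arr (c2 \<cdot> g2) Q Z''"
    using h1 h2 g1 g2 D by (auto intro: arr_comp)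
  have h: "arr h Z'' Q" and g: "arr g Q Z''" unfolding h_def g_def by (intro arr_add ht gt)+
  have hv: "h \<cdot> v'' = q"
  proof -
    have "h \<cdot> v'' = (h1 \<cdot> t1) \<cdot> v'' + (h2 \<cdot> t2) \<cdot> v''"
      unfolding h_def by (rule comp_add_left[OF ht arr_into[OF V(1)]])
    also have "\<dots> = h1 \<cdot> (v \<cdot> s1) + h2 \<cdot> (v' \<cdot> s2)"
      using comp_assoc[OF h1(1) D(3) arr_into[OF V(1)]] comp_assoc[OF h2(1) D(4) arr_into[OF V(1)]] V by simp
    also have "\<dots> = (q \<cdot> b1) \<cdot> s1 + (q \<cdot> b2) \<cdot> s2"
      using comp_assoc[OF h1(1) T(2) arr_into[OF B(3)]] comp_assoc[OF h2(1) T'(2) arr_into[OF B(4)]] h1 h2 by simp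
    also have "\<dots> = q" using biproduct_decomp(2)[OF bY Q(2)] by simp
    finally show ?thesis .
  qed
  have kh: "k \<cdot> h = w''"
    unfolding h_def w''_def using comp_add_right[OF Q(3) ht] comp_assoc[OF Q(3) h1(1) arr_into[OF D(3)]]
      comp_assoc[OF Q(3) h2(1) arr_into[OF D(4)]] comp_assoc[OF S(1) T(3) arr_into[OF D(3)]]
      comp_assoc[OF S(2) T'(3) arr_into[OF D(4)]] h1(3) h2(3) by simp
  have gq: "g \<cdot> q = v''"
    unfolding g_def v''_def using comp_add_left[OF gt arr_into[OF Q(2)]] comp_assoc[OF D(1) g1(1) arr_into[OF Q(2)]]
      comp_assoc[OF D(2) g2(1) arr_into[OF Q(2)]] g1 g2 by simp
  have wg: "w'' \<cdot> g = k"
  proof -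
    have "w'' \<cdot> g = w'' \<cdot> (c1 \<cdot> g1) + w'' \<cdot> (c2 \<cdot> g2)"
      unfolding g_def by (rule comp_add_right[OF W(1) gt])
    also have "\<dots> = (ShM C a1 \<cdot> w) \<cdot> g1 + (ShM C a2 \<cdot> w') \<cdot> g2"
      using comp_assoc[OF W(1) D(1) arr_into[OF g1(1)]] comp_assoc[OF W(1) D(2) arr_into[OF g2(1)]] W by simp
    also have "\<dots> = ShM C a1 \<cdot> (ShM C r1 \<cdot> k) + ShM C a2 \<cdot> (ShM C r2 \<cdot> k)"
      using comp_assoc[OF S(1) T(3) arr_into[OF g1(1)]] comp_assoc[OF S(2) T'(3) arr_into[OF g2(1)]] g1 g2 by simp
    also have "\<dots> = k" using biproduct_decomp(1)[OF bS arr_into[OF Q(3)]] by simp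
    finally show ?thesis .
  qed
  let ?m = "g \<cdot> h - Idt C Z''" and ?n = "h \<cdot> g - Idt C Q"
  note IZ = arr_Idt[OF D(12)] and IQ = arr_Idt[OF Q(6)]
  have gh: "arr (g \<cdot> h) Z'' Z''" and hg: "arr (h \<cdot> g) Q Q" using g h by (auto intro: arr_comp)
  have m: "arr ?m Z'' Z''" and n: "arr ?n Q Q" using gh hg IZ IQ by (auto intro: arr_diff)
  have mv: "?m \<cdot> v'' = 0"
    using comp_diff_left[OF gh IZ arr_into[OF V(1)]] comp_assoc[OF g h arr_into[OF V(1)]]
      hv gq comp_Idt_left[OF arr_into[OF V(1)]] by simp
  have wm: "w'' \<cdot> ?m = 0"
    using comp_diff_right[OF W(1) gh IZ] comp_assoc[OF W(1) g arr_into[OF h]]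
      wg kh comp_Idt_right[OF W(1)] by simp
  have nq: "?n \<cdot> q = 0"
    using comp_diff_left[OF hg IQ arr_into[OF Q(2)]] comp_assoc[OF h g arr_into[OF Q(2)]]
      hv gq comp_Idt_left[OF arr_into[OF Q(2)]] by simp
  have kn: "k \<cdot> ?n = 0"
    using comp_diff_right[OF Q(3) hg IQ] comp_assoc[OF Q(3) h arr_into[OF g]]
      wg kh comp_Idt_right[OF Q(3)] by simp
  obtain e where e: "arr e (Sh C X'') Q" "?n = e \<cdot> k" using exact_contra_third[OF tQ n nq] .
  have nn: "?n \<cdot> ?n = 0"
    using comp_assoc[OF e(1) Q(3) arr_into[OF n]] kn comp_zero_right[OF e(1)] unfolding e(2)[symmetric] by simp
  have "(?m \<cdot> c1) \<cdot> v = 0"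
  proof -
    have "(?m \<cdot> c1) \<cdot> v = ?m \<cdot> (v'' \<cdot> b1)" using comp_assoc[OF m D(1) arr_into[OF T(2)]] V by simp
    then show ?thesis using comp_assoc[OF m V(1) arr_into[OF B(1)]] mv comp_zero_left'[OF B(1)] by simp
  qed
  then obtain e1 where e1: "arr e1 (Sh C X) Z''" "?m \<cdot> c1 = e1 \<cdot> w"
    using exact_contra_third[OF t arr_comp[OF D(1) m]] by blast
  have "(?m \<cdot> c2) \<cdot> v' = 0"
  proof -
    have "(?m \<cdot> c2) \<cdot> v' = ?m \<cdot> (v'' \<cdot> b2)" using comp_assoc[OF m D(2) arr_into[OF T'(2)]] V by simp
    then show ?thesis using comp_assoc[OF m V(1) arr_into[OF B(2)]] mv comp_zero_left'[OF B(2)] by simp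
  qed
  then obtain e2 where e2: "arr e2 (Sh C X') Z''" "?m \<cdot> c2 = e2 \<cdot> w'"
    using exact_contra_third[OF t' arr_comp[OF D(2) m]] by blast
  have mm: "?m \<cdot> ?m = 0"
  proof -
    have 1: "w \<cdot> (t1 \<cdot> ?m) = 0"
      using comp_assoc[OF T(3) D(3) arr_into[OF m]] W(4) comp_assoc[OF S(3) W(1) arr_into[OF m]]
        wm comp_zero_right[OF S(3)] by simp
    have 2: "w' \<cdot> (t2 \<cdot> ?m) = 0"
      using comp_assoc[OF T'(3) D(4) arr_into[OF m]] W(5) comp_assoc[OF S(4) W(1) arr_into[OF m]]
        wm comp_zero_right[OF S(4)] by simp
    have tm: "arr (t1 \<cdot> ?m) Z'' Z" "arr (t2 \<cdot> ?m) Z'' Z'" using D m by (auto intro: arr_comp)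
    have ct: "arr (c1 \<cdot> (t1 \<cdot> ?m)) Z'' Z''" "arr (c2 \<cdot> (t2 \<cdot> ?m)) Z'' Z''" using D tm by (auto intro: arr_comp)
    have "?m \<cdot> ?m = ?m \<cdot> (c1 \<cdot> (t1 \<cdot> ?m) + c2 \<cdot> (t2 \<cdot> ?m))"
      using biproduct_decomp(1)[OF bZ arr_into[OF m]] by simp
    also have "\<dots> = ?m \<cdot> (c1 \<cdot> (t1 \<cdot> ?m)) + ?m \<cdot> (c2 \<cdot> (t2 \<cdot> ?m))" by (rule comp_add_right[OF m ct])
    also have "\<dots> = (e1 \<cdot> w) \<cdot> (t1 \<cdot> ?m) + (e2 \<cdot> w') \<cdot> (t2 \<cdot> ?m)"
      using comp_assoc[OF m D(1) arr_into[OF tm(1)]] comp_assoc[OF m D(2) arr_into[OF tm(2)]] e1 e2 by simp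
    also have "\<dots> = 0"
      using comp_assoc[OF e1(1) T(3) arr_into[OF tm(1)]] comp_assoc[OF e2(1) T'(3) arr_into[OF tm(2)]] 1 2
        comp_zero_right[OF e1(1)] comp_zero_right[OF e2(1)] by simp
    finally show ?thesis .
  qed
  obtain l where l: "arr l Q Z''" "l \<cdot> h = Idt C Z''" "h \<cdot> l = Idt C Q"
    using nearly_inverse_iso[OF h g mm nn] .
  have "tri X'' Y'' Z'' u'' v'' w''"
  proof (rule TR1_iso[OF tQ])
    show "candidate_triangle C (X'', Y'', Z'', u'', v'', w'')" using U V W by (simp add: candidate_arr)
    show "iso_mor C X'' X'' (Idt C X'')" 
      using iso_mor_arr[OF A(12) A(12), of "Idt C X''"] arr_Idt[OF A(12)] comp_Idt_right[OF arr_Idt[OF A(12)]] by blast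
    show "iso_mor C Y'' Y'' (Idt C Y'')"
      using iso_mor_arr[OF B(12) B(12), of "Idt C Y''"] arr_Idt[OF B(12)] comp_Idt_right[OF arr_Idt[OF B(12)]] by blast
    show "iso_mor C Q Z'' l" using iso_mor_arr[OF Q(6) D(12)] l h by blast
    show "Idt C Y'' \<cdot> u'' = u'' \<cdot> Idt C X''"
      using comp_Idt_left[OF arr_into[OF U(1)]] comp_Idt_right[OF U(1)] by simp
    show "l \<cdot> q = v'' \<cdot> Idt C Y''"
      using comp_assoc[OF l(1) h arr_into[OF V(1)]] hv l(2) comp_Idt_left[OF arr_into[OF V(1)]] comp_Idt_right[OF V(1)]
      by simp
    show "ShM C (Idt C X'') \<cdot> k = w'' \<cdot> l"
      using comp_assoc[OF Q(3) h arr_into[OF l(1)]] kh l(3) comp_Idt_right[OF Q(3)]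
        comp_Idt_left[OF arr_into[OF Q(3)]] ShM_Idt[OF A(12)] by simp
  qed
  then show ?thesis by (simp add: u''_def v''_def w''_def)
qed

end


section \<open>Bongartz completion\<close>

locale calabi_yau_category =
  triangulated_klinear_category C + krull_schmidt_category C
  for C :: "('k::field, 'o, 'm::ab_group_add) tricat" (structure) +
  assumes hf: "hom_finite C" and cy: "two_calabi_yau C"
begin

text \<open>
  The vanishing of \<open>Ext\<^sup>1(X, Y) = Hom(X, Y[1])\<close>.
\<close>

definition ext0 :: "'o \<Rightarrow> 'o \<Rightarrow> bool" where
  "ext0 X Y \<longleftrightarrow> X \<in> Ob C \<and> Y \<in> Ob C \<and> (\<forall>f. arr f X (Sh C Y) \<longrightarrow> f = 0)"

lemma ext0D: "\<lbrakk>ext0 X Y; arr f X (Sh C Y)\<rbrakk> \<Longrightarrow> f = 0"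
  by (simp add: ext0_def)

lemma ext0_Ob: "ext0 X Y \<Longrightarrow> X \<in> Ob C" "ext0 X Y \<Longrightarrow> Y \<in> Ob C"
  by (simp_all add: ext0_def)

lemma ext0_iff_Hom:
  assumes "X \<in> Ob C" "Y \<in> Ob C"
  shows "ext0 X Y \<longleftrightarrow> Hom C X (Sh C Y) = {0}"
  using assms arr_zero[of X "Sh C Y"] Sh_Ob[of Y] by (auto simp: ext0_def arr_def)

text \<open>
  By the Calabi-Yau property \<open>Hom(Y, X[1])\<close> is in bijection with the dual of
  \<open>Hom(X[1], Y[2]) \<cong> Hom(X, Y[1])\<close>, and the dual of a zero space has a single element.
\<close>

lemma ext0_sym:
  assumes "ext0 X Y"
  shows "ext0 Y X"
proof -
  note ob = ext0_Ob[OF assms]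
  note SX = Sh_Ob[OF ob(1)] and SY = Sh_Ob[OF ob(2)]
  have "\<exists>\<phi> :: 'o \<Rightarrow> 'o \<Rightarrow> 'm \<Rightarrow> 'm \<Rightarrow> 'k. \<forall>X \<in> Ob C. \<forall>Y \<in> Ob C.
      bij_betw (\<phi> X Y) (Hom C X Y) (dual_space C (Hom C Y (Sh C (Sh C X))))"
    using cy unfolding two_calabi_yau_def 
    by (elim exE conjE, intro exI ballI)
      (drule bspec, assumption, drule bspec, assumption, elim conjE, assumption)
  then obtain \<phi> :: "'o \<Rightarrow> 'o \<Rightarrow> 'm \<Rightarrow> 'm \<Rightarrow> 'k" where \<phi>:
    "bij_betw (\<phi> Y (Sh C X)) (Hom C Y (Sh C X)) (dual_space C (Hom C (Sh C X) (Sh C (Sh C Y))))"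
    using ob SX by blast
  have "Hom C (Sh C X) (Sh C (Sh C Y)) = ShM C ` Hom C X (Sh C Y)"
    using ShM_fully_faithful[OF ob(1) SY] by (simp add: bij_betw_def)
  also have "Hom C X (Sh C Y) = {0}" using assms ext0_iff_Hom[OF ob] by simp
  also have "ShM C ` {0} = {0}" using ShM_zero[OF ob(1) SY] by simp
  finally have V: "Hom C (Sh C X) (Sh C (Sh C Y)) = {0}" .
  have dual: "\<xi> = \<eta>" if "\<xi> \<in> dual_space C {0}" "\<eta> \<in> dual_space C {0}" for \<xi> \<eta>
  proof -
    have "\<xi> (0 + 0) = \<xi> 0 + \<xi> 0" "\<eta> (0 + 0) = \<eta> 0 + \<eta> 0" using that unfolding dual_space_def by blast+
    then have "\<xi> 0 = \<eta> 0" by (simp only: add_0_right add_cancel_right_right)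
    then show ?thesis using that unfolding dual_space_def by (auto intro: extensionalityI[of _ "{0}"])
  qed
  note \<phi>' = \<phi>[unfolded V]
  have zero: "0 \<in> Hom C Y (Sh C X)" by (rule arr_Hom[OF arr_zero[OF ob(2) SX]])
  have "f = 0" if "f \<in> Hom C Y (Sh C X)" for f
    using dual[OF bij_betw_apply[OF \<phi>' that] bij_betw_apply[OF \<phi>' zero]]
      inj_onD[OF bij_betw_imp_inj_on[OF \<phi>'] _ that zero] by simp
  then show ?thesis using ob by (auto simp: ext0_def arr_def)
qed

lemma ext0_summand:
  assumes "is_direct_sum C [X, Y] S" "ext0 S Z"
  shows "ext0 X Z"
proof -
  obtain i1 i2 p1 p2 where bp: "biproduct X Y S i1 i2 p1 p2"
    using assms(1) by (rule ds_biproductE)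
  note b = biproductD[OF bp]
  have "f = 0" if f: "arr f X (Sh C Z)" for f
  proof -
    have "f \<cdot> p1 = 0" by (rule ext0D[OF assms(2) arr_comp[OF b(3) f]])
    then have "(f \<cdot> p1) \<cdot> i1 = 0" using comp_zero_left'[OF b(1)] by simp
    then show ?thesis using comp_assoc[OF f b(3) arr_into[OF b(1)]] b(5) comp_Idt_right[OF f] by simp
  qed
  then show ?thesis using b(10) ext0_Ob(2)[OF assms(2)] by (simp add: ext0_def)
qed

lemma ext0_sum:
  assumes "is_direct_sum C [X, Y] S" "ext0 X Z" "ext0 Y Z"
  shows "ext0 S Z"
proof -
  obtain i1 i2 p1 p2 where bp: "biproduct X Y S i1 i2 p1 p2"
    using assms(1) by (rule ds_biproductE)
  note b = biproductD[OF bp]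
  have "f = 0" if f: "arr f S (Sh C Z)" for f
  proof -
    have "f \<cdot> i1 = 0" "f \<cdot> i2 = 0"
      using ext0D[OF assms(2) arr_comp[OF b(1) f]] ext0D[OF assms(3) arr_comp[OF b(2) f]] by auto
    then show ?thesis
      using biproduct_decomp(2)[OF bp f] comp_zero_left'[OF b(3)] comp_zero_left'[OF b(4)] by simp
  qed
  then show ?thesis using b(12) ext0_Ob(2)[OF assms(2)] by (simp add: ext0_def)
qed

lemma ext0_zero: "\<lbrakk>zero_ob C O\<^sub>0; Z \<in> Ob C\<rbrakk> \<Longrightarrow> ext0 O\<^sub>0 Z"
  using zero_ob_arr(2)[of O\<^sub>0 _ "Sh C Z"] ds_Ob(1)[of "[]" O\<^sub>0] by (auto simp: ext0_def)

lemma ext0_replicate: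
  "\<lbrakk>is_direct_sum C (replicate r X) S; ext0 X Z\<rbrakk> \<Longrightarrow> ext0 S Z"
proof (induction r arbitrary: S)
  case 0
  then show ?case using ext0_zero ext0_Ob(2) by simp
next
  case (Suc r)
  then have "is_direct_sum C (X # replicate r X) S" by simp
  then obtain S' where "is_direct_sum C (replicate r X) S'" "is_direct_sum C [X, S'] S" by (rule ds_ConsE)
  then show ?case using Suc ext0_sum by blast
qed

lemma ext0_le_left: "\<lbrakk>Y \<preceq> X; ext0 X Z\<rbrakk> \<Longrightarrow> ext0 Y Z"
  using support_le_complement ext0_replicate ext0_summand by blast

lemma ext0_le_right: "\<lbrakk>Y \<preceq> X; ext0 Z X\<rbrakk> \<Longrightarrow> ext0 Z Y"
  by (rule ext0_sym) (rule ext0_le_left, assumption, erule ext0_sym)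

lemma zero_le: "\<lbrakk>zero_ob C O\<^sub>0; X \<in> Ob C\<rbrakk> \<Longrightarrow> O\<^sub>0 \<preceq> X"
  using mult_zero[of O\<^sub>0] ds_Ob(1)[of "[]" O\<^sub>0] by (simp add: support_le_def)

lemma replicate_le: "\<lbrakk>is_direct_sum C (replicate r X) S; X \<in> Ob C\<rbrakk> \<Longrightarrow> S \<preceq> X"
  using mult_replicate[of r X S] ds_Ob(1)[of "replicate r X" S] by (simp add: support_le_def)

text \<open>
  Collect the finitely many morphisms of a spanning set into one morphism to a power of \<open>Y\<close>; the
  morphisms that factor through it form a subspace.
\<close>

lemma left_approximation:
  assumes A: "A \<in> Ob C" and Y: "Y \<in> Ob C"
  obtains S f where "S \<preceq> Y" "arr f A S" "\<And>g. arr g A Y \<Longrightarrow> \<exists>t. arr t S Y \<and> g = t \<cdot> f"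
proof -
  have *: "\<exists>r S f. is_direct_sum C (replicate r Y) S \<and> arr f A S \<and> (\<forall>g \<in> B. \<exists>t. arr t S Y \<and> g = t \<cdot> f)"
    if "finite B" "B \<subseteq> Hom C A Y" for B
    using that
  proof (induction B)
    case empty
    obtain O0 where O0: "zero_ob C O0" using ex_zero_ob by blast
    then show ?case using arr_zero[OF A ds_Ob(1)[OF O0]] by (intro exI[of _ 0] exI[of _ O0] exI[of _ 0]) simp
  next
    case (insert g B)
    then obtain r S f where S: "is_direct_sum C (replicate r Y) S" and f: "arr f A S"
      and fB: "\<forall>g \<in> B. \<exists>t. arr t S Y \<and> g = t \<cdot> f" by auto
    obtain S' where S': "is_direct_sum C [Y, S] S'" using ex_direct_sum Y ds_Ob(1)[OF S] by blast
    obtain i1 i2 p1 p2 where bp: "biproduct Y S S' i1 i2 p1 p2" using S' by (rule ds_biproductE)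
    note b = biproductD[OF bp]
    have g: "arr g A Y" using insert.prems A Y by (simp add: arr_def)
    have t: "arr (i1 \<cdot> g) A S'" "arr (i2 \<cdot> f) A S'" using b f g by (auto intro: arr_comp)
    define f' where "f' = i1 \<cdot> g + i2 \<cdot> f"
    have f': "arr f' A S'" unfolding f'_def by (rule arr_add[OF t])
    have p: "p1 \<cdot> f' = g" "p2 \<cdot> f' = f"
      unfolding f'_def using comp_add_right[OF b(3) t] comp_add_right[OF b(4) t] biproduct_lift[OF bp] f g
      by (simp_all add: arr_into)
    have "\<exists>t. arr t S' Y \<and> h = t \<cdot> f'" if h: "h \<in> insert g B" for h
    proof (cases "h = g")
      case True
      then show ?thesis using p(1) b(3) by blast
    next
      case False
      then obtain t where t: "arr t S Y" "h = t \<cdot> f" using h fB by blast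
      then have "h = (t \<cdot> p2) \<cdot> f'" using comp_assoc[OF t(1) b(4) arr_into[OF f']] p(2) by simp
      then show ?thesis using arr_comp[OF b(4) t(1)] by blast
    qed
    moreover have "is_direct_sum C (replicate (Suc r) Y) S'" using ds_ConsI[OF S S'] by simp
    ultimately show ?case using f' by blast
  qed
  obtain B where B: "finite B" "span B = Hom C A Y"
    using hf A Y unfolding hom_finite_def by blast
  then have "B \<subseteq> Hom C A Y" using span_superset by blast
  then obtain r S f where S: "is_direct_sum C (replicate r Y) S" and f: "arr f A S"
      and fB: "\<forall>g \<in> B. \<exists>t. arr t S Y \<and> g = t \<cdot> f" using * B(1) by blast
  have "\<exists>t. arr t S Y \<and> g = t \<cdot> f" if "arr g A Y" for g
  proof -
    have "g \<in> span B" using that B(2) by (simp add: arr_Hom)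
    then show ?thesis
    proof (induction rule: span_induct_alt)
      case base
      show ?case using arr_zero[OF arr_cod[OF f] Y] comp_zero_left'[OF f] by metis
    next
      case (step c x y)
      obtain t where t: "arr t S Y" "x = t \<cdot> f" using fB step.hyps(1) by blast
      obtain t' where t': "arr t' S Y" "y = t' \<cdot> f" using step by blast
      have ct: "arr (Scl C c t) S Y" using t(1) subspace_scale[OF Hom_subspace] by (simp add: arr_def)
      have "Scl C c x + y = (Scl C c t + t') \<cdot> f"
        using comp_add_left[OF ct t'(1) arr_into[OF f]] t t' f Cmp_Scl_left[of A S Y f t c] by (simp add: arr_def)
      then show ?case using arr_add[OF ct t'(1)] by blast
    qed
  qed
  then show thesis using that replicate_le[OF S Y] f by blast
qed

lemma right_approximation:
  assumes A: "A \<in> Ob C" and Y: "Y \<in> Ob C"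
  obtains S f where "S \<preceq> Y" "arr f S A" "\<And>g. arr g Y A \<Longrightarrow> \<exists>t. arr t Y S \<and> g = f \<cdot> t"
proof -
  have *: "\<exists>r S f. is_direct_sum C (replicate r Y) S \<and> arr f S A \<and> (\<forall>g \<in> B. \<exists>t. arr t Y S \<and> g = f \<cdot> t)"
    if "finite B" "B \<subseteq> Hom C Y A" for B
    using that
  proof (induction B)
    case empty
    obtain O0 where O0: "zero_ob C O0" using ex_zero_ob by blast
    then show ?case using arr_zero[OF ds_Ob(1)[OF O0] A] by (intro exI[of _ 0] exI[of _ O0] exI[of _ 0]) simp
  next
    case (insert g B)
    then obtain r S f where S: "is_direct_sum C (replicate r Y) S" and f: "arr f S A"
      and fB: "\<forall>g \<in> B. \<exists>t. arr t Y S \<and> g = f \<cdot> t" by auto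
    obtain S' where S': "is_direct_sum C [Y, S] S'" using ex_direct_sum Y ds_Ob(1)[OF S] by blast
    obtain i1 i2 p1 p2 where bp: "biproduct Y S S' i1 i2 p1 p2" using S' by (rule ds_biproductE)
    note b = biproductD[OF bp]
    have g: "arr g Y A" using insert.prems A Y by (simp add: arr_def)
    have t: "arr (g \<cdot> p1) S' A" "arr (f \<cdot> p2) S' A" using b f g by (auto intro: arr_comp)
    define f' where "f' = g \<cdot> p1 + f \<cdot> p2"
    have f': "arr f' S' A" unfolding f'_def by (rule arr_add[OF t])
    have p: "f' \<cdot> i1 = g" "f' \<cdot> i2 = f"
      unfolding f'_def
      using comp_add_left[OF t arr_into[OF b(1)]] comp_add_left[OF t arr_into[OF b(2)]]
        comp_assoc[OF g b(3) arr_into[OF b(1)]] comp_assoc[OF g b(3) arr_into[OF b(2)]]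
        comp_assoc[OF f b(4) arr_into[OF b(1)]] comp_assoc[OF f b(4) arr_into[OF b(2)]] b f g
      by (simp_all add: comp_Idt_right[OF f] comp_Idt_right[OF g] comp_zero_right[OF f] comp_zero_right[OF g])
    have "\<exists>t. arr t Y S' \<and> h = f' \<cdot> t" if h: "h \<in> insert g B" for h
    proof (cases "h = g")
      case True
      then show ?thesis using p(1) b(1) by blast
    next
      case False
      then obtain t where t: "arr t Y S" "h = f \<cdot> t" using h fB by blast
      then have "h = f' \<cdot> (i2 \<cdot> t)" using comp_assoc[OF f' b(2) arr_into[OF t(1)]] p(2) by simp
      then show ?thesis using arr_comp[OF t(1) b(2)] by blast
    qed
    moreover have "is_direct_sum C (replicate (Suc r) Y) S'" using ds_ConsI[OF S S'] by simp
    ultimately show ?case using f' by blast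
  qed
  obtain B where B: "finite B" "span B = Hom C Y A"
    using hf A Y unfolding hom_finite_def by blast
  then have "B \<subseteq> Hom C Y A" using span_superset by blast
  then obtain r S f where S: "is_direct_sum C (replicate r Y) S" and f: "arr f S A"
      and fB: "\<forall>g \<in> B. \<exists>t. arr t Y S \<and> g = f \<cdot> t" using * B(1) by blast
  have "\<exists>t. arr t Y S \<and> g = f \<cdot> t" if "arr g Y A" for g
  proof -
    have "g \<in> span B" using that B(2) by (simp add: arr_Hom)
    then show ?thesis
    proof (induction rule: span_induct_alt)
      case base
      show ?case using arr_zero[OF Y arr_dom[OF f]] comp_zero_right[OF f] by metis
    next
      case (step c x y)
      obtain t where t: "arr t Y S" "x = f \<cdot> t" using fB step.hyps(1) by blast
      obtain t' where t': "arr t' Y S" "y = f \<cdot> t'" using step by blast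
      have ct: "arr (Scl C c t) Y S" using t(1) subspace_scale[OF Hom_subspace] by (simp add: arr_def)
      have "Scl C c x + y = f \<cdot> (Scl C c t + t')"
        using comp_add_right[OF f ct t'(1)] t t' f Cmp_Scl_right[of Y S A t f c] by (simp add: arr_def)
      then show ?case using arr_add[OF ct t'(1)] by blast
    qed
  qed
  then show thesis using that replicate_le[OF S Y] f by blast
qed

text \<open>
  For rigid \<open>U\<close> the objects \<open>B\<close> with \<open>bongartz U A B\<close> are the cocones of left \<open>add(U[1])\<close>-approximations of \<open>A\<close>.
  Asking for \<open>Hom(B, U[1]) = 0\<close> in place of the approximation property makes the relation easier to
  verify; the two are equivalent by the long exact sequence.
\<close>

definition bongartz :: "'o \<Rightarrow> 'o \<Rightarrow> 'o \<Rightarrow> bool" where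
  "bongartz U A B \<longleftrightarrow> ext0 B U \<and> (\<exists>U' u v w. U' \<preceq> U \<and> tri U' B A u v w)"

lemma bongartz_Ob: "bongartz U A B \<Longrightarrow> A \<in> Ob C" "bongartz U A B \<Longrightarrow> B \<in> Ob C" "bongartz U A B \<Longrightarrow> U \<in> Ob C"
  by (auto simp: bongartz_def dest: triD(5,6) ext0_Ob)

lemma bongartz_ext0: "bongartz U A B \<Longrightarrow> ext0 B U"
  by (simp add: bongartz_def)

text \<open>
  The approximation of \<open>A \<cong> A\<^sub>0[1]\<close> is the shift of one of \<open>A\<^sub>0\<close>.
\<close>

lemma ex_bongartz:
  assumes U: "ext0 U U" and A: "A \<in> Ob C"
  shows "\<exists>B. bongartz U A B"
proof -
  note UO = ext0_Ob(1)[OF U]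
  obtain A0 where A0: "A0 \<in> Ob C" "Sh C A0 \<cong> A" using Sh_ess_surj[OF A] by blast
  obtain g1 f1 where fg: "arr g1 (Sh C A0) A" "arr f1 A (Sh C A0)" "f1 \<cdot> g1 = Idt C (Sh C A0)" "g1 \<cdot> f1 = Idt C A"
    using A0(2) by (rule isoE)
  obtain S f where S: "S \<preceq> U" "arr f A0 S" "\<And>g. arr g A0 U \<Longrightarrow> \<exists>t. arr t S U \<and> g = t \<cdot> f"
    using left_approximation[OF A0(1) UO] by blast
  have w: "arr (ShM C f \<cdot> f1) A (Sh C S)" by (rule arr_comp[OF fg(2) arr_ShM[OF S(2)]])
  obtain B u v where t: "tri S B A u v (ShM C f \<cdot> f1)"
    using tri_complete[OF w arr_cod[OF S(2)]] by blast
  note a = triD[OF t]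
  have "h = 0" if h: "arr h B (Sh C U)" for h
  proof -
    have "h \<cdot> u = 0" by (rule ext0D[OF ext0_le_left[OF S(1) U] arr_comp[OF a(1) h]])
    then obtain k where k: "arr k A (Sh C U)" "h = k \<cdot> v" using exact_contra_mid[OF t h] by blast
    obtain k0 where k0: "arr k0 A0 U" "k \<cdot> g1 = ShM C k0"
      using ShM_full[OF arr_comp[OF fg(1) k(1)] A0(1) UO] by blast
    obtain s where s: "arr s S U" "k0 = s \<cdot> f" using S(3)[OF k0(1)] by blast
    have "k = (k \<cdot> g1) \<cdot> f1" using comp_assoc[OF k(1) fg(1) arr_into[OF fg(2)]] fg(4) comp_Idt_right[OF k(1)] by simp
    also have "\<dots> = ShM C s \<cdot> (ShM C f \<cdot> f1)"
      using k0(2) s ShM_comp[OF S(2) s(1)] comp_assoc[OF arr_ShM[OF s(1)] arr_ShM[OF S(2)] arr_into[OF fg(2)]] by simp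
    finally have "h = ShM C s \<cdot> ((ShM C f \<cdot> f1) \<cdot> v)"
      using k(2) comp_assoc[OF arr_ShM[OF s(1)] w arr_into[OF a(2)]] by simp
    then show ?thesis using tri_comp_zero2[OF t] comp_zero_right[OF arr_ShM[OF s(1)]] by simp
  qed
  then have "ext0 B U" using a UO by (simp add: ext0_def)
  then show ?thesis using t S(1) unfolding bongartz_def by blast
qed

text \<open>
  A morphism \<open>B \<rightarrow> B'[1] \<rightarrow> A'[1]\<close> vanishes on \<open>V\<close>, hence factors through \<open>A\<close> and is zero by assumption.  So
  \<open>B \<rightarrow> B'[1]\<close> factors through \<open>V'[1]\<close>, and there are no nonzero morphisms \<open>B \<rightarrow> V'[1]\<close>.
\<close>

lemma bongartz_ext0_pair:
  assumes B: "bongartz U A B" and B': "bongartz U A' B'" and AA: "ext0 A A'"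
  shows "ext0 B B'"
proof -
  obtain V u v w where V: "V \<preceq> U" "tri V B A u v w" using B by (auto simp: bongartz_def)
  obtain V' u' v' w' where V': "V' \<preceq> U" "tri V' B' A' u' v' w'" using B' by (auto simp: bongartz_def)
  note a = triD[OF V(2)] and a' = triD[OF V'(2)]
  have "g = 0" if g: "arr g B (Sh C B')" for g
  proof -
    have 1: "g \<cdot> u = 0"
      by (rule ext0D[OF ext0_le_left[OF V(1) ext0_sym[OF bongartz_ext0[OF B']]] arr_comp[OF a(1) g]])
    have vg: "arr (ShM C v' \<cdot> g) B (Sh C A')" by (rule arr_comp[OF g arr_ShM[OF a'(2)]])
    have "(ShM C v' \<cdot> g) \<cdot> u = 0"
      using comp_assoc[OF arr_ShM[OF a'(2)] g arr_into[OF a(1)]] 1 comp_zero_right[OF arr_ShM[OF a'(2)]] by simp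
    then obtain k where k: "arr k A (Sh C A')" "ShM C v' \<cdot> g = k \<cdot> v"
      using exact_contra_mid[OF V(2) vg] by blast
    have "k = 0" by (rule ext0D[OF AA k(1)])
    then have "ShM C v' \<cdot> g = 0" using k(2) comp_zero_left'[OF a(2)] by simp
    then obtain h where h: "arr h B (Sh C V')" "g = ShM C u' \<cdot> h" using exact_cov_Sh_mid[OF V'(2) g] by blast
    have "h = 0" by (rule ext0D[OF ext0_le_right[OF V'(1) bongartz_ext0[OF B]] h(1)])
    then show ?thesis using h(2) comp_zero_right[OF arr_ShM[OF a'(1)]] by simp
  qed
  then show ?thesis using a(5) a'(5) by (simp add: ext0_def)
qed

text \<open>
  The analogue of Schanuel's lemma.  Consider a cone \<open>Q\<close> of the composite \<open>B' \<rightarrow> A \<rightarrow> V[1]\<close>.  This composite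
  vanishes, so \<open>Q \<cong> V[1] \<oplus> B'[1]\<close>.  The octahedral axiom exhibits \<open>Q\<close> also as an extension of \<open>B[1]\<close> by
  \<open>V'[1]\<close>, whose class is up to sign the shift of the vanishing composite \<open>B \<rightarrow> A \<rightarrow> V'[1]\<close>.
\<close>

lemma bongartz_unique:
  assumes B: "bongartz U A B" and B': "bongartz U A B'"
  obtains V V' S where "V \<preceq> U" "V' \<preceq> U" "is_direct_sum C [V, B] S" "is_direct_sum C [V', B'] S"
proof -
  obtain V u v w where V: "V \<preceq> U" "tri V B A u v w" using B by (auto simp: bongartz_def)
  obtain V' u' v' w' where V': "V' \<preceq> U" "tri V' B' A u' v' w'" using B' by (auto simp: bongartz_def)
  note a = triD[OF V(2)] and a' = triD[OF V'(2)]
  have wv: "arr (w \<cdot> v') B' (Sh C V)" and wv': "arr (w' \<cdot> v) B (Sh C V')" using a a' by (auto intro: arr_comp)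
  have z: "w \<cdot> v' = 0" by (rule ext0D[OF ext0_le_right[OF V(1) bongartz_ext0[OF B']] wv])
  have z': "w' \<cdot> v = 0" by (rule ext0D[OF ext0_le_right[OF V'(1) bongartz_ext0[OF B]] wv'])
  obtain Q k k' where tQ: "tri B' (Sh C V) Q (w \<cdot> v') k k'"
    using TR1_cone[OF a'(5) Sh_Ob[OF a(4)] arr_Hom[OF wv]] by blast
  obtain f g where tfg: "tri (Sh C V') Q (Sh C B) f g (ShM C w' \<cdot> (- ShM C v))"
    using TR4[OF tri_rotate[OF V'(2)] tri_rotate[OF tri_rotate[OF V(2)]] tQ] by blast
  have "ShM C w' \<cdot> (- ShM C v) = - ShM C (w' \<cdot> v)"
    using comp_uminus_right[OF arr_ShM[OF a'(3)] arr_ShM[OF a(2)]] ShM_comp[OF a(2) a'(3)] by simp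
  also have "\<dots> = 0" using z' ShM_zero[OF a(5) Sh_Ob[OF a'(4)]] by simp
  finally have 1: "is_direct_sum C [Sh C V', Sh C B] Q" using tri_split tfg by simp
  have "- ShM C (w \<cdot> v') = 0" using z ShM_zero[OF a'(5) Sh_Ob[OF a(4)]] by simp
  then have 2: "is_direct_sum C [Sh C V, Sh C B'] Q" using tri_split tri_rotate[OF tQ] by simp
  obtain S where S: "is_direct_sum C [V', B] S" using ex_direct_sum a a' by blast
  obtain S' where S': "is_direct_sum C [V, B'] S'" using ex_direct_sum a a' by blast
  have "Sh C S \<cong> Q" "Sh C S' \<cong> Q" using ds_unique[OF ds_Sh[OF S] 1] ds_unique[OF ds_Sh[OF S'] 2] by auto
  then have "Sh C S' \<cong> Sh C S" using iso_trans iso_sym by blast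
  then have "S' \<cong> S" using Sh_iso_cancel ds_Ob(1)[OF S] ds_Ob(1)[OF S'] by blast
  then show thesis using that[OF V'(1) V(1) S] ds_iso[OF S'] by blast
qed

lemma bongartz_sum:
  assumes B: "bongartz U A B" and B': "bongartz U A' B'"
    and A'': "is_direct_sum C [A, A'] A''" and B'': "is_direct_sum C [B, B'] B''"
  shows "bongartz U A'' B''"
proof -
  obtain V u v w where V: "V \<preceq> U" "tri V B A u v w" using B by (auto simp: bongartz_def)
  obtain V' u' v' w' where V': "V' \<preceq> U" "tri V' B' A' u' v' w'" using B' by (auto simp: bongartz_def)
  obtain V'' where V'': "is_direct_sum C [V, V'] V''"
    using ex_direct_sum triD(4)[OF V(2)] triD(4)[OF V'(2)] by blast
  obtain a1 a2 r1 r2 where 1: "biproduct V V' V'' a1 a2 r1 r2" using V'' by (rule ds_biproductE)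
  obtain b1 b2 s1 s2 where 2: "biproduct B B' B'' b1 b2 s1 s2" using B'' by (rule ds_biproductE)
  obtain c1 c2 t1 t2 where 3: "biproduct A A' A'' c1 c2 t1 t2" using A'' by (rule ds_biproductE)
  have "V'' \<preceq> U" by (rule support_le_sum[OF V'' V(1) V'(1)])
  moreover have "ext0 B'' U" by (rule ext0_sum[OF B'' bongartz_ext0[OF B] bongartz_ext0[OF B']])
  ultimately show ?thesis
    unfolding bongartz_def using tri_sum[OF V(2) V'(2) 1 2 3] by blast
qed

lemma bongartz_self: "ext0 A U \<Longrightarrow> bongartz U A A"
proof -
  assume e: "ext0 A U"
  obtain O0 where O0: "zero_ob C O0" using ex_zero_ob by blast
  show ?thesis
    unfolding bongartz_def using e zero_le[OF O0 ext0_Ob(2)[OF e]] tri_zero_Idt[OF O0 ext0_Ob(1)[OF e]] by blast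
qed

lemma bongartz_zero:
  assumes "ext0 U U" "V \<preceq> U" "zero_ob C O\<^sub>0"
  shows "bongartz U O\<^sub>0 V"
  unfolding bongartz_def
  using ext0_le_left[OF assms(2,1)] assms(2) TR1_Idt[OF support_le_Ob(1)[OF assms(2)] assms(3)] by blast

lemma bongartz_add:
  assumes "ext0 U U" "bongartz U A B" "V \<preceq> U" "is_direct_sum C [B, V] B'"
  shows "bongartz U A B'"
proof -
  obtain O0 where O0: "zero_ob C O0" using ex_zero_ob by blast
  show ?thesis
    by (rule bongartz_sum[OF assms(2) bongartz_zero[OF assms(1,3) O0] _ assms(4)])
      (rule zero_ds[OF O0 bongartz_Ob(1)[OF assms(2)]])
qed

definition tilting :: "'o \<Rightarrow> bool" where
  "tilting T \<longleftrightarrow> ext0 T T \<and> (\<forall>X. ext0 T X \<longrightarrow> X \<preceq> T)"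

lemma tilting_iff: "cluster_tilting C T \<longleftrightarrow> tilting T"
proof
  assume ct: "cluster_tilting C T"
  then have T: "T \<in> Ob C" by (simp add: cluster_tilting_def)
  have *: "X \<preceq> T \<longleftrightarrow> ext0 T X" if "X \<in> Ob C" for X
    using ct add_of_iff[OF T] ext0_iff_Hom[OF T that] that by (auto simp: cluster_tilting_def)
  then show "tilting T" using *[OF T] support_le_refl[OF T] ext0_Ob(2) by (auto simp: tilting_def)
next
  assume t: "tilting T"
  then have T: "T \<in> Ob C" using ext0_Ob by (auto simp: tilting_def)
  have "X \<preceq> T \<longleftrightarrow> X \<in> Ob C \<and> Hom C T (Sh C X) = {0}" for X
    using t ext0_le_right[of X T T] ext0_iff_Hom[OF T, of X] support_le_Ob(1)[of X T]
    by (auto simp: tilting_def)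
  then show "cluster_tilting C T" using T add_of_iff[OF T] by (auto simp: cluster_tilting_def)
qed

lemma tilting_Ob: "tilting T \<Longrightarrow> T \<in> Ob C"
  using ext0_Ob by (auto simp: tilting_def)

text \<open>
  Take for \<open>h\<close> a right \<open>add(T)\<close>-approximation \<open>T\<^sub>0 \<rightarrow> Z[1]\<close>; its cocone \<open>A\<close> satisfies \<open>Hom(T, A[1]) = 0\<close>.
\<close>

lemma tilting_coresolution:
  assumes T: "tilting T" and Z: "Z \<in> Ob C"
  obtains A T\<^sub>0 z a h where "tri Z A T\<^sub>0 z a h" "A \<preceq> T" "T\<^sub>0 \<preceq> T"
proof -
  have TT: "ext0 T T" using T by (simp add: tilting_def)
  obtain S h where S: "S \<preceq> T" "arr h S (Sh C Z)" "\<And>g. arr g T (Sh C Z) \<Longrightarrow> \<exists>t. arr t T S \<and> g = h \<cdot> t"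
    using right_approximation[OF Sh_Ob[OF Z] tilting_Ob[OF T]] by blast
  obtain A z a where t: "tri Z A S z a h" using tri_complete[OF S(2) Z] by blast
  note d = triD[OF t]
  have "g = 0" if g: "arr g T (Sh C A)" for g
  proof -
    have "ShM C a \<cdot> g = 0"
      by (rule ext0D[OF ext0_le_right[OF S(1) TT] arr_comp[OF g arr_ShM[OF d(2)]]])
    then obtain k where k: "arr k T (Sh C Z)" "g = ShM C z \<cdot> k" using exact_cov_Sh_mid[OF t g] by blast
    obtain l where l: "arr l T S" "k = h \<cdot> l" using S(3)[OF k(1)] by blast
    have "g = (ShM C z \<cdot> h) \<cdot> l" using k l comp_assoc[OF arr_ShM[OF d(1)] d(3) arr_into[OF l(1)]] by simp
    then show ?thesis using tri_comp_zero3[OF t] comp_zero_left'[OF l(1)] by simp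
  qed
  then have "ext0 T A" using d tilting_Ob[OF T] by (simp add: ext0_def)
  then have "A \<preceq> T" using T by (simp add: tilting_def)
  then show thesis using that t S(1) by blast
qed

text \<open>
  Start from \<open>Z \<rightarrow> A \<rightarrow> T\<^sub>0\<close>.  The morphism \<open>Z \<rightarrow> A\<close> lifts to the cocone \<open>X\<close> of an approximation of \<open>A\<close> because
  \<open>Hom(Z, U[1]) = 0\<close>.  Adding a left \<open>add(U)\<close>-approximation \<open>y: Z \<rightarrow> U\<^sub>2\<close> gives \<open>Z \<rightarrow> V = X \<oplus> U\<^sub>2\<close>, and \<open>y\<close> is what
  makes \<open>Hom(B, U[1])\<close> vanish for the cone \<open>B\<close>.  The octahedral axiom for \<open>Z \<rightarrow> V \<rightarrow> A\<close> yields the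
  triangle \<open>U\<^sub>3 \<rightarrow> B \<rightarrow> T\<^sub>0 \<rightarrow> U\<^sub>3[1]\<close>.
\<close>

lemma bongartz_coresolution:
  assumes T: "tilting T" and U: "ext0 U U" and ZU: "ext0 Z U"
  obtains A T\<^sub>0 V B z p q where "A \<preceq> T" "T\<^sub>0 \<preceq> T" "bongartz U A V" "bongartz U T\<^sub>0 B" "tri Z V B z p q"
proof -
  note Z = ext0_Ob(1)[OF ZU] and UO = ext0_Ob(2)[OF ZU]
  obtain A T0 z a h where t: "tri Z A T0 z a h" and le: "A \<preceq> T" "T0 \<preceq> T"
    using tilting_coresolution[OF T Z] by blast
  note d = triD[OF t]
  obtain X where X: "bongartz U A X" using ex_bongartz[OF U d(5)] by blast
  then obtain U1 u v w where U1: "U1 \<preceq> U" "tri U1 X A u v w" by (auto simp: bongartz_def)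
  note a1 = triD[OF U1(2)]
  have "w \<cdot> z = 0" by (rule ext0D[OF ext0_le_right[OF U1(1) ZU] arr_comp[OF d(1) a1(3)]])
  then obtain z1 where z1: "arr z1 Z X" "z = v \<cdot> z1" using exact_cov_third[OF U1(2) d(1)] by blast
  obtain U2 y where U2: "U2 \<preceq> U" "arr y Z U2" "\<And>g. arr g Z U \<Longrightarrow> \<exists>t. arr t U2 U \<and> g = t \<cdot> y"
    using left_approximation[OF Z UO] by blast
  note U2O = arr_cod[OF U2(2)]
  obtain V where V: "is_direct_sum C [X, U2] V" using ex_direct_sum a1 U2O by blast
  obtain b1 b2 s1 s2 where bV: "biproduct X U2 V b1 b2 s1 s2" using V by (rule ds_biproductE)
  note b = biproductD[OF bV]
  have AV: "bongartz U A V" by (rule bongartz_add[OF U X U2(1) V])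
  obtain U3 where U3: "is_direct_sum C [U1, U2] U3" using ex_direct_sum a1 U2O by blast
  obtain a1' a2' r1 r2 where bU: "biproduct U1 U2 U3 a1' a2' r1 r2" using U3 by (rule ds_biproductE)
  obtain O0 where O0: "zero_ob C O0" using ex_zero_ob by blast
  note O0O = ds_Ob(1)[OF O0]
  note IA = arr_Idt[OF a1(6)]
  have bA: "biproduct A O0 A (Idt C A) 0 (Idt C A) 0"
    using IA arr_zero[OF O0O a1(6)] arr_zero[OF a1(6) O0O] O0 comp_Idt_right[OF IA] comp_zero_left'[OF IA]
      comp_zero_right[OF arr_zero[OF O0O a1(6)]] comp_zero_right[OF IA] comp_zero_right[OF arr_zero[OF a1(6) O0O]]
    by (auto simp: biproduct_def zero_ob_iff)
  \<comment> \<open>The sum of \<open>U\<^sub>1 \<rightarrow> X \<rightarrow> A\<close> and \<open>U\<^sub>2 \<rightarrow> U\<^sub>2 \<rightarrow> 0\<close>, with \<open>A \<oplus> 0\<close> identified with \<open>A\<close>.\<close>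
  obtain u3 v3 w3 where tV: "tri U3 V A u3 v3 w3" and "v3 = Idt C A \<cdot> (v \<cdot> s1) + 0 \<cdot> (0 \<cdot> s2)"
    using tri_sum[OF U1(2) TR1_Idt[OF U2O O0] bU bV bA] by blast
  then have v3: "v3 = v \<cdot> s1"
    using comp_Idt_left[OF arr_into[OF arr_comp[OF b(3) a1(2)]]] comp_zero_left'[OF b(4)] comp_zero_left'[OF arr_zero[OF b(12,12)]]
    by simp
  note a3 = triD[OF tV]
  define z' where "z' = b1 \<cdot> z1 + b2 \<cdot> y"
  have tz: "arr (b1 \<cdot> z1) Z V" "arr (b2 \<cdot> y) Z V" using b z1 U2 by (auto intro: arr_comp)
  have z': "arr z' Z V" unfolding z'_def by (rule arr_add[OF tz])
  have sz: "s1 \<cdot> z' = z1" "s2 \<cdot> z' = y"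
    unfolding z'_def using comp_add_right[OF b(3) tz] comp_add_right[OF b(4) tz] biproduct_lift[OF bV] z1(1) U2(2)
    by (simp_all add: arr_into)
  have vz: "v3 \<cdot> z' = z" using v3 comp_assoc[OF a1(2) b(3) arr_into[OF z']] sz z1 by simp
  obtain B p q where tB: "tri Z V B z' p q" using TR1_cone[OF Z b(12) arr_Hom[OF z']] by blast
  note aB = triD[OF tB]
  have "tri Z A T0 (v3 \<cdot> z') a h" using t vz by simp
  then obtain f g where tfg: "tri B T0 (Sh C U3) f g (ShM C p \<cdot> (- ShM C u3))"
    using TR4[OF tB tri_rotate[OF tV]] by blast
  have "ShM C p \<cdot> (- ShM C u3) = - ShM C (p \<cdot> u3)"
    using comp_uminus_right[OF arr_ShM[OF aB(2)] arr_ShM[OF a3(1)]] ShM_comp[OF a3(1) aB(2)] by simp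
  then have tB': "tri U3 B T0 (p \<cdot> u3) f g"
    using tri_rotate_back[OF _ arr_comp[OF a3(1) aB(2)]] tfg by simp
  have "k = 0" if k: "arr k B (Sh C U)" for k
  proof -
    have "k \<cdot> p = 0" by (rule ext0D[OF bongartz_ext0[OF AV] arr_comp[OF aB(2) k]])
    then obtain l where l: "arr l (Sh C Z) (Sh C U)" "k = l \<cdot> q" using exact_contra_third[OF tB k] by blast
    obtain l0 where l0: "arr l0 Z U" "l = ShM C l0" using ShM_full[OF l(1) Z UO] by blast
    obtain s where s: "arr s U2 U" "l0 = s \<cdot> y" using U2(3)[OF l0(1)] by blast
    note ss = arr_comp[OF b(4) s(1)]
    have "l0 = (s \<cdot> s2) \<cdot> z'" using s sz comp_assoc[OF s(1) b(4) arr_into[OF z']] by simp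
    then have "l = ShM C (s \<cdot> s2) \<cdot> ShM C z'" using l0 ShM_comp[OF z' ss] by simp
    then have "k = ShM C (s \<cdot> s2) \<cdot> (ShM C z' \<cdot> q)"
      using l comp_assoc[OF arr_ShM[OF ss] arr_ShM[OF z'] arr_into[OF aB(3)]] by simp
    then show ?thesis using tri_comp_zero3[OF tB] comp_zero_right[OF arr_ShM[OF ss]] by simp
  qed
  then have "ext0 B U" using aB UO by (simp add: ext0_def)
  moreover have "U3 \<preceq> U" by (rule support_le_sum[OF U3 U1(1) U2(1)])
  ultimately have "bongartz U T0 B" unfolding bongartz_def using tB' by blast
  then show thesis using that le AV tB by blast
qed

end


section \<open>Completions under mutation\<close>

context krull_schmidt_category
begin

lemma local_le: "\<lbrakk>mult P X > 0; X \<in> Ob C\<rbrakk> \<Longrightarrow> P \<preceq> X"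
  by (rule mult_pos_split) (auto intro: support_le_summand)

lemma le_mult_zero: "\<lbrakk>Y \<preceq> X; local_End C P; P \<in> Ob C; mult P X = 0\<rbrakk> \<Longrightarrow> mult P Y = 0"
  using support_leD[of Y X P] by auto

end

context calabi_yau_category
begin

text \<open>
  Adding the trivial triangle of zero objects changes \<open>A\<close> to any isomorphic object.
\<close>

lemma bongartz_iso:
  assumes "bongartz U A B" "A \<cong> A'"
  shows "bongartz U A' B"
proof -
  obtain O0 where O0: "zero_ob C O0" using ex_zero_ob by blast
  note ob = bongartz_Ob[OF assms(1)]
  have "bongartz U O0 O0" by (rule bongartz_self[OF ext0_zero[OF O0 ob(3)]])
  moreover have "is_direct_sum C [A, O0] A'" by (rule ds_iso[OF zero_ds[OF O0 ob(1)] assms(2)])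
  ultimately show ?thesis
    using bongartz_sum[OF assms(1)] zero_ds[OF O0 ob(2)] by blast
qed

lemma bongartz_mult:
  assumes "bongartz U A B" "bongartz U A B'" "local_End C P" "P \<in> Ob C" "mult P U = 0"
  shows "mult P B = mult P B'"
proof -
  obtain V V' S where S: "V \<preceq> U" "V' \<preceq> U" "is_direct_sum C [V, B] S" "is_direct_sum C [V', B'] S"
    using bongartz_unique[OF assms(1,2)] .
  then show ?thesis
    using mult_sum[OF S(3), of P] mult_sum[OF S(4), of P] le_mult_zero[OF S(1) assms(3-5)]
      le_mult_zero[OF S(2) assms(3-5)] by simp
qed

lemma bongartz_replicate:
  assumes "bongartz U A B" "is_direct_sum C (replicate r A) S" "is_direct_sum C (replicate r B) D"
  shows "bongartz U S D"
  using assms(2,3)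
proof (induction r arbitrary: S D)
  case 0
  then have z: "zero_ob C S" "zero_ob C D" by simp_all
  have "bongartz U D D" by (rule bongartz_self[OF ext0_zero[OF z(2) bongartz_Ob(3)[OF assms(1)]]])
  then show ?case by (rule bongartz_iso[OF _ ds_unique[OF z(2,1)]])
next
  case (Suc r)
  then have "is_direct_sum C (A # replicate r A) S" "is_direct_sum C (B # replicate r B) D" by simp_all
  then obtain S' D' where S': "is_direct_sum C (replicate r A) S'" "is_direct_sum C [A, S'] S"
    and D': "is_direct_sum C (replicate r B) D'" "is_direct_sum C [B, D'] D"
    by (meson ds_ConsE)
  show ?case by (rule bongartz_sum[OF assms(1) Suc.IH[OF S'(1) D'(1)] S'(2) D'(2)])
qed

lemma ex_bongartz_containing:
  assumes "ext0 U U" "A \<in> Ob C"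
  obtains G where "bongartz U A G" "U \<preceq> G"
proof -
  obtain B where B: "bongartz U A B" using ex_bongartz assms by blast
  obtain G where G: "is_direct_sum C [B, U] G" using ex_direct_sum bongartz_Ob[OF B] by blast
  have "bongartz U A G" by (rule bongartz_add[OF assms(1) B support_le_refl G]) (rule ext0_Ob(1)[OF assms(1)])
  then show thesis using that support_le_summand(2)[OF G] by blast
qed

text \<open>
  If \<open>A \<oplus> A' = T\<^sup>r\<close>, then \<open>bongartz U\<close> relates \<open>T\<^sup>r\<close> to both \<open>G\<^sup>r\<close> and \<open>B \<oplus> B'\<close>, so these
  agree outside \<open>add(U)\<close>.
\<close>

lemma bongartz_le:
  assumes U: "ext0 U U" and G: "bongartz U T G" "U \<preceq> G" and A: "A \<preceq> T" and B: "bongartz U A B"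
  shows "B \<preceq> G"
proof -
  obtain r S A' where S: "is_direct_sum C (replicate r T) S" "is_direct_sum C [A, A'] S"
    using support_le_complement[OF A] by blast
  have "A' \<in> Ob C" using ds_Ob(2)[OF S(2)] by simp
  then obtain B' where B': "bongartz U A' B'" using ex_bongartz[OF U] by blast
  obtain D where D: "is_direct_sum C [B, B'] D" using ex_direct_sum bongartz_Ob(2)[OF B] bongartz_Ob(2)[OF B'] by blast
  obtain E where E: "is_direct_sum C (replicate r G) E" using ex_replicate bongartz_Ob(2)[OF G(1)] by blast
  have DS: "bongartz U S D" by (rule bongartz_sum[OF B B' S(2) D])
  have ES: "bongartz U S E" by (rule bongartz_replicate[OF G(1) S(1) E])
  have "mult P G > 0" if P: "P \<in> Ob C" "local_End C P" "mult P B > 0" for P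
  proof (cases "mult P U > 0")
    case True
    then show ?thesis using support_leD[OF G(2) P(2,1)] by simp
  next
    case False
    then have "r * mult P G = mult P B + mult P B'"
      using bongartz_mult[OF DS ES P(2,1)] mult_sum[OF D] mult_replicate[OF E] by simp
    then show ?thesis using P(3) by (cases "mult P G") auto
  qed
  then show ?thesis using bongartz_Ob(2)[OF G(1)] bongartz_Ob(2)[OF B] by (auto simp: support_le_def)
qed

text \<open>
  The triangle of \<open>bongartz_coresolution\<close> splits when \<open>X\<close> has no extensions with \<open>G\<close>, because its third
  object lies in \<open>add(G)\<close>.
\<close>

lemma bongartz_split:
  assumes T: "tilting T" and U: "ext0 U U" and G: "bongartz U T G" "U \<preceq> G"
    and XU: "ext0 X U" and GX: "ext0 G X"
  obtains A T\<^sub>0 V B where "A \<preceq> T" "T\<^sub>0 \<preceq> T" "bongartz U A V" "bongartz U T\<^sub>0 B" "is_direct_sum C [X, B] V"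
proof -
  obtain A T0 V B z p q where c: "A \<preceq> T" "T0 \<preceq> T" "bongartz U A V" "bongartz U T0 B" "tri X V B z p q"
    using bongartz_coresolution[OF T U XU] by blast
  have "ext0 B X" by (rule ext0_le_left[OF bongartz_le[OF U G c(2,4)] GX])
  then have "q = 0" by (rule ext0D) (rule triD(3)[OF c(5)])
  then have "is_direct_sum C [X, B] V" using tri_split c(5) by simp
  then show thesis using that c by blast
qed

lemma tilting_bongartz:
  assumes T: "tilting T" and U: "ext0 U U" and G: "bongartz U T G" "U \<preceq> G"
  shows "tilting G"
proof -
  have GG: "ext0 G G" by (rule bongartz_ext0_pair[OF G(1) G(1)]) (use T in \<open>simp add: tilting_def\<close>)
  have "X \<preceq> G" if GX: "ext0 G X" for X
  proof -
    have "ext0 X U" by (rule ext0_sym[OF ext0_le_left[OF G(2) GX]])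
    then obtain A T0 V B where c: "A \<preceq> T" "T0 \<preceq> T" "bongartz U A V" "bongartz U T0 B" "is_direct_sum C [X, B] V"
      using bongartz_split[OF T U G _ GX] by blast
    show ?thesis by (rule support_le_trans[OF support_le_summand(1)[OF c(5)] bongartz_le[OF U G c(1,3)]])
  qed
  then show ?thesis using GG by (simp add: tilting_def)
qed

lemma tilting_le:
  assumes "tilting G" "N \<preceq> G" "G \<preceq> N"
  shows "tilting N"
  using assms ext0_le_left[OF assms(2)] ext0_le_right[OF assms(2)] ext0_le_left[OF assms(3)]
    support_le_trans[OF _ assms(3)] unfolding tilting_def by blast

text \<open>
  A cluster tilting object is maximal among rigid objects with respect to \<open>add\<close>.
\<close>

lemma tilting_basic_iso:
  assumes "tilting N" "tilting N'" "basic_ob C N" "basic_ob C N'" "N \<preceq> N'"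
  shows "N \<cong> N'"
proof -
  have "ext0 N N'" using ext0_le_left[OF assms(5)] assms(2) by (simp add: tilting_def)
  then have "N' \<preceq> N" using assms(1) by (simp add: tilting_def)
  then show ?thesis using basic_iso assms by blast
qed

text \<open>
  Outside the part that comes from \<open>W\<close>, the completion of an object \<open>A \<in> add(W \<oplus> X)\<close> only depends on
  how often \<open>X\<close> occurs in \<open>A\<close>.  This is seen one indecomposable summand of \<open>A\<close> at a time.
\<close>

lemma bongartz_linear:
  assumes U: "ext0 U U" and T: "is_direct_sum C [W, X] T" and X: "local_End C X" "X \<in> Ob C"
    and GW: "bongartz U W G\<^sub>W" "U \<preceq> G\<^sub>W" and BX: "bongartz U X B\<^sub>X"
    and Q: "local_End C Q" "Q \<in> Ob C" "mult Q G\<^sub>W = 0"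
    and A: "A \<preceq> T" "bongartz U A V"
  shows "mult Q V = mult X A * mult Q B\<^sub>X"
proof -
  have QU: "mult Q U = 0" by (rule le_mult_zero[OF GW(2) Q])
  obtain As where "is_direct_sum C As A" "\<forall>P \<in> set As. local_End C P"
    using support_le_Ob(1)[OF A(1)] by (rule ex_local_decomposition)
  then show ?thesis using A
  proof (induction As arbitrary: A V)
    case Nil
    have "bongartz U A A" by (rule bongartz_self[OF ext0_zero[OF Nil(1) ext0_Ob(1)[OF U]]])
    then have "mult Q V = mult Q A" by (rule bongartz_mult[OF Nil(4) _ Q(1,2) QU])
    then show ?case using mult_zero[OF Nil(1)] by simp
  next
    case (Cons P Ps)
    obtain A' where A': "is_direct_sum C Ps A'" "is_direct_sum C [P, A'] A"
      using Cons.prems(1) by (rule ds_ConsE)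
    have P: "local_End C P" "P \<in> Ob C" "A' \<in> Ob C" using Cons.prems(2) ds_Ob(2)[OF A'(2)] by auto
    obtain B1 where B1: "bongartz U P B1" using ex_bongartz[OF U P(2)] by blast
    obtain V' where V': "bongartz U A' V'" using ex_bongartz[OF U P(3)] by blast
    obtain D where D: "is_direct_sum C [B1, V'] D" using ex_direct_sum bongartz_Ob(2) B1 V' by blast
    have "mult Q V = mult Q D"
      by (rule bongartz_mult[OF Cons.prems(4) bongartz_sum[OF B1 V' A'(2) D] Q(1,2) QU])
    also have "\<dots> = mult Q B1 + mult Q V'" by (rule mult_sum[OF D])
    also have "mult Q V' = mult X A' * mult Q B\<^sub>X"
      using Cons.IH[OF A'(1) _ support_le_trans[OF support_le_summand(2)[OF A'(2)] Cons.prems(3)] V'] Cons.prems(2)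
      by simp
    also have "mult Q B1 = mult X P * mult Q B\<^sub>X"
    proof (cases "X \<cong> P")
      case True
      then have "mult Q B1 = mult Q B\<^sub>X" by (intro bongartz_mult[OF B1 bongartz_iso[OF BX] Q(1,2) QU])
      then show ?thesis using True mult_local[OF P(1,2)] by simp
    next
      case False
      have "mult P T > 0"
        using support_leD[OF support_le_trans[OF support_le_summand(1)[OF A'(2)] Cons.prems(3)] P(1,2)] mult_self[OF P(1,2)] by simp
      moreover have "mult P X = 0" using mult_local[OF X, of P] False iso_sym by auto
      ultimately have "P \<preceq> W" using mult_sum[OF T, of P] local_le ds_Ob(2)[OF T] by simp
      then have "B1 \<preceq> G\<^sub>W" by (rule bongartz_le[OF U GW _ B1])
      then show ?thesis using le_mult_zero[OF _ Q] mult_local[OF P(1,2), of X] False by simp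
    qed
    finally show ?case using mult_sum[OF A'(2), of X] by (simp add: algebra_simps)
  qed
qed

text \<open>
  For \<open>P\<close> in the completion the split triangle \<open>V \<cong> P \<oplus> B\<close> and \<open>bongartz_linear\<close> give
  \<open>a \<cdot> m\<^sub>R = [R \<cong> P] + b \<cdot> m\<^sub>R\<close> for every \<open>R\<close> outside \<open>add(G\<^sub>W)\<close>, where \<open>m\<^sub>R\<close> is the multiplicity in \<open>B\<^sub>X\<close>.
  With \<open>R = Q\<close> not isomorphic to \<open>P\<close> and \<open>m\<^sub>Q > 0\<close> this says \<open>a = b\<close>, which is impossible for \<open>R = P\<close>.
\<close>

lemma bongartz_new_summand_unique:
  assumes U: "ext0 U U" and tT: "tilting T" and T: "is_direct_sum C [W, X] T" and X: "local_End C X" "X \<in> Ob C"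
    and GW: "bongartz U W G\<^sub>W" "U \<preceq> G\<^sub>W" and BX: "bongartz U X B\<^sub>X" and G: "is_direct_sum C [G\<^sub>W, B\<^sub>X] G"
    and P: "local_End C P" "P \<in> Ob C" "mult P G > 0" "mult P G\<^sub>W = 0"
    and Q: "local_End C Q" "Q \<in> Ob C" "mult Q G > 0" "mult Q G\<^sub>W = 0"
  shows "Q \<cong> P"
proof (rule ccontr)
  assume n: "\<not> Q \<cong> P"
  have TG: "bongartz U T G" by (rule bongartz_sum[OF GW(1) BX T G])
  have UG: "U \<preceq> G" by (rule support_le_trans[OF GW(2) support_le_summand(1)[OF G]])
  have PG: "P \<preceq> G" by (rule local_le[OF P(3) bongartz_Ob(2)[OF TG]])
  have GG: "ext0 G G" using tilting_bongartz[OF tT U TG UG] by (simp add: tilting_def)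
  obtain A T0 V B where c: "A \<preceq> T" "T0 \<preceq> T" "bongartz U A V" "bongartz U T0 B" "is_direct_sum C [P, B] V"
    using bongartz_split[OF tT U TG UG ext0_le_left[OF PG bongartz_ext0[OF TG]] ext0_le_right[OF PG GG]] by blast
  have lin: "mult X A * mult R B\<^sub>X = mult R P + mult X T0 * mult R B\<^sub>X"
    if R: "local_End C R" "R \<in> Ob C" "mult R G\<^sub>W = 0" for R
    using bongartz_linear[OF U T X GW BX R c(1,3)] bongartz_linear[OF U T X GW BX R c(2,4)] mult_sum[OF c(5), of R] by simp
  have "mult Q P = 0" using n mult_local[OF P(1,2), of Q] by simp
  moreover have "mult Q B\<^sub>X > 0" using Q mult_sum[OF G, of Q] by simp
  ultimately have "mult X A = mult X T0" using lin[OF Q(1,2,4)] by simp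
  then show False using lin[OF P(1,2,4)] mult_self[OF P(1,2)] by simp
qed

text \<open>
  The basic object is compared with \<open>G\<close> through \<open>add\<close>, since \<open>G\<close> is determined by \<open>T\<close> up to summands in
  \<open>add(U)\<close> and in general has repeated summands.
\<close>

definition completion :: "'o \<Rightarrow> 'o \<Rightarrow> 'o \<Rightarrow> bool" where
  "completion U T N \<longleftrightarrow> basic_ob C N \<and> (\<exists>G. bongartz U T G \<and> U \<preceq> G \<and> N \<preceq> G \<and> G \<preceq> N)"

lemma completion_tilting:
  "\<lbrakk>tilting T; ext0 U U; completion U T N\<rbrakk> \<Longrightarrow> tilting N"
  unfolding completion_def using tilting_bongartz tilting_le by blast

lemma completion_unique:
  assumes "ext0 U U" "completion U T N" "completion U T N'"
  shows "N \<cong> N'"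
proof -
  obtain G where G: "basic_ob C N" "bongartz U T G" "U \<preceq> G" "N \<preceq> G" "G \<preceq> N"
    using assms(2) by (auto simp: completion_def)
  obtain G' where G': "basic_ob C N'" "bongartz U T G'" "U \<preceq> G'" "N' \<preceq> G'" "G' \<preceq> N'"
    using assms(3) by (auto simp: completion_def)
  note T = support_le_refl[OF bongartz_Ob(1)[OF G(2)]]
  have "G \<preceq> G'" "G' \<preceq> G"
    using bongartz_le[OF assms(1) G(2,3) T G'(2)] bongartz_le[OF assms(1) G'(2,3) T G(2)] by auto
  then show ?thesis using basic_iso[OF G(1) G'(1)] support_le_trans G(4,5) G'(4,5) by blast
qed

lemma mutation_iso_source:
  assumes "mutation C P N N'" "N\<^sub>0 \<cong> N" "basic_ob C N\<^sub>0" "cluster_tilting C N\<^sub>0"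
  shows "mutation C P N\<^sub>0 N'"
  using assms(1,3,4) ds_iso[OF _ iso_sym[OF assms(2)]] unfolding mutation_def by blast

text \<open>
  \<open>Q\<close> and \<open>N\<close> are the basic versions of \<open>G\<^sub>W\<close> and \<open>G\<close>, and \<open>P\<close> is the only summand of \<open>G\<close> that \<open>G\<^sub>W\<close> lacks.
\<close>

lemma exchange_decomposition:
  assumes G: "G\<^sub>W \<preceq> G"
    and P: "local_End C P" "P \<in> Ob C" "mult P G > 0" "mult P G\<^sub>W = 0"
    and uni: "\<And>R. \<lbrakk>local_End C R; R \<in> Ob C; mult R G > 0; mult R G\<^sub>W = 0\<rbrakk> \<Longrightarrow> R \<cong> P"
    and N: "basic_ob C N" "N \<preceq> G" "G \<preceq> N" and Q: "basic_ob C Q" "Q \<preceq> G\<^sub>W" "G\<^sub>W \<preceq> Q"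
  shows "is_direct_sum C [Q, P] N"
proof (rule ds_if_mult)
  fix R assume R: "local_End C R" "R \<in> Ob C"
  have 1: "mult R N \<le> 1" "mult R Q \<le> 1" using N Q R by (auto simp: basic_iff)
  have 2: "mult R N > 0 \<longleftrightarrow> mult R G > 0" "mult R Q > 0 \<longleftrightarrow> mult R G\<^sub>W > 0"
    using support_leD[OF _ R] N Q by blast+
  have 3: "mult R G > 0" if "mult R G\<^sub>W > 0" using support_leD[OF G R that] .
  have 4: "mult R P = (if R \<cong> P then 1 else 0)" by (rule mult_local[OF P(1,2)])
  show "mult R N = mult R Q + mult R P"
  proof (cases "R \<cong> P")
    case True
    then have "mult R G > 0" "mult R G\<^sub>W = 0" using P mult_iso_left[OF True] by auto
    then show ?thesis using 1 2 4 True by simp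
  next
    case False
    then have "mult R G > 0 \<longleftrightarrow> mult R G\<^sub>W > 0" using uni[OF R] 3 by auto
    then show ?thesis using 1 2 4 False by (cases "mult R N"; cases "mult R Q") auto
  qed
qed (use P N Q in \<open>auto simp: basic_ob_def\<close>)

text \<open>
  The completions of \<open>T = W \<oplus> Y\<close> and \<open>T' = W \<oplus> Y'\<close> share the part \<open>G\<^sub>W\<close>, and each has at most one
  indecomposable summand outside it.  If one of them has none, or if both have the same, then one
  completion lies in \<open>add\<close> of the other and they are isomorphic, being cluster tilting.  Otherwise they
  are \<open>Q \<oplus> P\<close> and \<open>Q \<oplus> P'\<close> with \<open>P\<close> and \<open>P'\<close> not isomorphic, which is a mutation at \<open>P\<close>; and \<open>P\<close> is not in \<open>add(U)\<close> because \<open>U\<close>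
  belongs to the common part.
\<close>

lemma completion_mutation:
  assumes U: "ext0 U U" and mut: "mutation C Y T T'" and N: "completion U T N"
  obtains N' where "completion U T' N'" "N \<cong> N' \<or> (\<exists>P. P \<notin> add_of C U \<and> mutation C P N N')"
proof -
  note UO = ext0_Ob(1)[OF U]
  obtain W Y' where T: "tilting T" "tilting T'" "is_direct_sum C [W, Y] T" "is_direct_sum C [W, Y'] T'"
    and Y: "local_End C Y" "Y \<in> Ob C" and Y': "local_End C Y'" "Y' \<in> Ob C"
    using mut unfolding mutation_def indecomposable_iff tilting_iff by blast
  have W: "W \<in> Ob C" using ds_Ob(2)[OF T(3)] by simp
  obtain GW where GW: "bongartz U W GW" "U \<preceq> GW" using ex_bongartz_containing[OF U W] .
  obtain B where B: "bongartz U Y B" using ex_bongartz[OF U Y(2)] by blast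
  obtain B' where B': "bongartz U Y' B'" using ex_bongartz[OF U Y'(2)] by blast
  obtain G where G: "is_direct_sum C [GW, B] G" using ex_direct_sum bongartz_Ob(2) GW(1) B by blast
  obtain G' where G': "is_direct_sum C [GW, B'] G'" using ex_direct_sum bongartz_Ob(2) GW(1) B' by blast
  note le = support_le_summand(1)[OF G] and le' = support_le_summand(1)[OF G']
  have TG: "bongartz U T G" and TG': "bongartz U T' G'"
    by (rule bongartz_sum[OF GW(1) B T(3) G] bongartz_sum[OF GW(1) B' T(4) G'])+
  have UG: "U \<preceq> G" and UG': "U \<preceq> G'"
    by (rule support_le_trans[OF GW(2) le] support_le_trans[OF GW(2) le'])+
  have tG: "tilting G" and tG': "tilting G'"
    by (rule tilting_bongartz[OF T(1) U TG UG] tilting_bongartz[OF T(2) U TG' UG'])+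
  note uni = bongartz_new_summand_unique[OF U T(1) T(3) Y GW B G]
  note uni' = bongartz_new_summand_unique[OF U T(2) T(4) Y' GW B' G']
  obtain N1 where N1: "basic_ob C N1" "N1 \<preceq> G" "G \<preceq> N1" using ex_basic support_le_Ob(2)[OF le] by blast
  obtain N' where N': "basic_ob C N'" "N' \<preceq> G'" "G' \<preceq> N'" using ex_basic support_le_Ob(2)[OF le'] by blast
  obtain Q where Q: "basic_ob C Q" "Q \<preceq> GW" "GW \<preceq> Q" using ex_basic support_le_Ob(1)[OF le] by blast
  have tN: "tilting N1" and tN': "tilting N'"
    by (rule tilting_le[OF tG N1(2,3)] tilting_le[OF tG' N'(2,3)])+
  have cN': "completion U T' N'" using N' TG' UG' by (auto simp: completion_def)
  have "completion U T N1" using N1 TG UG by (auto simp: completion_def)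
  then have NN1: "N \<cong> N1" by (rule completion_unique[OF U N])
  have iso1: "N1 \<cong> N'" if "G \<preceq> G'"
    using tilting_basic_iso[OF tN tN' N1(1) N'(1)] support_le_trans N1(2) N'(3) that by blast
  have iso2: "N1 \<cong> N'" if "G' \<preceq> G"
    using iso_sym[OF tilting_basic_iso[OF tN' tN N'(1) N1(1)]] support_le_trans N'(2) N1(3) that by blast
  have "N1 \<cong> N' \<or> (\<exists>P. P \<notin> add_of C U \<and> mutation C P N1 N')"
  proof (cases "G \<preceq> GW \<or> G' \<preceq> GW")
    case True
    then show ?thesis using iso1 iso2 support_le_trans le le' by blast
  next
    case False
    obtain P where P: "local_End C P" "P \<in> Ob C" "mult P G > 0" "mult P GW = 0"
      using False support_le_Ob[OF le] by (auto simp: support_le_def)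
    obtain P' where P': "local_End C P'" "P' \<in> Ob C" "mult P' G' > 0" "mult P' GW = 0"
      using False support_le_Ob[OF le'] by (auto simp: support_le_def)
    show ?thesis
    proof (cases "P \<cong> P'")
      case True
      have "mult R G' > 0" if R: "R \<in> Ob C" "local_End C R" "mult R G > 0" for R
      proof (cases "mult R GW = 0")
        case z: True
        have "R \<cong> P'" using uni[OF P R(2,1,3) z] True by (rule iso_trans)
        then show ?thesis using P'(3) mult_iso_left by metis
      next
        case False
        then show ?thesis using support_leD[OF le' R(2,1)] by simp
      qed
      then have "G \<preceq> G'" using support_le_Ob(2)[OF le] support_le_Ob(2)[OF le'] by (simp add: support_le_def)
      then show ?thesis using iso1 by blast
    next
      case n: False
      have d: "is_direct_sum C [Q, P] N1"
        by (rule exchange_decomposition[OF le P _ N1 Q]) (rule uni[OF P])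
      have d': "is_direct_sum C [Q, P'] N'"
        by (rule exchange_decomposition[OF le' P' _ N' Q]) (rule uni'[OF P'])
      have QO: "Q \<in> Ob C" using Q(1) by (simp add: basic_ob_def)
      have nQ: "P \<notin> add_of C Q"
        using support_leD[of P Q P] support_leD[OF Q(2), of P] mult_self[OF P(1,2)] P add_of_iff[OF QO] by auto
      have nU: "P \<notin> add_of C U"
        using support_leD[of P U P] support_leD[OF GW(2), of P] mult_self[OF P(1,2)] P add_of_iff[OF UO] by auto
      have "almost_cluster_tilting C Q"
        unfolding almost_cluster_tilting_def tilting_iff indecomposable_iff using QO P nQ d tN by blast
      then have "mutation C P N1 N'"
        unfolding mutation_def tilting_iff indecomposable_iff
        using N1(1) N'(1) Q(1) tN tN' P P' n d d' by blast
      then show ?thesis using nU by blast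
    qed
  qed
  then have "N \<cong> N' \<or> (\<exists>P. P \<notin> add_of C U \<and> mutation C P N N')"
    using iso_trans[OF NN1] mutation_iso_source[OF _ NN1] N completion_tilting[OF T(1) U N]
    by (auto simp: completion_def tilting_iff)
  then show thesis using that cN' by blast
qed

lemma mutation_seq_iso_source:
  assumes "mutation_seq C Ps N N'" "N\<^sub>0 \<cong> N" "basic_ob C N\<^sub>0" "cluster_tilting C N\<^sub>0"
  shows "mutation_seq C Ps N\<^sub>0 N'"
  using assms by (cases Ps) (auto intro: iso_trans mutation_iso_source)

lemma completion_mutation_seq:
  assumes "ext0 U U" "mutation_seq C Ys T T'" "completion U T N" "completion U T' N'"
  shows "\<exists>Ps. mutation_seq C Ps N N' \<and> (\<forall>P \<in> set Ps. P \<notin> add_of C U)"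
  using assms(2,3)
proof (induction Ys arbitrary: T N)
  case Nil
  then have "T \<cong> T'" by simp
  then have "completion U T' N" using Nil(2) bongartz_iso unfolding completion_def by blast
  then have "N \<cong> N'" by (rule completion_unique[OF assms(1) _ assms(4)])
  then show ?case by (intro exI[of _ "[]"]) simp
next
  case (Cons Y Ys)
  then obtain T1 where T1: "mutation C Y T T1" "mutation_seq C Ys T1 T'" by auto
  obtain N1 where N1: "completion U T1 N1" "N \<cong> N1 \<or> (\<exists>P. P \<notin> add_of C U \<and> mutation C P N N1)"
    using completion_mutation[OF assms(1) T1(1) Cons.prems(2)] .
  obtain Ps where Ps: "mutation_seq C Ps N1 N'" "\<forall>P \<in> set Ps. P \<notin> add_of C U"
    using Cons.IH[OF T1(2) N1(1)] by blast
  have "tilting T" using T1(1) by (simp add: mutation_def tilting_iff)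
  then have N: "basic_ob C N" "cluster_tilting C N"
    using completion_tilting[OF _ assms(1)] Cons.prems(2) by (auto simp: completion_def tilting_iff)
  from N1(2) show ?case
  proof
    assume "N \<cong> N1"
    then show ?thesis using mutation_seq_iso_source[OF Ps(1) _ N] Ps(2) by blast
  next
    assume "\<exists>P. P \<notin> add_of C U \<and> mutation C P N N1"
    then obtain P where "P \<notin> add_of C U" "mutation C P N N1" by blast
    then show ?thesis using Ps by (intro exI[of _ "P # Ps"]) auto
  qed
qed

text \<open>
  If \<open>U \<in> add(T)\<close>, then \<open>Hom(T, U[1]) = 0\<close> and \<open>T\<close> is its own Bongartz completion.
\<close>

lemma completion_self:
  assumes "tilting T" "U \<preceq> T" "basic_ob C N" "N \<preceq> T" "T \<preceq> N"
  shows "completion U T N"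
proof -
  have "ext0 T U" using ext0_le_right[OF assms(2)] assms(1) by (simp add: tilting_def)
  then show ?thesis using bongartz_self assms unfolding completion_def by blast
qed

end

theorem theorem4p2p4:
  fixes C :: "('k::field, 'o, 'm::ab_group_add) tricat"
    and n :: nat
    and Ts Ms :: "'o list"
    and T M U :: 'o
  assumes "triangulated_klinear_category C"
    and "krull_schmidt C"
    and "hom_finite C"
    and "two_calabi_yau C"
    and "length Ts = n" and "\<forall>X \<in> set Ts. indecomposable_ob C X" and "is_direct_sum C Ts T"
    and "basic_ob C T" and "cluster_tilting C T"
    and "length Ms = n" and "\<forall>X \<in> set Ms. indecomposable_ob C X" and "is_direct_sum C Ms M"
    and "basic_ob C M" and "cluster_tilting C M"
    and "maximal_common_summand C T M U"
    and "mutation_reachable C T M"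
  shows "\<exists>Ys. mutation_seq C Ys T M \<and> (\<forall>Y \<in> set Ys. Y \<notin> add_of C U)"
proof -
  interpret triangulated_klinear_category C by fact
  interpret calabi_yau_category C
    by unfold_locales fact+
  have T: "tilting T" and M: "tilting M"
    using \<open>cluster_tilting C T\<close> \<open>cluster_tilting C M\<close> by (simp_all add: tilting_iff)
  have UT: "U \<preceq> T" and UM: "U \<preceq> M"
    using \<open>maximal_common_summand C T M U\<close> add_of_iff[OF tilting_Ob[OF T]] add_of_iff[OF tilting_Ob[OF M]]
    by (simp_all add: maximal_common_summand_def)
  have TT: "ext0 T T" using T by (simp add: tilting_def)
  have U: "ext0 U U" by (rule ext0_le_left[OF UT ext0_le_right[OF UT TT]])
  obtain N Zs where N: "basic_ob C N" "tilting N" "M \<in> add_of C N" "mutation_seq C Zs T N"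
    using \<open>mutation_reachable C T M\<close> unfolding mutation_reachable_def tilting_iff by blast
  have MN: "M \<preceq> N" using N(3) add_of_iff[OF tilting_Ob[OF N(2)]] by simp
  have "M \<cong> N" by (rule tilting_basic_iso[OF M N(2) \<open>basic_ob C M\<close> N(1) MN])
  then have NM: "N \<preceq> M" using mult_iso[OF \<open>M \<cong> N\<close>] iso_Ob by (simp add: support_le_def)
  have "completion U T T"
    by (rule completion_self[OF T UT \<open>basic_ob C T\<close>]) (rule support_le_refl[OF tilting_Ob[OF T]])+
  moreover have "completion U N M"
    by (rule completion_self[OF N(2) support_le_trans[OF UM MN] \<open>basic_ob C M\<close> MN NM])
  ultimately show ?thesis using completion_mutation_seq[OF U N(4)] by blast
qed

end
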